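(* Let $F$ be a field and let $Q$ be a quiver of type $\tilde{A}_n$. An indecomposable $R\in\mathrm{rep}(Q,\mathbf{vect}_F)$ is in the additive image of the functor $\mathtt{free}_*\colon\mathrm{rep}(Q,\mathbf{set})\to\mathrm{rep}(Q,\mathbf{vect}_F)$ if and only if \begin{itemize} \item $R$ is a string representation, or \item $R$ is a band representation with $V\cong F[X]/(f(X)^m)$ where \begin{enumerate} \item $f(X)$ is the minimal polynomial (over $F$) of a root of unity, \item the number $m$ satisfies $m=1$ if $\mathrm{char}(F)=0$, and $m=\mathrm{char}(F)^k$ for some non-negative integer $k$ if $\mathrm{char}(F)>0$, \item the isomorphism $\phi\colon V\to V$ in the definition of a band representation is given by $\phi(q)=X\cdot q$. \end{enumerate} \end{itemize}
   Context: A quiver of type $\tilde{A}_n$ has vertices $\circ_0,\dots,\circ_n$ and arrows $\alpha_0,\dots,\alpha_n$, where $\alpha_i$ connects $\circ_i$ and $\circ_{i+1}$ (indices modulo $n+1$), with an arbitrary orientation of each arrow. A quiver is identified with its path category; $\mathrm{rep}(Q,C)$ is the category of functors $Q\to C$. $\mathbf{set}$, $\mathbf{set}^{\mathrm{pt}}$, $\mathbf{vect}_F$ are the categories of finite sets, finite pointed sets and finite-dimensional $F$-vector spaces. $\mathtt{free}$ sends a set to the free vector space on it; $\mathtt{free}_*(S)=\mathtt{free}\circ S$. $\mathtt{free}^{\mathrm{pt}}$ sends a pointed set $(S,* )$ to the free vector space on $S\setminus\{*\}$, with elements mapped to $*$ being sent to $0$. The additive image of a functor $T\colon A\to B$ with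 $B$ additive consists of all finite direct sums of direct summands of objects isomorphic to some $T(Z)$, $Z\in A$. String representations: representations isomorphic to $\mathtt{free}^{\mathrm{pt}}\circ S_\gamma$, with $S_\gamma\in\mathrm{rep}(Q,\mathbf{set}^{\mathrm{pt}})$ defined as follows. Let $\gamma\colon\{1,\dots,m\}\to Q_0$ (the vertex set, identified with $\mathbb{Z}/(n+1)$) be an undirected path moving clockwise around $Q$, i.e. $\gamma(l)=c+l$ modulo $n+1$ for a constant $c$. Put $S_\gamma(v)=\gamma^{-1}(v)\cup\{*\}$. For $1\le l<m$, the arrow $\alpha_{\gamma(l)}$ maps $l\mapsto l+1$ or $l+1\mapsto l$, according to whether it points from $\circ_{\gamma(l)}$ to $\circ_{\gamma(l+1)}$ or conversely. At the ends: if $\alpha_{\gamma(1)-1}$ is oriented outward from $\circ_{\gamma(1)}$ then $S_\gamma(\alpha_{\gamma(1)-1})(1)=*$, and if $\alpha_{\gamma(m)}$ is oriented outward from $\circ_{\gamma(m)}$ then $S_\gamma(\alpha_{\gamma(m)})(m)=*$. Band representations: representations isomorphic to one assigning a finite-dimensional vector space $V$ to every vertex, the identity to each of $\alpha_0,\dots,\alpha_{n-1}$, and an isomorphism $\phi\colon V\to V$ to $\alpha_n$, where $(V,\phi)$ is an indecomposable representation of the quiver with one vertex and one loop; equivalently $V=F[X]/(p(X)^m)$ for a monic irreducible polynomial $p$ with $\phi(q)=X\cdot q$ (and $\phi$ invertible). *)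

theory Defs
  imports
    "Graph_Theory.Digraph"
    "HOL-Library.Function_Algebras"
    "HOL-Library.FuncSet"
    "HOL-Computational_Algebra.Polynomial"
    "HOL-Algebra.Algebraic_Closure_Type"
begin

section \<open>Quivers of extended type A\<close>

text \<open>
  A quiver is a directed multigraph. Its path category is free, so a functor out of it is given
  by its values on vertices and arrows; representations below are stored in this form.

  The arrow \<open>i\<close> joins \<open>i\<close> and \<open>i + 1\<close> modulo \<open>n + 1\<close>; it points from \<open>i\<close> to \<open>i + 1\<close> iff
  \<open>fwd i\<close>. For \<open>n = 0\<close> this is a single loop, whichever value \<open>fwd\<close> has.
\<close>

definition cyc_quiver :: "nat \<Rightarrow> (nat \<Rightarrow> bool) \<Rightarrow> (nat, nat) pre_digraph" where
  "cyc_quiver n fwd =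
    \<lparr> verts = {..n}, arcs = {..n},
      tail = (\<lambda>i. if fwd i then i else (i + 1) mod (n + 1)),
      head = (\<lambda>i. if fwd i then (i + 1) mod (n + 1) else i) \<rparr>"

abbreviation loop_quiver :: "(nat, nat) pre_digraph" where
  "loop_quiver \<equiv> cyc_quiver 0 (\<lambda>_. True)"

section \<open>Linear representations\<close>

text \<open>
  The vector spaces at the vertices are subspaces of one ambient vector space \<open>'v\<close> with scalar
  multiplication \<open>vscale\<close>. This is no restriction, as any family of vector spaces embeds into its
  direct sum. The value of \<open>vmap R a\<close> outside the space at the tail of \<open>a\<close> is irrelevant.
\<close>

record ('q, 'a, 'f, 'v) vrep =
  vscale :: "'f \<Rightarrow> 'v \<Rightarrow> 'v"
  vobj :: "'q \<Rightarrow> 'v set"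
  vmap :: "'a \<Rightarrow> 'v \<Rightarrow> 'v"

definition linear_betw ::
  "('f \<Rightarrow> 'v \<Rightarrow> 'v) \<Rightarrow> ('f \<Rightarrow> 'w \<Rightarrow> 'w) \<Rightarrow> 'v::ab_group_add set \<Rightarrow> 'w::ab_group_add set \<Rightarrow> ('v \<Rightarrow> 'w) \<Rightarrow> bool"
where
  "linear_betw s t V W h \<longleftrightarrow> h ` V \<subseteq> W \<and>
     (\<forall>x\<in>V. \<forall>y\<in>V. h (x + y) = h x + h y) \<and> (\<forall>c. \<forall>x\<in>V. h (s c x) = t c (h x))"

definition is_vrep ::
  "('q, 'a) pre_digraph \<Rightarrow> ('q, 'a, 'f::field, 'v::ab_group_add) vrep \<Rightarrow> bool" where
  "is_vrep Q R \<longleftrightarrow> vector_space (vscale R) \<and>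
     (\<forall>q\<in>verts Q. \<exists>B. finite B \<and> vobj R q = module.span (vscale R) B) \<and>
     (\<forall>a\<in>arcs Q. linear_betw (vscale R) (vscale R)
        (vobj R (tail Q a)) (vobj R (head Q a)) (vmap R a))"

definition vrep_iso ::
  "('q, 'a) pre_digraph \<Rightarrow> ('q, 'a, 'f::field, 'v::ab_group_add) vrep \<Rightarrow>
     ('q, 'a, 'f, 'w::ab_group_add) vrep \<Rightarrow> bool" where
  "vrep_iso Q R S \<longleftrightarrow> (\<exists>h.
     (\<forall>q\<in>verts Q. linear_betw (vscale R) (vscale S) (vobj R q) (vobj S q) (h q) \<and>
        bij_betw (h q) (vobj R q) (vobj S q)) \<and>
     (\<forall>a\<in>arcs Q. \<forall>x\<in>vobj R (tail Q a).
        h (head Q a) (vmap R a x) = vmap S a (h (tail Q a) x)))"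

text \<open>Restriction of a representation to a family of subspaces.\<close>

abbreviation vrestrict ::
  "('q, 'a, 'f::field, 'v::ab_group_add) vrep \<Rightarrow> ('q \<Rightarrow> 'v set) \<Rightarrow> ('q, 'a, 'f, 'v) vrep" where
  "vrestrict R U \<equiv> R\<lparr>vobj := U\<rparr>"

definition subrep ::
  "('q, 'a) pre_digraph \<Rightarrow> ('q, 'a, 'f::field, 'v::ab_group_add) vrep \<Rightarrow> ('q \<Rightarrow> 'v set) \<Rightarrow> bool" where
  "subrep Q R U \<longleftrightarrow> (\<forall>q\<in>verts Q. U q \<subseteq> vobj R q) \<and> is_vrep Q (vrestrict R U)"

text \<open>
  Direct sums are internal: \<open>R\<close> is the direct sum of its subrepresentations \<open>U i\<close>, \<open>i < k\<close>.
  Up to isomorphism of the summands this is the same as being isomorphic to an external direct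
  sum. The case \<open>k = 0\<close> means that \<open>R\<close> is zero.
\<close>

definition direct_sum ::
  "('q, 'a) pre_digraph \<Rightarrow> ('q, 'a, 'f::field, 'v::ab_group_add) vrep \<Rightarrow> nat \<Rightarrow>
     (nat \<Rightarrow> 'q \<Rightarrow> 'v set) \<Rightarrow> bool" where
  "direct_sum Q R k U \<longleftrightarrow> (\<forall>i<k. subrep Q R (U i)) \<and>
     (\<forall>q\<in>verts Q. \<forall>x\<in>vobj R q. \<exists>!y. y \<in> (\<Pi>\<^sub>E i\<in>{..<k}. U i q) \<and> x = (\<Sum>i<k. y i))"

definition zero_family :: "('q, 'a) pre_digraph \<Rightarrow> ('q \<Rightarrow> 'v::zero set) \<Rightarrow> bool" where
  "zero_family Q U \<longleftrightarrow> (\<forall>q\<in>verts Q. U q = {0})"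

definition indecomposable ::
  "('q, 'a) pre_digraph \<Rightarrow> ('q, 'a, 'f::field, 'v::ab_group_add) vrep \<Rightarrow> bool" where
  "indecomposable Q R \<longleftrightarrow> is_vrep Q R \<and> \<not> zero_family Q (vobj R) \<and>
     (\<forall>U. direct_sum Q R 2 U \<longrightarrow> zero_family Q (U 0) \<or> zero_family Q (U 1))"

text \<open>\<open>D\<close> is isomorphic to a direct summand of \<open>E\<close>, that is, \<open>D \<oplus> D' \<cong> E\<close> for some \<open>D'\<close>.\<close>

definition direct_summand ::
  "('q, 'a) pre_digraph \<Rightarrow> ('q, 'a, 'f::field, 'v::ab_group_add) vrep \<Rightarrow>
     ('q, 'a, 'f, 'w::ab_group_add) vrep \<Rightarrow> bool" where
  "direct_summand Q D E \<longleftrightarrow> (\<exists>U. direct_sum Q E 2 U \<and> vrep_iso Q D (vrestrict E (U 0)))"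

text \<open>
  Additive image of a functor \<open>T\<close> with object class \<open>A\<close> and values in representations: finite
  direct sums of direct summands of objects isomorphic to some \<open>T Z\<close>.
\<close>

definition in_additive_image ::
  "('q, 'a) pre_digraph \<Rightarrow> ('z \<Rightarrow> ('q, 'a, 'f::field, 'w::ab_group_add) vrep) \<Rightarrow> 'z set \<Rightarrow>
     ('q, 'a, 'f, 'v::ab_group_add) vrep \<Rightarrow> bool" where
  "in_additive_image Q T A R \<longleftrightarrow> (\<exists>k U. direct_sum Q R k U \<and>
     (\<forall>i<k. \<exists>Z\<in>A. \<exists>E :: ('q, 'a, 'f, 'w) vrep.
        is_vrep Q E \<and> vrep_iso Q E (T Z) \<and> direct_summand Q (vrestrict R (U i)) E))"

section \<open>Representations in finite sets and in finite pointed sets\<close>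

record ('q, 'a, 's) srep =
  sobj :: "'q \<Rightarrow> 's set"
  smap :: "'a \<Rightarrow> 's \<Rightarrow> 's"

definition is_srep :: "('q, 'a) pre_digraph \<Rightarrow> ('q, 'a, 's) srep \<Rightarrow> bool" where
  "is_srep Q S \<longleftrightarrow> (\<forall>q\<in>verts Q. finite (sobj S q)) \<and>
     (\<forall>a\<in>arcs Q. smap S a ` sobj S (tail Q a) \<subseteq> sobj S (head Q a))"

text \<open>
  Every finite set is in bijection with a finite set of natural numbers, so up to isomorphism
  these are all the objects.
\<close>

definition set_reps :: "('q, 'a) pre_digraph \<Rightarrow> ('q, 'a, nat) srep set" where
  "set_reps Q = {S. is_srep Q S}"

record ('q, 'a, 's) psrep = "('q, 'a, 's) srep" +
  spt :: "'q \<Rightarrow> 's"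

text \<open>
  The free vector space on a finite set \<open>S\<close> is the space of scalar-valued functions vanishing
  outside \<open>S\<close>; a map of sets is extended linearly by summing over fibres.
\<close>

definition free_obj :: "'s set \<Rightarrow> ('s \<Rightarrow> 'f::field) set" where
  "free_obj S = {c. \<forall>x. x \<notin> S \<longrightarrow> c x = 0}"

definition free_map :: "'s set \<Rightarrow> ('s \<Rightarrow> 't) \<Rightarrow> ('s \<Rightarrow> 'f::field) \<Rightarrow> ('t \<Rightarrow> 'f)" where
  "free_map S g c = (\<lambda>y. \<Sum>x\<in>{x\<in>S. g x = y}. c x)"

definition free_rep ::
  "('q, 'a) pre_digraph \<Rightarrow> ('q, 'a, 's) srep \<Rightarrow> ('q, 'a, 'f::field, 's \<Rightarrow> 'f) vrep" where
  "free_rep Q S =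
    \<lparr> vscale = (\<lambda>r c x. r * c x),
      vobj = (\<lambda>q. free_obj (sobj S q)),
      vmap = (\<lambda>a. free_map (sobj S (tail Q a)) (smap S a)) \<rparr>"

text \<open>
  Pointed version: basis elements that are sent to the base point are sent to zero, so only
  the elements mapped elsewhere contribute.
\<close>

definition free_pt_rep ::
  "('q, 'a) pre_digraph \<Rightarrow> ('q, 'a, 's) psrep \<Rightarrow> ('q, 'a, 'f::field, 's \<Rightarrow> 'f) vrep" where
  "free_pt_rep Q S =
    \<lparr> vscale = (\<lambda>r c x. r * c x),
      vobj = (\<lambda>q. free_obj (sobj S q - {spt S q})),
      vmap = (\<lambda>a. free_map
        {x \<in> sobj S (tail Q a) - {spt S (tail Q a)}. smap S a x \<noteq> spt S (head Q a)} (smap S a)) \<rparr>"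

section \<open>String representations\<close>

text \<open>
  The path is \<open>\<gamma> l = c + l\<close> modulo \<open>n + 1\<close> for \<open>1 \<le> l \<le> m\<close>; the base point is \<open>None\<close>.
  An arrow \<open>i\<close> pointing to \<open>i + 1\<close> moves every \<open>l\<close> over \<open>i\<close> to \<open>l + 1\<close>, except that \<open>m\<close>
  goes to the base point; an arrow pointing from \<open>i + 1\<close> to \<open>i\<close> moves every \<open>l\<close> over \<open>i + 1\<close> to
  \<open>l - 1\<close>, except that \<open>1\<close> goes to the base point.
\<close>

definition string_psrep ::
  "nat \<Rightarrow> (nat \<Rightarrow> bool) \<Rightarrow> nat \<Rightarrow> nat \<Rightarrow> (nat, nat, nat option) psrep" where
  "string_psrep n fwd c m =
    \<lparr> sobj = (\<lambda>q. Some ` {l \<in> {1..m}. (c + l) mod (n + 1) = q} \<union> {None}),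
      smap = (\<lambda>i x. case x of None \<Rightarrow> None
         | Some l \<Rightarrow> if fwd i then (if l < m then Some (l + 1) else None)
                     else (if 1 < l then Some (l - 1) else None)),
      spt = (\<lambda>_. None) \<rparr>"

definition is_string_rep ::
  "nat \<Rightarrow> (nat \<Rightarrow> bool) \<Rightarrow> (nat, nat, 'f::field, 'v::ab_group_add) vrep \<Rightarrow> bool" where
  "is_string_rep n fwd R \<longleftrightarrow> (\<exists>c m. 1 \<le> m \<and>
     vrep_iso (cyc_quiver n fwd) R (free_pt_rep (cyc_quiver n fwd) (string_psrep n fwd c m)))"

section \<open>Band representations\<close>

definition band_rep ::
  "nat \<Rightarrow> ('f \<Rightarrow> 'v \<Rightarrow> 'v) \<Rightarrow> 'v set \<Rightarrow> ('v \<Rightarrow> 'v) \<Rightarrow> (nat, nat, 'f::field, 'v::ab_group_add) vrep" where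
  "band_rep n s V \<phi> = \<lparr> vscale = s, vobj = (\<lambda>_. V), vmap = (\<lambda>i. if i = n then \<phi> else id) \<rparr>"

text \<open>
  \<open>R\<close> is a band representation with data \<open>(V, \<phi>)\<close>. Note that \<open>band_rep 0 s V \<phi>\<close> is just
  \<open>(V, \<phi>)\<close> as a representation of the quiver with one vertex and one loop.
\<close>

definition is_band_rep ::
  "nat \<Rightarrow> (nat \<Rightarrow> bool) \<Rightarrow> (nat, nat, 'f::field, 'v::ab_group_add) vrep \<Rightarrow>
     ('f \<Rightarrow> 'w::ab_group_add \<Rightarrow> 'w) \<Rightarrow> 'w set \<Rightarrow> ('w \<Rightarrow> 'w) \<Rightarrow> bool" where
  "is_band_rep n fwd R s V \<phi> \<longleftrightarrow> indecomposable loop_quiver (band_rep 0 s V \<phi>) \<and>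
     bij_betw \<phi> V V \<and> vrep_iso (cyc_quiver n fwd) R (band_rep n s V \<phi>)"

text \<open>\<open>F[X]/(g)\<close>, each coset being represented by its remainder modulo \<open>g\<close>.\<close>

definition poly_quot :: "'f::field poly \<Rightarrow> 'f poly set" where
  "poly_quot g = range (\<lambda>q. q mod g)"

definition mult_X :: "'f::field poly \<Rightarrow> 'f poly \<Rightarrow> 'f poly" where
  "mult_X g q = ([:0, 1:] * q) mod g"

text \<open>
  Roots of unity lie in extension fields of \<open>F\<close>; as they are algebraic, the algebraic closure
  contains all of them.
\<close>

definition root_of_unity :: "'a::field \<Rightarrow> bool" where
  "root_of_unity z \<longleftrightarrow> (\<exists>k>0. z ^ k = 1)"

definition is_min_poly :: "'f::field poly \<Rightarrow> 'f alg_closure \<Rightarrow> bool" where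
  "is_min_poly f z \<longleftrightarrow> lead_coeff f = 1 \<and> poly (map_poly to_ac f) z = 0 \<and>
     (\<forall>g. poly (map_poly to_ac g) z = 0 \<longrightarrow> f dvd g)"

end

theory Submission
  imports Defs
begin

text \<open>
  Suppose that some arrow of \<open>R\<close> is not bijective. Start at a vector in its kernel or, if all arrows
  are injective, at a suitable vector outside its image, and follow the cycle away from that arrow,
  applying arrows and lifting along them as far as possible. This comes to an end and yields a string
  in \<open>R\<close> together with a dual string of functionals. Their pairing matrix is unitriangular, so the
  string representation is a direct summand of \<open>R\<close>, and equals \<open>R\<close> if \<open>R\<close> is indecomposable. Strings
  always lie in the additive image, because a pointed set retracts onto its base point.

  If all arrows are bijective, then \<open>R\<close> is a vector space \<open>V\<close> with an automorphism \<open>\<phi>\<close>. If it is a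
  summand of the free representation on \<open>S\<close>, then the identity of \<open>V\<close> is a sum of endomorphisms, one for
  each connected component of \<open>S\<close>, and by Fitting's lemma one of them is bijective. The winding numbers
  of the closed walks in this component are the multiples of some \<open>g\<close>. Collecting coordinates by winding
  number shows that \<open>g = 0\<close> is impossible (the torsion module \<open>V\<close> would embed into a free one) and that
  \<open>V\<close> is a summand of $F[X]/(X^g - 1)$. If \<open>g = g' p^k\<close> with \<open>g'\<close> prime to the characteristic \<open>p\<close>, then
  $X^g - 1$ is the $p^k$-th power of the separable polynomial $X^{g'} - 1$, which leaves the stated
  summands only. All of these occur, as the free representation on a cycle winding \<open>g\<close> times around
  the quiver is $F[X]/(X^g - 1)$.
\<close>

section \<open>Finite-dimensional subspaces\<close>

text \<open>Continuing a vector along the cycle involves choices where it has to be lifted. A chain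
  that ends is therefore useful only if no other chain from the same first vector does better: none
  can be lifted further, respectively none has already become zero. This is what
  \<open>lower\<close> records, and it is exactly the obstruction to the dual functionals. A string
  passes each vertex many times, so entries of the pairing matrix off the diagonal need not vanish;
  the arrow at one end of the string decides on which side of the diagonal they do.

  For automorphisms, \<open>V\<close> is reached only through an injective endomorphism that factors
  over \<open>F[X]/(X^g - 1)\<close>, not through a given splitting. This still yields
  \<open>X^g - 1 = h * h'\<close> with \<open>h\<close> and \<open>h'\<close> comaximal.
  Comaximality, not mere divisibility, is what forces the exponent: \<open>f ^ m\<close> has to be
  the full power of \<open>f\<close> in \<open>X^g - 1\<close>, which excludes all smaller
  exponents.\<close>

lemma linear_betwI:
  assumes "\<And>x. x \<in> V \<Longrightarrow> h x \<in> W"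
    and "\<And>x y. x \<in> V \<Longrightarrow> y \<in> V \<Longrightarrow> h (x + y) = h x + h y"
    and "\<And>c x. x \<in> V \<Longrightarrow> h (s c x) = t c (h x)"
  shows "linear_betw s t V W h"
  using assms by (auto simp: linear_betw_def)

lemma linear_betw_mem: "linear_betw s t V W h \<Longrightarrow> x \<in> V \<Longrightarrow> h x \<in> W"
  by (auto simp: linear_betw_def)

lemma linear_betw_add: "linear_betw s t V W h \<Longrightarrow> x \<in> V \<Longrightarrow> y \<in> V \<Longrightarrow> h (x + y) = h x + h y"
  by (auto simp: linear_betw_def)

lemma linear_betw_scale: "linear_betw s t V W h \<Longrightarrow> x \<in> V \<Longrightarrow> h (s c x) = t c (h x)"
  by (auto simp: linear_betw_def)

lemma linear_betw_zero:
  fixes h :: "'v::ab_group_add \<Rightarrow> 'w::ab_group_add"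
  shows "linear_betw s t V W h \<Longrightarrow> 0 \<in> V \<Longrightarrow> h 0 = 0"
  using linear_betw_add[of s t V W h 0 0] by simp

lemma linear_betw_comp:
  "linear_betw s t V W h \<Longrightarrow> linear_betw t u W Z k \<Longrightarrow> linear_betw s u V Z (\<lambda>x. k (h x))"
  by (auto simp: linear_betw_def image_subset_iff)

lemma linear_betw_mono:
  "linear_betw s t V W h \<Longrightarrow> V' \<subseteq> V \<Longrightarrow> h ` V' \<subseteq> W' \<Longrightarrow> linear_betw s t V' W' h"
  unfolding linear_betw_def by blast

definition fdsub :: "('f::field \<Rightarrow> 'v \<Rightarrow> 'v) \<Rightarrow> 'v::ab_group_add set \<Rightarrow> bool" where
  "fdsub s V \<longleftrightarrow> (\<exists>B. finite B \<and> V = module.span s B)"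

context vector_space
begin

lemma linear_betw_diff:
  assumes "linear_betw scale t V W h" "subspace V" "x \<in> V" "y \<in> V"
  shows "h (x - y) = h x - h y"
  using linear_betw_add[OF assms(1), of "x - y" y] assms subspace_diff[of V x y]
  by (simp add: algebra_simps)

lemma linear_betw_sum:
  assumes "linear_betw scale t V W h" "subspace V" "\<And>i. i \<in> A \<Longrightarrow> f i \<in> V"
  shows "h (sum f A) = (\<Sum>i\<in>A. h (f i))"
  using assms(3)
proof (induction A rule: infinite_finite_induct)
  case (insert a A)
  then have "sum f A \<in> V" using subspace_sum[OF assms(2), of A f] by auto
  with insert show ?case using linear_betw_add[OF assms(1)] by simp
qed (use linear_betw_zero[OF assms(1)] subspace_0[OF assms(2)] in auto)

lemma subspace_kernel_betw:
  assumes "linear_betw scale t V W h" "subspace V" "vector_space t"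
  shows "subspace {x\<in>V. h x = 0}"
proof -
  interpret t: vector_space t by fact
  show ?thesis
    using assms(2) linear_betw_zero[OF assms(1)]
    by (intro subspaceI) (auto simp: linear_betw_add[OF assms(1)] linear_betw_scale[OF assms(1)]
        subspace_0 subspace_add subspace_scale)
qed

lemma subspace_vimage_betw:
  assumes "linear_betw scale t V W h" "subspace V" "vector_space t" "module.subspace t B"
  shows "subspace {x\<in>V. h x \<in> B}"
proof -
  interpret t: vector_space t by fact
  show ?thesis
    using assms(2) linear_betw_zero[OF assms(1)]
    by (intro subspaceI) (auto simp: linear_betw_add[OF assms(1)] linear_betw_scale[OF assms(1)]
        subspace_0 subspace_add subspace_scale t.subspace_0[OF assms(4)]
        t.subspace_add[OF assms(4)] t.subspace_scale[OF assms(4)])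
qed

lemma subspace_image_betw:
  assumes "linear_betw scale t V W h" "subspace V" "vector_space t"
  shows "module.subspace t (h ` V)"
proof -
  interpret t: vector_space t by fact
  show ?thesis
  proof (rule t.subspaceI)
    show "0 \<in> h ` V"
      using linear_betw_zero[OF assms(1)] subspace_0[OF assms(2)] by force
  next
    fix x y assume "x \<in> h ` V" "y \<in> h ` V"
    then show "x + y \<in> h ` V"
      using linear_betw_add[OF assms(1)] subspace_add[OF assms(2)] by (metis (no_types, lifting) image_iff)
  next
    fix c x assume "x \<in> h ` V"
    then show "t c x \<in> h ` V"
      using linear_betw_scale[OF assms(1)] subspace_scale[OF assms(2)] by (metis (no_types, lifting) image_iff)
  qed
qed

lemma linear_betw_inj_onI:
  assumes "linear_betw scale t V W h" "subspace V" "\<And>x. x \<in> V \<Longrightarrow> h x = 0 \<Longrightarrow> x = 0"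
  shows "inj_on h V"
proof (rule inj_onI)
  fix x y assume "x \<in> V" "y \<in> V" "h x = h y"
  with assms(3)[of "x - y"] show "x = y"
    using linear_betw_diff[OF assms(1,2)] subspace_diff[OF assms(2)] by auto
qed

lemma linear_betw_inv:
  assumes h: "linear_betw scale t V W h" and V: "subspace V" and b: "bij_betw h V W"
  shows "linear_betw t scale W V (inv_into V h)"
proof (rule linear_betwI)
  fix x assume "x \<in> W"
  with b show "inv_into V h x \<in> V" by (metis bij_betw_def inv_into_into)
next
  fix x y assume "x \<in> W" "y \<in> W"
  then obtain x' y' where "x' \<in> V" "y' \<in> V" "x = h x'" "y = h y'"
    using b by (auto simp: bij_betw_def)
  moreover have "inv_into V h (h (x' + y')) = x' + y'"
    using b calculation V by (auto simp: bij_betw_def subspace_add)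
  ultimately show "inv_into V h (x + y) = inv_into V h x + inv_into V h y"
    using b by (auto simp: bij_betw_def linear_betw_add[OF h])
next
  fix c x assume "x \<in> W"
  then obtain x' where "x' \<in> V" "x = h x'"
    using b by (auto simp: bij_betw_def)
  moreover have "inv_into V h (h (scale c x')) = scale c x'"
    using b calculation V by (auto simp: bij_betw_def subspace_scale)
  ultimately show "inv_into V h (t c x) = scale c (inv_into V h x)"
    using b by (auto simp: bij_betw_def linear_betw_scale[OF h])
qed

section \<open>Dimension arguments\<close>

lemma fdsub_subspace: "fdsub scale V \<Longrightarrow> subspace V"
  by (auto simp: fdsub_def)

lemma fdsub_subset:
  assumes "fdsub scale V" "subspace U" "U \<subseteq> V"
  shows "fdsub scale U"
proof -
  obtain B where B: "finite B" "V = span B" using assms by (auto simp: fdsub_def)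
  obtain C where C: "C \<subseteq> U" "independent C" "U \<subseteq> span C"
    by (rule maximal_independent_subset)
  have "finite C"
    using independent_span_bound[OF B(1) C(2)] C(1) B assms by auto
  moreover have "U = span C"
    using C assms span_minimal by blast
  ultimately show ?thesis by (auto simp: fdsub_def)
qed

text \<open>The finite-dimensional \<open>V\<close> keeps all bases finite, so that
  \<open>dim\<close> is a genuine count; infinite sets have \<open>card\<close> equal to 0.\<close>

lemma dim_strict_mono:
  assumes "fdsub scale V" "subspace U" "subspace W" "U \<subset> W" "W \<subseteq> V"
  shows "dim U < dim W"
proof -
  obtain B where B: "finite B" "V = span B" using assms by (auto simp: fdsub_def)
  obtain C where C: "C \<subseteq> U" "independent C" "U \<subseteq> span C"
    by (rule maximal_independent_subset)
  obtain D where D: "C \<subseteq> D" "D \<subseteq> W" "independent D" "W \<subseteq> span D"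
    using maximal_independent_subset_extend[of C W] C assms by blast
  have fD: "finite D"
    using independent_span_bound[OF B(1) D(3)] D(2) B assms by auto
  have "C \<noteq> D"
    using C D assms span_minimal[of C U] by auto
  then have "card C < card D"
    using D fD by (simp add: psubset_card_mono psubset_eq)
  moreover have "card C = dim U" "card D = dim W"
    using basis_card_eq_dim C D by blast+
  ultimately show ?thesis by simp
qed

text \<open>A strict descent at every step would use up the dimension of \<open>U 0\<close>. Only
  one equality is claimed; where later ones matter, as in \<open>fitting\<close>, they are derived
  from the shape of the sequence.\<close>

lemma decreasing_stable:
  assumes V: "fdsub scale V" and sub: "\<And>j. subspace (U j)" and le: "\<And>j. U (Suc j) \<subseteq> U j"
    and U0: "U 0 \<subseteq> V"
  obtains j :: nat where "U (Suc j) = U j"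
proof (rule ccontr)
  assume "\<not> thesis"
  then have ne: "U (Suc j) \<noteq> U j" for j using that by blast
  have UV: "U j \<subseteq> V" for j
    by (induction j) (use U0 le in auto)
  have "dim (U (Suc j)) < dim (U j)" for j
    by (rule dim_strict_mono[OF V sub sub _ UV]) (use ne le in auto)
  then have "dim (U j) + j \<le> dim (U 0)" for j
    by (induction j) (auto, metis add_Suc_right le_trans less_eq_Suc_le nat_add_left_cancel_le add.commute)
  from this[of "Suc (dim (U 0))"] show False by simp
qed

lemma increasing_stable:
  assumes V: "fdsub scale V" and sub: "\<And>j. subspace (U j)" and le: "\<And>j. U j \<subseteq> U (Suc j)"
    and UV: "\<And>j. U j \<subseteq> V"
  obtains j :: nat where "U (Suc j) = U j"
proof (rule ccontr)
  assume "\<not> thesis"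
  then have ne: "U (Suc j) \<noteq> U j" for j using that by blast
  have "dim (U j) < dim (U (Suc j))" for j
    by (rule dim_strict_mono[OF V sub sub _ UV]) (use ne le in auto)
  then have ge: "j \<le> dim (U j)" for j
    by (induction j) (auto, metis Suc_leI le_less_trans)
  obtain B where B: "finite B" "V = span B" using V by (auto simp: fdsub_def)
  from ge[of "Suc (card B)"] dim_le_card[of "U (Suc (card B))" B] B UV show False
    by fastforce
qed

text \<open>The images of the powers of \<open>f\<close> decrease, so those of \<open>f ^^ j\<close>
  and \<open>f ^^ Suc j\<close> agree for some \<open>j\<close>; cancelling the injective
  \<open>f ^^ j\<close> leaves surjectivity of \<open>f\<close>.\<close>

lemma inj_endo_surj:
  assumes V: "fdsub scale V" and f: "linear_betw scale scale V V f" and inj: "inj_on f V"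
  shows "f ` V = V"
proof -
  define U where "U j = (f ^^ j) ` V" for j
  have sV: "subspace V" using V by (rule fdsub_subspace)
  have fV: "f ` V \<subseteq> V" using f by (auto simp: linear_betw_def)
  have USuc: "U (Suc j) = f ` U j" for j by (auto simp: U_def)
  have UV: "U j \<subseteq> V" for j
    by (induction j) (use fV in \<open>auto simp: USuc, auto simp: U_def\<close>)
  have sub: "subspace (U j)" for j
  proof (induction j)
    case 0 then show ?case by (simp add: U_def sV)
  next
    case (Suc j)
    have "linear_betw scale scale (U j) V f"
      by (rule linear_betw_mono[OF f UV]) (use fV UV in auto)
    then show ?case unfolding USuc by (rule subspace_image_betw[OF _ Suc vector_space_axioms])
  qed
  have le: "U (Suc j) \<subseteq> U j" for j
  proof (induction j)
    case 0 then show ?case using fV by (simp add: U_def)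
  next
    case (Suc j) then show ?case by (auto simp: USuc)
  qed
  obtain j where j: "U (Suc j) = U j"
    by (rule decreasing_stable[where U = U, OF V sub le]) (simp add: U_def)

  have injj: "inj_on (f ^^ i) V" for i
  proof (induction i)
    case (Suc i)
    have "inj_on f (U i)" using inj UV by (rule inj_on_subset)
    with Suc have "inj_on (f \<circ> (f ^^ i)) V"
      unfolding U_def by (intro comp_inj_on)
    then show ?case by (simp add: comp_def)
  qed simp
  show ?thesis
  proof (intro subset_antisym fV subsetI)
    fix x assume x: "x \<in> V"
    then have "(f ^^ j) x \<in> U (Suc j)" using j by (auto simp: U_def)
    then obtain y where y: "y \<in> V" "(f ^^ j) x = (f ^^ j) (f y)"
      unfolding U_def by (auto simp: funpow_swap1)
    then have "x = f y" using injj[of j] x fV by (auto dest!: inj_onD)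
    with y show "x \<in> f ` V" by auto
  qed
qed

section \<open>Functionals: extension, lifting, separation\<close>

lemma functional_extend:
  assumes U: "subspace U" and p: "linear_betw scale (*) U UNIV p"
  obtains g where "linear_betw scale (*) UNIV UNIV g" "\<And>x. x \<in> U \<Longrightarrow> g x = p x"
proof -
  interpret f: vector_space "(*) :: 'a \<Rightarrow> 'a \<Rightarrow> 'a"
    by unfold_locales (auto simp: algebra_simps)
  interpret vp: vector_space_pair scale "(*) :: 'a \<Rightarrow> 'a \<Rightarrow> 'a" ..
  obtain B where B: "B \<subseteq> U" "independent B" "U \<subseteq> span B"
    by (rule maximal_independent_subset)
  obtain g where g: "Vector_Spaces.linear scale (*) g" "\<forall>x\<in>B. g x = p x"
    using vp.linear_independent_extend[OF B(2)] by blast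
  then have g': "linear_betw scale (*) UNIV UNIV g"
    by (auto simp: linear_betw_def Vector_Spaces.linear_iff)
  moreover have "g x = p x" if "x \<in> U" for x
  proof -
    have "subspace {x\<in>U. g x = p x}"
      using U p g' linear_betw_zero[OF p] linear_betw_zero[OF g']
      by (intro subspaceI) (auto simp: subspace_0 subspace_add subspace_scale linear_betw_def)
    moreover have "B \<subseteq> {x\<in>U. g x = p x}" using B g by auto
    ultimately have "span B \<subseteq> {x\<in>U. g x = p x}" by (intro span_minimal)
    with B that show ?thesis by auto
  qed
  ultimately show ?thesis using that by blast
qed

text \<open>The only candidate is \<open>q (g w + b) = p w\<close> on the sum of \<open>B\<close>
  and the image of \<open>g\<close>. The assumption \<open>kill\<close> says that this is well
  defined, and \<open>functional_extend\<close> does the rest.\<close>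

lemma functional_lift:
  assumes W: "subspace W" and g: "linear_betw scale scale W W' g"
    and B: "subspace B" and p: "linear_betw scale (*) W UNIV p"
    and kill: "\<And>x. x \<in> W \<Longrightarrow> g x \<in> B \<Longrightarrow> p x = 0"
  obtains q where "linear_betw scale (*) UNIV UNIV q"
    "\<And>x. x \<in> W \<Longrightarrow> q (g x) = p x" "\<And>x. x \<in> B \<Longrightarrow> q x = 0"
proof -
  define U where "U = {x + y |x y. x \<in> g ` W \<and> y \<in> B}"
  define q0 where "q0 y = p (SOME w. w \<in> W \<and> y - g w \<in> B)" for y
  have gW: "subspace (g ` W)" by (rule subspace_image_betw[OF g W vector_space_axioms])
  have sU: "subspace U" unfolding U_def by (rule subspace_sums[OF gW B])
  have q0: "q0 y = p w" if "w \<in> W" "y - g w \<in> B" for y w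
  proof -
    define v where "v = (SOME w. w \<in> W \<and> y - g w \<in> B)"
    have v: "v \<in> W \<and> y - g v \<in> B"
      unfolding v_def by (rule someI[of "\<lambda>w. w \<in> W \<and> y - g w \<in> B" w]) (use that in auto)
    then have "(y - g v) - (y - g w) \<in> B" using that B subspace_diff by blast
    then have "g (w - v) \<in> B"
      using linear_betw_diff[OF g W, of w v] that v by simp
    moreover have "w - v \<in> W" using that v W subspace_diff by blast
    ultimately have "p (w - v) = 0" by (rule kill[rotated])
    interpret f: vector_space "(*) :: 'a \<Rightarrow> 'a \<Rightarrow> 'a"
      by unfold_locales (auto simp: algebra_simps)
    have "p w = p v" using \<open>p (w - v) = 0\<close> linear_betw_diff[OF p W, of w v] that v by simp
    then show ?thesis by (simp add: q0_def v_def)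
  qed
  have UD: "\<exists>w\<in>W. y - g w \<in> B" if "y \<in> U" for y
    using that by (auto simp: U_def intro: rev_bexI)
  have "linear_betw scale (*) U UNIV q0"
  proof (rule linear_betwI)
    fix x y assume "x \<in> U" "y \<in> U"
    then obtain v w where vw: "v \<in> W" "x - g v \<in> B" "w \<in> W" "y - g w \<in> B"
      using UD by blast
    moreover have "(x - g v) + (y - g w) \<in> B" using vw B subspace_add by blast
    then have "x + y - g (v + w) \<in> B"
      using vw by (simp add: linear_betw_add[OF g] algebra_simps)
    ultimately show "q0 (x + y) = q0 x + q0 y"
      using q0[of v x] q0[of w y] q0[of "v + w" "x + y"] W
      by (simp add: subspace_add linear_betw_add[OF p])
  next
    fix c x assume "x \<in> U"
    then obtain v where v: "v \<in> W" "x - g v \<in> B"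
      using UD by blast
    moreover have "scale c (x - g v) \<in> B" using v B subspace_scale by blast
    then have "scale c x - g (scale c v) \<in> B"
      using v by (simp add: linear_betw_scale[OF g] algebra_simps)
    ultimately show "q0 (scale c x) = c * q0 x"
      using q0[of v x] q0[of "scale c v" "scale c x"] W
      by (simp add: subspace_scale linear_betw_scale[OF p])
  qed auto
  then obtain q where q: "linear_betw scale (*) UNIV UNIV q" "\<And>x. x \<in> U \<Longrightarrow> q x = q0 x"
    using functional_extend[OF sU] by blast
  have 0: "0 \<in> B" "0 \<in> W" using B W subspace_0 by auto
  have g0: "g 0 = 0" "p 0 = 0" using linear_betw_zero[OF g] linear_betw_zero[OF p] 0 by auto
  show ?thesis
  proof
    show "linear_betw scale (*) UNIV UNIV q" by fact
    show "q (g x) = p x" if "x \<in> W" for x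
    proof -
      have "g x + 0 \<in> U" unfolding U_def using that 0 by blast
      with q(2) q0[of x "g x"] that 0 show ?thesis by simp
    qed
    show "q x = 0" if "x \<in> B" for x
    proof -
      have "g 0 + x \<in> U" unfolding U_def using that 0 by blast
      with q(2)[of x] q0[of 0 x] that 0 g0 show ?thesis by simp
    qed
  qed
qed

lemma functional_separate:
  assumes A: "subspace A" and x: "x \<notin> A"
  obtains q where "linear_betw scale (*) UNIV UNIV q" "\<And>y. y \<in> A \<Longrightarrow> q y = 0" "q x = 1"
proof -
  interpret f: vector_space "(*) :: 'a \<Rightarrow> 'a \<Rightarrow> 'a"
    by unfold_locales (auto simp: algebra_simps)
  interpret vp: vector_space_pair scale "(*) :: 'a \<Rightarrow> 'a \<Rightarrow> 'a" ..
  obtain B where B: "B \<subseteq> A" "independent B" "A \<subseteq> span B"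
    by (rule maximal_independent_subset)
  then have "span B = A" using A span_minimal by blast
  then have "independent (insert x B)"
    using B x by (intro independent_insertI) auto
  then obtain q where q: "Vector_Spaces.linear scale (*) q" "\<forall>y\<in>insert x B. q y = (if y = x then 1 else 0)"
    using vp.linear_independent_extend[of "insert x B" "\<lambda>y. if y = x then 1 else 0"] by blast
  then have q': "linear_betw scale (*) UNIV UNIV q"
    by (auto simp: linear_betw_def Vector_Spaces.linear_iff)
  have "subspace {y. q y = 0}"
    using q' linear_betw_zero[OF q']
    by (intro subspaceI) (auto simp: linear_betw_def)
  moreover have "B \<subseteq> {y. q y = 0}" using q B x by auto
  ultimately have "span B \<subseteq> {y. q y = 0}" by (intro span_minimal)
  with q q' \<open>span B = A\<close> that show ?thesis by auto
qed

text \<open>Otherwise \<open>card B + 1\<close> vectors would be independent inside the span of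
  \<open>B\<close>. The dependence is on earlier vectors only, which is what
  \<open>kernel_string\<close> can realise by shifted chains.\<close>

lemma dependent_sequence:
  assumes u: "\<And>i::nat. i \<le> card B \<Longrightarrow> u i \<in> span B" and B: "finite B"
  shows "\<exists>q\<le>card B. u q \<in> span (u ` {..<q})"
proof (rule ccontr)
  assume neg: "\<not> ?thesis"
  have ne: "u q \<notin> span (u ` {..<q})" if "q \<le> card B" for q
    using neg that by blast
  have "independent (u ` {..<q}) \<and> card (u ` {..<q}) = q" if "q \<le> Suc (card B)" for q
    using that
  proof (induction q)
    case (Suc q)
    then have "u q \<notin> u ` {..<q}" using ne[of q] span_base by auto
    with Suc ne[of q] show ?case
      by (auto simp: lessThan_Suc independent_insertI)
  qed (simp add: independent_empty)
  from this[of "Suc (card B)"] independent_span_bound[OF B, of "u ` {..<Suc (card B)}"] u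
  show False by (auto simp: image_subset_iff less_Suc_eq_le)
qed

end

section \<open>Strings in walks of linear maps\<close>

text \<open>A zigzag of spaces: arrow \<open>k\<close> joins \<open>W k\<close> and
  \<open>W (Suc k)\<close> and leads onwards iff \<open>out k\<close>. Reading the cycle from a
  vertex in either sense gives such a zigzag, so both senses are treated at once.\<close>

locale walk = vector_space scale
  for scale :: "'f::field \<Rightarrow> 'v::ab_group_add \<Rightarrow> 'v" +
  fixes W :: "nat \<Rightarrow> 'v set" and out :: "nat \<Rightarrow> bool" and g :: "nat \<Rightarrow> 'v \<Rightarrow> 'v"
  assumes W: "subspace (W k)"
    and g_out: "out k \<Longrightarrow> linear_betw scale scale (W k) (W (Suc k)) (g k)"
    and g_in: "\<not> out k \<Longrightarrow> linear_betw scale scale (W (Suc k)) (W k) (g k)"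
begin

text \<open>An element of the limit of the first \<open>k\<close> arrows. Dually, a
  \<open>cochain\<close> is a functional on their colimit.\<close>

definition chain :: "nat \<Rightarrow> (nat \<Rightarrow> 'v) \<Rightarrow> bool" where
  "chain k x \<longleftrightarrow> (\<forall>j\<le>k. x j \<in> W j) \<and>
     (\<forall>j<k. if out j then g j (x j) = x (Suc j) else g j (x (Suc j)) = x j)"

definition cochain :: "nat \<Rightarrow> (nat \<Rightarrow> 'v \<Rightarrow> 'f) \<Rightarrow> bool" where
  "cochain k \<xi> \<longleftrightarrow> (\<forall>j\<le>k. linear_betw scale (*) (W j) UNIV (\<xi> j)) \<and>
     (\<forall>j<k. if out j then \<forall>y\<in>W j. \<xi> (Suc j) (g j y) = \<xi> j y
            else \<forall>y\<in>W (Suc j). \<xi> j (g j y) = \<xi> (Suc j) y)"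

lemma chain_0: "chain 0 x \<longleftrightarrow> x 0 \<in> W 0"
  by (auto simp: chain_def)

lemma chain_Suc: "chain (Suc k) x \<longleftrightarrow> chain k x \<and> x (Suc k) \<in> W (Suc k) \<and>
   (if out k then g k (x k) = x (Suc k) else g k (x (Suc k)) = x k)"
  by (auto simp: chain_def less_Suc_eq le_Suc_eq)

lemma cochain_Suc: "cochain (Suc k) \<xi> \<longleftrightarrow> cochain k \<xi> \<and>
   linear_betw scale (*) (W (Suc k)) UNIV (\<xi> (Suc k)) \<and>
   (if out k then \<forall>y\<in>W k. \<xi> (Suc k) (g k y) = \<xi> k y
            else \<forall>y\<in>W (Suc k). \<xi> k (g k y) = \<xi> (Suc k) y)"
  by (auto simp: cochain_def less_Suc_eq le_Suc_eq)

lemma chain_mono: "chain k x \<Longrightarrow> j \<le> k \<Longrightarrow> chain j x"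
  by (auto simp: chain_def)

lemma cochain_mono: "cochain k \<xi> \<Longrightarrow> j \<le> k \<Longrightarrow> cochain j \<xi>"
  by (auto simp: cochain_def)

lemma chain_cong: "(\<And>j. j \<le> k \<Longrightarrow> x j = y j) \<Longrightarrow> chain k x \<longleftrightarrow> chain k y"
  by (auto simp: chain_def)

lemma cochain_cong: "(\<And>j. j \<le> k \<Longrightarrow> \<xi> j = \<eta> j) \<Longrightarrow> cochain k \<xi> \<longleftrightarrow> cochain k \<eta>"
  by (auto simp: cochain_def)

lemma chain_upd: "chain k (\<lambda>j. if j = Suc k then v else x j) \<longleftrightarrow> chain k x"
  by (rule chain_cong) auto

lemma cochain_upd: "cochain k (\<lambda>j. if j = Suc k then v else \<xi> j) \<longleftrightarrow> cochain k \<xi>"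
  by (rule cochain_cong) auto

lemma g_mem: "x \<in> W k \<Longrightarrow> out k \<Longrightarrow> g k x \<in> W (Suc k)"
  "x \<in> W (Suc k) \<Longrightarrow> \<not> out k \<Longrightarrow> g k x \<in> W k"
  using g_out g_in linear_betw_mem by blast+

lemma g_zero: "g k 0 = 0"
  using linear_betw_zero[OF g_out] linear_betw_zero[OF g_in] W subspace_0 by metis

lemma chain_zero: "chain k (\<lambda>_. 0)"
  using W subspace_0 by (auto simp: chain_def g_zero)

lemma chain_add: assumes "chain k x" "chain k y" shows "chain k (\<lambda>j. x j + y j)"
proof -
  have "g j (x j + y j) = x (Suc j) + y (Suc j)" if "j < k" "out j" for j
    using linear_betw_add[OF g_out[OF that(2)], of "x j" "y j"] that assms by (auto simp: chain_def)
  moreover have "g j (x (Suc j) + y (Suc j)) = x j + y j" if "j < k" "\<not> out j" for j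
    using linear_betw_add[OF g_in[OF that(2)], of "x (Suc j)" "y (Suc j)"] that assms
    by (auto simp: chain_def)
  ultimately show ?thesis
    using assms W subspace_add by (auto simp: chain_def)
qed

lemma chain_scale: assumes "chain k x" shows "chain k (\<lambda>j. scale c (x j))"
proof -
  have "g j (scale c (x j)) = scale c (x (Suc j))" if "j < k" "out j" for j
    using linear_betw_scale[OF g_out[OF that(2)], of "x j"] that assms by (auto simp: chain_def)
  moreover have "g j (scale c (x (Suc j))) = scale c (x j)" if "j < k" "\<not> out j" for j
    using linear_betw_scale[OF g_in[OF that(2)], of "x (Suc j)"] that assms
    by (auto simp: chain_def)
  ultimately show ?thesis
    using assms W subspace_scale by (auto simp: chain_def)
qed

lemma chain_diff: assumes "chain k x" "chain k y" shows "chain k (\<lambda>j. x j - y j)"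
  using chain_add[OF assms(1) chain_scale[OF assms(2), of "- 1"]] by simp

text \<open>A functional on the colimit is evaluated at an element of the limit, and the map from
  the limit to the colimit may be taken through any position.\<close>

lemma pairing:
  assumes "chain k x" "cochain k \<xi>" "j \<le> k"
  shows "\<xi> j (x j) = \<xi> 0 (x 0)"
  using assms(3)
proof (induction j)
  case (Suc j)
  have c: "chain (Suc j) x" "cochain (Suc j) \<xi>"
    using chain_mono[OF assms(1) Suc(2)] cochain_mono[OF assms(2) Suc(2)] by auto
  then have "x j \<in> W j" "x (Suc j) \<in> W (Suc j)" by (auto simp: chain_def)
  with c have "\<xi> (Suc j) (x (Suc j)) = \<xi> j (x j)"
    unfolding chain_Suc cochain_Suc by (cases "out j") (simp, metis, simp, metis)
  with Suc show ?case by simp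
qed simp

text \<open>The necessary condition, that \<open>p\<close> kills the starts of all chains ending in
  \<open>B\<close>, is also sufficient. Going back by one arrow replaces \<open>B\<close> by its
  preimage or its image, hence \<open>B\<close> is arbitrary in the induction. Across an onward
  arrow the functional is lifted; across a backward one it is composed with the arrow.\<close>

lemma cochain_extend:
  assumes "linear_betw scale (*) (W 0) UNIV p" "subspace B" "B \<subseteq> W k"
    and "\<And>x. chain k x \<Longrightarrow> x k \<in> B \<Longrightarrow> p (x 0) = 0"
  shows "\<exists>\<xi>. cochain k \<xi> \<and> \<xi> 0 = p \<and> (\<forall>y\<in>B. \<xi> k y = 0)"
  using assms(2-)
proof (induction k arbitrary: B)
  case 0
  have "p y = 0" if "y \<in> B" for y
    using that 0(2) 0(3)[of "\<lambda>_. y"] by (auto simp: chain_0)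
  with assms(1) show ?case
    by (intro exI[of _ "\<lambda>_. p"]) (auto simp: cochain_def)
next
  case (Suc k)
  show ?case
  proof (cases "out k")
    case True
    let ?B = "{x\<in>W k. g k x \<in> B}"
    have "subspace ?B"
      using g_out[OF True] W vector_space_axioms Suc(2) by (rule subspace_vimage_betw)
    moreover have "p (x 0) = 0" if "chain k x" "x k \<in> ?B" for x
      using Suc(4)[of "x(Suc k := g k (x k))"] that True
      by (auto simp: chain_Suc chain_upd g_mem)
    ultimately obtain \<xi> where \<xi>: "cochain k \<xi>" "\<xi> 0 = p" "\<forall>y\<in>?B. \<xi> k y = 0"
      using Suc(1)[of ?B] by auto
    have lin: "linear_betw scale (*) (W k) UNIV (\<xi> k)" using \<xi> by (auto simp: cochain_def)
    obtain q where q: "linear_betw scale (*) UNIV UNIV q"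
      "\<And>x. x \<in> W k \<Longrightarrow> q (g k x) = \<xi> k x" "\<And>x. x \<in> B \<Longrightarrow> q x = 0"
      by (rule functional_lift[OF W g_out[OF True] Suc(2) lin]) (use \<xi> in auto)
    have "linear_betw scale (*) (W (Suc k)) UNIV q" by (rule linear_betw_mono[OF q(1)]) auto
    then show ?thesis
      using \<xi> q True by (intro exI[of _ "\<xi>(Suc k := q)"]) (auto simp: cochain_Suc cochain_upd)
  next
    case False
    have lin: "linear_betw scale scale B (g k ` B) (g k)"
      using linear_betw_mono[OF g_in[OF False] Suc(3)] by auto
    have "subspace (g k ` B)"
      by (rule subspace_image_betw[OF lin Suc(2) vector_space_axioms])
    moreover have "g k ` B \<subseteq> W k" using Suc(3) g_mem False by auto
    moreover have "p (x 0) = 0" if "chain k x" "x k \<in> g k ` B" for x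
    proof -
      from that obtain y where "y \<in> B" "x k = g k y" by auto
      then show ?thesis
        using Suc(4)[of "x(Suc k := y)"] that False Suc(3) by (auto simp: chain_Suc chain_upd)
    qed
    ultimately obtain \<xi> where \<xi>: "cochain k \<xi>" "\<xi> 0 = p" "\<forall>y\<in>g k ` B. \<xi> k y = 0"
      using Suc(1)[of "g k ` B"] by auto
    have "linear_betw scale (*) (W k) UNIV (\<xi> k)" using \<xi> by (auto simp: cochain_def)
    then have "linear_betw scale (*) (W (Suc k)) UNIV (\<lambda>y. \<xi> k (g k y))"
      by (rule linear_betw_comp[OF g_in[OF False]])
    then show ?thesis
      using \<xi> False by (intro exI[of _ "\<xi>(Suc k := (\<lambda>y. \<xi> k (g k y)))"])
        (auto simp: cochain_Suc cochain_upd)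
  qed
qed

text \<open>A chain ends at \<open>k\<close> if the next arrow leaves \<open>W k\<close> and kills \<open>x k\<close>, or enters \<open>W k\<close>;
  dually for cochains. The obstruction to a cochain ending at \<open>k\<close> is \<open>lower k\<close>.\<close>

definition stop :: "nat \<Rightarrow> 'v set" where
  "stop k = (if out k then {0} else g k ` W (Suc k))"

definition lower :: "nat \<Rightarrow> 'v set" where
  "lower k = {x 0 |x. chain k x \<and> x k \<in> stop k}"

definition end_chain :: "nat \<Rightarrow> (nat \<Rightarrow> 'v) \<Rightarrow> bool" where
  "end_chain k x \<longleftrightarrow> chain k x \<and> (out k \<longrightarrow> g k (x k) = 0)"

definition end_cochain :: "nat \<Rightarrow> (nat \<Rightarrow> 'v \<Rightarrow> 'f) \<Rightarrow> bool" where
  "end_cochain k \<xi> \<longleftrightarrow> cochain k \<xi> \<and> (\<not> out k \<longrightarrow> (\<forall>y\<in>W (Suc k). \<xi> k (g k y) = 0))"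

lemma subspace_stop: "subspace (stop k)" "stop k \<subseteq> W k"
  using subspace_image_betw[OF g_in W vector_space_axioms] g_mem subspace_0[OF W]
  by (auto simp: stop_def)

lemma subspace_lower: "subspace (lower k)"
proof (rule subspaceI)
  show "0 \<in> lower k"
    using chain_zero[of k] subspace_0[OF subspace_stop(1)] by (auto simp: lower_def intro!: exI[of _ "\<lambda>_. 0"])
next
  fix x y assume "x \<in> lower k" "y \<in> lower k"
  then obtain a b where "chain k a" "chain k b" "a k \<in> stop k" "b k \<in> stop k" "x = a 0" "y = b 0"
    by (auto simp: lower_def)
  then show "x + y \<in> lower k"
    using chain_add[of k a b] subspace_add[OF subspace_stop(1)]
    by (auto simp: lower_def intro!: exI[of _ "\<lambda>j. a j + b j"])
next
  fix c x assume "x \<in> lower k"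
  then obtain a where "chain k a" "a k \<in> stop k" "x = a 0"
    by (auto simp: lower_def)
  then show "scale c x \<in> lower k"
    using chain_scale[of k a c] subspace_scale[OF subspace_stop(1)]
    by (auto simp: lower_def intro!: exI[of _ "\<lambda>j. scale c (a j)"])
qed

text \<open>A functional separating \<open>x 0\<close> from \<open>T\<close> extends because
  \<open>T\<close> contains the obstruction. For a kernel vector \<open>T\<close> is
  \<open>lower k\<close> itself; for a cokernel vector it is the image of the closing arrow, which
  \<open>\<xi> 0\<close> has to kill in addition.\<close>

lemma end_cochain_exists:
  assumes x: "end_chain k x" and T: "subspace T" "lower k \<subseteq> T" "x 0 \<notin> T"
  obtains \<xi> where "end_cochain k \<xi>" "\<And>y. y \<in> T \<Longrightarrow> \<xi> 0 y = 0" "\<And>j. j \<le> k \<Longrightarrow> \<xi> j (x j) = 1"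
proof -
  obtain p where p: "linear_betw scale (*) UNIV UNIV p" "\<And>y. y \<in> T \<Longrightarrow> p y = 0" "p (x 0) = 1"
    using functional_separate[OF T(1,3)] by metis
  have p': "linear_betw scale (*) (W 0) UNIV p" by (rule linear_betw_mono[OF p(1)]) auto
  obtain \<xi> where \<xi>: "cochain k \<xi>" "\<xi> 0 = p" "\<forall>y\<in>stop k. \<xi> k y = 0"
    using cochain_extend[OF p' subspace_stop, of k] p(2) T(2) by (auto simp: lower_def)
  show ?thesis
  proof
    show "end_cochain k \<xi>" using \<xi> by (auto simp: end_cochain_def stop_def)
    show "\<xi> j (x j) = 1" if "j \<le> k" for j
      using pairing[OF _ \<xi>(1) that] x \<xi> p by (auto simp: end_chain_def)
  qed (use \<xi> p in auto)
qed

text \<open>Suppose that \<open>x0\<close> lies in \<open>lower k\<close> whenever a chain from it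
  ends at \<open>k\<close>. At a backward arrow this provides another chain from \<open>x0\<close>
  that lifts one step further; at an onward arrow killing the chain it provides one that is already
  zero at \<open>k\<close>, which is excluded by induction. Hence chains of all lengths exist and
  none reaches 0.\<close>

lemma chain_cases:
  assumes x0: "x0 \<in> W 0" "x0 \<noteq> 0"
  obtains (finite) k x where "end_chain k x" "x 0 = x0" "x0 \<notin> lower k"
  | (infinite) "\<And>k. \<exists>x. chain k x \<and> x 0 = x0" "\<And>k x. chain k x \<Longrightarrow> x 0 = x0 \<Longrightarrow> x k \<noteq> 0"
proof (rule ccontr)
  assume neg: "\<not> thesis"
  have fin: "x0 \<in> lower k" if "end_chain k x" "x 0 = x0" for k x
    using that neg finite by blast
  have ex: "\<exists>x. chain k x \<and> x 0 = x0" for k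
  proof (induction k)
    case 0 then show ?case using x0 by (auto simp: chain_0)
  next
    case (Suc k)
    then obtain x where x: "chain k x" "x 0 = x0" by blast
    have xW: "x k \<in> W k" using x by (auto simp: chain_def)
    show ?case
    proof (cases "out k")
      case True
      then show ?thesis using x xW
        by (intro exI[of _ "x(Suc k := g k (x k))"]) (auto simp: chain_Suc chain_upd g_mem)
    next
      case False
      then have "x0 \<in> lower k" using fin[of k x] x by (auto simp: end_chain_def)
      then obtain y w where "chain k y" "y 0 = x0" "w \<in> W (Suc k)" "y k = g k w"
        using False by (auto simp: lower_def stop_def)
      then show ?thesis using False
        by (intro exI[of _ "y(Suc k := w)"]) (auto simp: chain_Suc chain_upd g_mem)
    qed
  qed
  have nz: "x k \<noteq> 0" if "chain k x" "x 0 = x0" for k x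
    using that
  proof (induction k arbitrary: x)
    case 0 with x0 show ?case by auto
  next
    case (Suc k)
    show ?case
    proof
      assume z: "x (Suc k) = 0"
      have nz: "x k \<noteq> 0" using Suc by (auto simp: chain_Suc)
      show False
      proof (cases "out k")
        case True
        then have "end_chain k x" using Suc z by (auto simp: end_chain_def chain_Suc)
        then have "x0 \<in> lower k" using fin Suc by blast
        then obtain y where "chain k y" "y 0 = x0" "y k = 0"
          using True by (auto simp: lower_def stop_def)
        with Suc(1)[of y] show False by simp
      next
        case False
        with Suc z have "x k = 0" by (auto simp: chain_Suc g_zero)
        with nz show False by simp
      qed
    qed
  qed
  from ex nz neg infinite show False by blast
qed

end

section \<open>Walks that return to their first space after \<open>N\<close> steps\<close>

locale periodic_walk = walk +
  fixes N :: nat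
  assumes N: "0 < N"
    and W_add: "W (k + N) = W k" and out_add: "out (k + N) = out k" and g_add: "g (k + N) = g k"
    and fd: "fdsub scale (W 0)"
begin

lemma W_period: "W (k + i * N) = W k"
proof (induction i)
  case (Suc i)
  then show ?case using W_add[of "k + i * N"] by (simp add: ac_simps)
qed simp

lemma out_period: "out (k + i * N) = out k"
proof (induction i)
  case (Suc i)
  then show ?case using out_add[of "k + i * N"] by (simp add: ac_simps)
qed simp

lemma g_period: "g (k + i * N) = g k"
proof (induction i)
  case (Suc i)
  then show ?case using g_add[of "k + i * N"] by (simp add: ac_simps)
qed simp

text \<open>Zeros can be put in front of a chain because the arrow closing each period points
  backwards and kills the first vector.\<close>

lemma chain_shift:
  assumes x: "chain k x" and last: "\<not> out (N - 1)" "g (N - 1) (x 0) = 0"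
  shows "chain (k + i * N) (\<lambda>j. if j < i * N then 0 else x (j - i * N))"
proof -
  let ?d = "i * N"
  have "x (j - ?d) \<in> W j" if "?d \<le> j" "j \<le> k + ?d" for j
    using that x W_period[of "j - ?d" i] by (auto simp: chain_def)
  moreover have "if out j then g j (x (j - ?d)) = x (Suc j - ?d) else g j (x (Suc j - ?d)) = x (j - ?d)"
    if "?d \<le> j" "j < k + ?d" for j
  proof -
    have "j - ?d < k" "Suc j - ?d = Suc (j - ?d)" using that by auto
    then show ?thesis
      using x out_period[of "j - ?d" i] g_period[of "j - ?d" i] that by (auto simp: chain_def)
  qed
  moreover have "\<not> out j \<and> g j (x 0) = 0" if eq: "Suc j = ?d" for j
  proof -
    obtain i' where "i = Suc i'" using eq by (cases i) auto
    then have "j = (N - 1) + i' * N" using eq N by auto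
    then show ?thesis using out_period[of "N - 1" i'] g_period[of "N - 1" i'] last by simp
  qed
  moreover have "Suc j < ?d" if "j < ?d" "Suc j \<noteq> ?d" for j using that by simp
  ultimately show ?thesis
    using subspace_0[OF W] unfolding chain_def
    by (auto simp: g_zero not_less)
qed

text \<open>If no chain from \<open>x0\<close> ends, then extending a long chain by zeros beyond \<open>x0\<close>
  and shifting it by periods, a linear dependency produces a chain from \<open>x0\<close> that hits zero.\<close>

lemma kernel_string:
  assumes last: "\<not> out (N - 1)" "g (N - 1) x0 = 0" and x0: "x0 \<in> W 0" "x0 \<noteq> 0"
  obtains k x \<xi> where "end_chain k x" "end_cochain k \<xi>" "x 0 = x0" "\<And>j. j \<le> k \<Longrightarrow> \<xi> j (x j) = 1"
  using x0
proof (cases rule: chain_cases)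
  case (finite k x)
  have "x 0 \<notin> lower k" using finite by simp
  from end_cochain_exists[OF finite(1) subspace_lower subset_refl this]
  obtain \<xi> where "end_cochain k \<xi>" "\<And>j. j \<le> k \<Longrightarrow> \<xi> j (x j) = 1" by metis
  then show thesis using that[of k x \<xi>] finite by simp
next
  case infinite
  obtain B where B: "finite B" "W 0 = span B" using fd by (auto simp: fdsub_def)
  obtain x where x: "chain (card B * N) x" "x 0 = x0" using infinite(1) by blast
  have "x (i * N) \<in> span B" if "i \<le> card B" for i
    using x(1) that W_period[of 0 i] B(2) by (auto simp: chain_def)
  then obtain q where q: "q \<le> card B" "x (q * N) \<in> span ((\<lambda>i. x (i * N)) ` {..<q})"
    using dependent_sequence[OF _ B(1), of "\<lambda>i. x (i * N)"] by auto
  have xq: "chain (q * N) x" using x(1) q(1) by (intro chain_mono[OF x(1)]) simp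
  \<comment> \<open>\<open>M\<close> is a subspace, and it contains the earlier
    \<open>x (i * N)\<close>, each as the end of an initial piece of \<open>x\<close> shifted by
    \<open>q - i\<close> periods. So it contains \<open>x (q * N)\<close> too, and the chain
    realising this can be subtracted from \<open>x\<close>.\<close>
  define M where "M = {z (q * N) |z. chain (q * N) z \<and> z 0 = 0}"
  have "subspace M"
  proof (rule subspaceI)
    show "0 \<in> M" unfolding M_def using chain_zero[of "q * N"] by (auto intro!: exI[of _ "\<lambda>_. 0"])
  next
    fix a b assume "a \<in> M" "b \<in> M"
    then obtain y z where "chain (q * N) y" "y 0 = 0" "a = y (q * N)"
      "chain (q * N) z" "z 0 = 0" "b = z (q * N)" by (auto simp: M_def)
    then show "a + b \<in> M"
      unfolding M_def using chain_add[of "q * N" y z] by (auto intro!: exI[of _ "\<lambda>j. y j + z j"])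
  next
    fix c a assume "a \<in> M"
    then obtain y where "chain (q * N) y" "y 0 = 0" "a = y (q * N)" by (auto simp: M_def)
    then show "scale c a \<in> M"
      unfolding M_def using chain_scale[of "q * N" y c] by (auto intro!: exI[of _ "\<lambda>j. scale c (y j)"])
  qed
  moreover have "x (i * N) \<in> M" if i: "i < q" for i
  proof -
    let ?y = "\<lambda>j. if j < (q - i) * N then 0 else x (j - (q - i) * N)"
    have "i * N + (q - i) * N = q * N" using i by (simp flip: add_mult_distrib)
    moreover have "chain (i * N) x" using chain_mono[OF xq, of "i * N"] i by simp
    ultimately have "chain (q * N) ?y"
      using chain_shift[of "i * N" x "q - i"] last x(2) by simp
    moreover have "?y (q * N) = x (i * N)"
      using i \<open>i * N + (q - i) * N = q * N\<close> by (metis add_diff_cancel_right' le_add2 not_less)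
    moreover have "?y 0 = 0" using i N by simp
    ultimately show ?thesis unfolding M_def by (intro CollectI exI[of _ ?y]) simp
  qed
  ultimately have "span ((\<lambda>i. x (i * N)) ` {..<q}) \<subseteq> M" by (intro span_minimal) auto
  then obtain z where z: "chain (q * N) z" "z 0 = 0" "x (q * N) = z (q * N)"
    using q(2) by (auto simp: M_def)
  then show thesis
    using infinite(2)[OF chain_diff[OF xq z(1)]] x(2) by simp
qed

definition starts :: "nat \<Rightarrow> 'b set" where
  "starts k = {x 0 |x. chain k x}"

lemma subspace_starts: "subspace (starts k)"
proof (rule subspaceI)
  show "0 \<in> starts k" unfolding starts_def using chain_zero[of k] by (auto intro!: exI[of _ "\<lambda>_. 0"])
next
  fix a b assume "a \<in> starts k" "b \<in> starts k"
  then obtain y z where "chain k y" "a = y 0" "chain k z" "b = z 0" by (auto simp: starts_def)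
  then show "a + b \<in> starts k"
    unfolding starts_def using chain_add[of k y z] by (auto intro!: exI[of _ "\<lambda>j. y j + z j"])
next
  fix c a assume "a \<in> starts k"
  then obtain y where "chain k y" "a = y 0" by (auto simp: starts_def)
  then show "scale c a \<in> starts k"
    unfolding starts_def using chain_scale[of k y c] by (auto intro!: exI[of _ "\<lambda>j. scale c (y j)"])
qed

lemma starts_antimono: "j \<le> k \<Longrightarrow> starts k \<subseteq> starts j"
  unfolding starts_def using chain_mono by blast

lemma chain_drop: "chain (k + N) x \<Longrightarrow> chain k (\<lambda>j. x (j + N))"
  unfolding chain_def
proof (intro conjI allI impI, goal_cases)
  case (1 j)
  then show ?case using W_add[of j] by auto
next
  case (2 j)
  then have "j + N < k + N" by simp
  with 2 show ?case using out_add[of j] g_add[of j] by (metis add_Suc)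
qed

text \<open>If all arrows are injective, going once around maps the elements that start arbitrarily
  long chains injectively, hence surjectively, to themselves.\<close>

lemma cokernel_string:
  assumes last: "out (N - 1)" "g (N - 1) ` W (N - 1) \<noteq> W 0"
    and inj_out: "\<And>k x. out k \<Longrightarrow> x \<in> W k \<Longrightarrow> g k x = 0 \<Longrightarrow> x = 0"
    and inj_in: "\<And>k x. \<not> out k \<Longrightarrow> x \<in> W (Suc k) \<Longrightarrow> g k x = 0 \<Longrightarrow> x = 0"
  obtains k x \<xi> where "end_chain k x" "end_cochain k \<xi>"
    "\<And>y. y \<in> W (N - 1) \<Longrightarrow> \<xi> 0 (g (N - 1) y) = 0" "\<And>j. j \<le> k \<Longrightarrow> \<xi> j (x j) = 1"
proof -
  have WN: "W N = W 0" using W_add[of 0] by simp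
  have SN: "Suc (N - 1) = N" using N by simp
  define T where "T = g (N - 1) ` W (N - 1)"
  have T: "subspace T" "T \<subseteq> W 0"
    using subspace_image_betw[OF g_out[OF last(1)] W vector_space_axioms]
      g_mem(1)[OF _ last(1)] SN WN by (auto simp: T_def)
  \<comment> \<open>The starts decrease with the length, so those for \<open>j\<close> and
    \<open>j + 1\<close> periods agree for some \<open>j\<close>; going around once shows that this
    common space \<open>C\<close> lies in the image \<open>T\<close> of the closing arrow.\<close>
  have "\<exists>k. starts k \<subseteq> T"
  proof (rule ccontr)
    assume neg: "\<nexists>k. starts k \<subseteq> T"
    define U where "U j = starts (j * N)" for j
    obtain j where j: "U (Suc j) = U j"
    proof (rule decreasing_stable[OF fd])
      show "U (Suc j) \<subseteq> U j" for j unfolding U_def by (rule starts_antimono) simp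
      show "U 0 \<subseteq> W 0" by (auto simp: U_def starts_def chain_0)
    qed (auto simp: U_def subspace_starts)
    define C where "C = U j"
    have C: "subspace C" "C \<subseteq> W 0"
      by (auto simp: C_def U_def subspace_starts) (auto simp: starts_def chain_def)
    have ex: "\<exists>y. chain (j * N + N) y \<and> y 0 = v" if "v \<in> C" for v
    proof -
      have "v \<in> starts (j * N + N)" using that j by (simp add: C_def U_def add.commute)
      then show ?thesis unfolding starts_def by blast
    qed
    \<comment> \<open>Follow a chain from \<open>v\<close> once around. As all arrows are injective,
      a chain starting at 0 vanishes everywhere, so the value at \<open>N\<close> does not depend on
      the chain. It lies in \<open>C\<close> because dropping the first period leaves a chain of
      \<open>j\<close> periods.\<close>
    define \<theta> where "\<theta> v = (SOME y. chain (j * N + N) y \<and> y 0 = v) N" for v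
    have zero: "y i = 0 \<longleftrightarrow> y 0 = 0" if y: "chain k y" "i \<le> k" for y i k
      using y(2)
    proof (induction i)
      case (Suc i)
      have c: "chain (Suc i) y" using chain_mono[OF y(1) Suc(2)] .
      then have "y i \<in> W i" "y (Suc i) \<in> W (Suc i)" by (auto simp: chain_def)
      with c have "y (Suc i) = 0 \<longleftrightarrow> y i = 0"
        using inj_out[of i "y i"] inj_in[of i "y (Suc i)"] g_zero[of i]
        unfolding chain_Suc by (cases "out i") (simp, metis, simp, metis)
      with Suc show ?case by simp
    qed simp
    have \<theta>: "\<theta> v = y N" if y: "chain (j * N + N) y" "y 0 = v" for v y
    proof -
      define z where "z = (SOME y. chain (j * N + N) y \<and> y 0 = v)"
      have z: "chain (j * N + N) z" "z 0 = v"
        using someI[of "\<lambda>y. chain (j * N + N) y \<and> y 0 = v" y] y by (auto simp: z_def)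
      have "z N - y N = 0"
        using zero[OF chain_diff[OF z(1) y(1)], of N] z y by simp
      then show ?thesis by (simp add: \<theta>_def z_def)
    qed
    have lin: "linear_betw scale scale C C \<theta>"
    proof (rule linear_betwI)
      fix v assume "v \<in> C"
      then obtain y where y: "chain (j * N + N) y" "y 0 = v" using ex by blast
      then have "y N \<in> C" using chain_drop[OF y(1)]
        by (auto simp: C_def U_def starts_def intro!: exI[of _ "\<lambda>j. y (j + N)"])
      then show "\<theta> v \<in> C" using \<theta>[OF y] by simp
    next
      fix v w assume "v \<in> C" "w \<in> C"
      then obtain y z where "chain (j * N + N) y" "y 0 = v" "chain (j * N + N) z" "z 0 = w"
        using ex by meson
      then show "\<theta> (v + w) = \<theta> v + \<theta> w"
        using \<theta>[OF chain_add[of "j * N + N" y z]] \<theta>[of y] \<theta>[of z] by simp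
    next
      fix c v assume "v \<in> C"
      then obtain y where "chain (j * N + N) y" "y 0 = v" using ex by blast
      then show "\<theta> (scale c v) = scale c (\<theta> v)"
        using \<theta>[OF chain_scale[of "j * N + N" y c]] \<theta>[of y] by simp
    qed
    have "inj_on \<theta> C"
    proof (rule linear_betw_inj_onI[OF lin C(1)])
      fix v assume "v \<in> C" "\<theta> v = 0"
      then obtain y where y: "chain (j * N + N) y" "y 0 = v" using ex by blast
      then show "v = 0" using \<theta>[OF y] zero[OF y(1), of N] \<open>\<theta> v = 0\<close> by simp
    qed
    then have surj: "\<theta> ` C = C" using inj_endo_surj[OF fdsub_subset[OF fd C] lin] by simp
    have "C \<subseteq> T"
    proof
      fix v assume "v \<in> C"
      then obtain w where "w \<in> C" "v = \<theta> w" using surj by auto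
      then obtain y where y: "chain (j * N + N) y" "v = y N" using ex \<theta> by metis
      have "chain (Suc (N - 1)) y" using chain_mono[OF y(1)] SN by simp
      then have "y N = g (N - 1) (y (N - 1))" "y (N - 1) \<in> W (N - 1)"
        using last(1) SN by (auto simp: chain_Suc) (auto simp: chain_def)
      then show "v \<in> T" using y(2) by (auto simp: T_def)
    qed
    with neg show False by (auto simp: C_def U_def)
  qed
  \<comment> \<open>For the least such \<open>k\<close>, written \<open>Suc i\<close>, some chain of
    length \<open>i\<close> starts outside \<open>T\<close> but none of length \<open>k\<close>
    does. Hence arrow \<open>i\<close> does not lead onwards, the chain ends there, and
    \<open>lower i\<close>, which consists of starts of longer chains, lies in
    \<open>T\<close>.\<close>
  define k where "k = (LEAST k. starts k \<subseteq> T)"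
  have k: "starts k \<subseteq> T" unfolding k_def using LeastI_ex[OF \<open>\<exists>k. starts k \<subseteq> T\<close>] .
  have "starts 0 = W 0"
  proof (intro subset_antisym subsetI)
    fix v assume "v \<in> W 0"
    then have "chain 0 (\<lambda>_. v)" by (simp add: chain_0)
    then show "v \<in> starts 0" unfolding starts_def by fast
  qed (auto simp: starts_def chain_0)
  then have "k \<noteq> 0" using k T last by (metis T_def subset_antisym)
  then obtain i where i: "k = Suc i" by (cases k) auto
  then have "\<not> starts i \<subseteq> T" unfolding k_def using not_less_Least[of i "\<lambda>k. starts k \<subseteq> T"]
    by (metis lessI)
  then obtain x where x: "chain i x" "x 0 \<notin> T" by (auto simp: starts_def)
  have "\<not> out i"
  proof
    assume "out i"
    then have "chain (Suc i) (\<lambda>j. if j = Suc i then g i (x i) else x j)"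
      using x by (auto simp: chain_Suc chain_upd intro!: g_mem) (auto simp: chain_def)
    then have "x 0 \<in> starts k" unfolding starts_def i by (intro CollectI exI conjI) auto
    with k x show False by auto
  qed
  have "lower i \<subseteq> starts k"
  proof
    fix v assume "v \<in> lower i"
    then obtain y w where "chain i y" "v = y 0" "w \<in> W (Suc i)" "y i = g i w"
      using \<open>\<not> out i\<close> by (auto simp: lower_def stop_def)
    then have "chain (Suc i) (\<lambda>j. if j = Suc i then w else y j)"
      using \<open>\<not> out i\<close> by (auto simp: chain_Suc chain_upd)
    then show "v \<in> starts k" unfolding starts_def i using \<open>v = y 0\<close>
      by (intro CollectI exI conjI) auto
  qed
  with k have lower: "lower i \<subseteq> T" by blast
  have "end_chain i x" using x \<open>\<not> out i\<close> by (auto simp: end_chain_def)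
  moreover from end_cochain_exists[OF this T(1) lower x(2)] obtain \<xi> where
    "end_cochain i \<xi>" "\<And>y. y \<in> T \<Longrightarrow> \<xi> 0 y = 0" "\<And>j. j \<le> i \<Longrightarrow> \<xi> j (x j) = 1" by metis
  ultimately show thesis
    using that[of i x \<xi>] unfolding T_def by simp
qed

end

section \<open>Morphisms and direct sums of representations\<close>

definition vrep_hom ::
  "('q, 'a) pre_digraph \<Rightarrow> ('q, 'a, 'f::field, 'v::ab_group_add) vrep \<Rightarrow>
     ('q, 'a, 'f, 'w::ab_group_add) vrep \<Rightarrow> ('q \<Rightarrow> 'v \<Rightarrow> 'w) \<Rightarrow> bool" where
  "vrep_hom Q R S h \<longleftrightarrow>
     (\<forall>q\<in>verts Q. linear_betw (vscale R) (vscale S) (vobj R q) (vobj S q) (h q)) \<and>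
     (\<forall>a\<in>arcs Q. \<forall>x\<in>vobj R (tail Q a).
        h (head Q a) (vmap R a x) = vmap S a (h (tail Q a) x))"

lemma vrep_iso_iff_hom: "vrep_iso Q R S \<longleftrightarrow>
  (\<exists>h. vrep_hom Q R S h \<and> (\<forall>q\<in>verts Q. bij_betw (h q) (vobj R q) (vobj S q)))"
  unfolding vrep_iso_def vrep_hom_def by blast

lemma is_vrepD:
  assumes "is_vrep Q R"
  shows "vector_space (vscale R)" "q \<in> verts Q \<Longrightarrow> fdsub (vscale R) (vobj R q)"
    "q \<in> verts Q \<Longrightarrow> module.subspace (vscale R) (vobj R q)"
    "a \<in> arcs Q \<Longrightarrow> linear_betw (vscale R) (vscale R)
        (vobj R (tail Q a)) (vobj R (head Q a)) (vmap R a)"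
proof -
  show vs: "vector_space (vscale R)" using assms by (simp add: is_vrep_def)
  interpret vector_space "vscale R" by fact
  show "q \<in> verts Q \<Longrightarrow> fdsub (vscale R) (vobj R q)"
    using assms by (auto simp: is_vrep_def fdsub_def)
  then show "q \<in> verts Q \<Longrightarrow> subspace (vobj R q)"
    by (simp add: fdsub_subspace)
  show "a \<in> arcs Q \<Longrightarrow> linear_betw (vscale R) (vscale R)
        (vobj R (tail Q a)) (vobj R (head Q a)) (vmap R a)"
    using assms by (auto simp: is_vrep_def)
qed

lemma is_vrepI:
  assumes "vector_space (vscale R)" "\<And>q. q \<in> verts Q \<Longrightarrow> fdsub (vscale R) (vobj R q)"
    "\<And>a. a \<in> arcs Q \<Longrightarrow> linear_betw (vscale R) (vscale R)
        (vobj R (tail Q a)) (vobj R (head Q a)) (vmap R a)"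
  shows "is_vrep Q R"
  using assms unfolding is_vrep_def fdsub_def by blast

lemma subrepI:
  assumes R: "is_vrep Q R" and Q: "wf_digraph Q"
    and U: "\<And>q. q \<in> verts Q \<Longrightarrow> module.subspace (vscale R) (U q)"
    "\<And>q. q \<in> verts Q \<Longrightarrow> U q \<subseteq> vobj R q"
    "\<And>a x. a \<in> arcs Q \<Longrightarrow> x \<in> U (tail Q a) \<Longrightarrow> vmap R a x \<in> U (head Q a)"
  shows "subrep Q R U"
proof -
  interpret vector_space "vscale R" using R by (rule is_vrepD)
  interpret wf_digraph Q by fact
  have "is_vrep Q (vrestrict R U)"
  proof (rule is_vrepI)
    show "fdsub (vscale (vrestrict R U)) (vobj (vrestrict R U) q)" if "q \<in> verts Q" for q
      using fdsub_subset[OF is_vrepD(2)[OF R that]] U that by simp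
    show "linear_betw (vscale (vrestrict R U)) (vscale (vrestrict R U))
          (vobj (vrestrict R U) (tail Q a)) (vobj (vrestrict R U) (head Q a))
          (vmap (vrestrict R U) a)" if "a \<in> arcs Q" for a
      using linear_betw_mono[OF is_vrepD(4)[OF R that]] U that by (auto simp: image_subset_iff)
  qed (simp add: vector_space_axioms)
  then show ?thesis using U(2) by (simp add: subrep_def)
qed

lemma subrepD:
  assumes "subrep Q R U"
  shows "q \<in> verts Q \<Longrightarrow> module.subspace (vscale R) (U q)"
    "q \<in> verts Q \<Longrightarrow> U q \<subseteq> vobj R q"
    "a \<in> arcs Q \<Longrightarrow> x \<in> U (tail Q a) \<Longrightarrow> vmap R a x \<in> U (head Q a)"
    "is_vrep Q (vrestrict R U)"
proof -
  show r: "is_vrep Q (vrestrict R U)" using assms by (simp add: subrep_def)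
  show "q \<in> verts Q \<Longrightarrow> module.subspace (vscale R) (U q)"
    using is_vrepD(3)[OF r] by simp
  show "q \<in> verts Q \<Longrightarrow> U q \<subseteq> vobj R q" using assms by (simp add: subrep_def)
  show "a \<in> arcs Q \<Longrightarrow> x \<in> U (tail Q a) \<Longrightarrow> vmap R a x \<in> U (head Q a)"
    using linear_betw_mem[OF is_vrepD(4)[OF r]] by simp
qed

section \<open>Decompositions into two summands, and retracts\<close>

lemma direct_sum_2I:
  assumes R: "is_vrep Q R" and A: "subrep Q R A" and B: "subrep Q R B"
    and int: "\<And>q x. q \<in> verts Q \<Longrightarrow> x \<in> A q \<Longrightarrow> x \<in> B q \<Longrightarrow> x = 0"
    and sum: "\<And>q x. q \<in> verts Q \<Longrightarrow> x \<in> vobj R q \<Longrightarrow> \<exists>a\<in>A q. \<exists>b\<in>B q. x = a + b"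
  shows "direct_sum Q R 2 (\<lambda>i. if i = 0 then A else B)"
proof -
  interpret vector_space "vscale R" using R by (rule is_vrepD)
  let ?U = "\<lambda>i::nat. if i = 0 then A else B"
  have "\<exists>!y. y \<in> (\<Pi>\<^sub>E i\<in>{..<2}. ?U i q) \<and> x = (\<Sum>i<2. y i)"
    if q: "q \<in> verts Q" and x: "x \<in> vobj R q" for q x
  proof -
    obtain a b where ab: "a \<in> A q" "b \<in> B q" "x = a + b" using sum[OF q x] by blast
    define y where "y = (\<lambda>i::nat. if i = 0 then a else if i = 1 then b else undefined)"
    show ?thesis
    proof (rule ex1I[of _ y])
      show "y \<in> (\<Pi>\<^sub>E i\<in>{..<2}. ?U i q) \<and> x = (\<Sum>i<2. y i)"
        using ab by (auto simp: y_def PiE_iff extensional_def numeral_2_eq_2 less_Suc_eq)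
    next
      fix z assume z: "z \<in> (\<Pi>\<^sub>E i\<in>{..<2}. ?U i q) \<and> x = (\<Sum>i<2. z i)"
      then have z': "z 0 \<in> A q" "z 1 \<in> B q" "x = z 0 + z 1"
        by (auto simp: PiE_iff numeral_2_eq_2 Ball_def split: if_splits)
      have eq: "a - z 0 = z 1 - b" using z'(3) ab(3) by (simp add: algebra_simps)
      have "a - z 0 \<in> A q" using subrepD(1)[OF A q] ab z' by (simp add: subspace_diff)
      moreover have "a - z 0 \<in> B q" unfolding eq
        using subrepD(1)[OF B q] ab z' by (simp add: subspace_diff)
      ultimately have "a - z 0 = 0" by (rule int[OF q])
      then have "z 0 = a" "z 1 = b" using eq by auto
      moreover have "z i = undefined" if "i \<noteq> 0" "i \<noteq> 1" for i
        using z that by (auto simp: PiE_iff extensional_def)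
      ultimately show "z = y" by (auto simp: y_def)
    qed
  qed
  with A B show ?thesis by (auto simp: direct_sum_def)
qed

lemma direct_sum_2D:
  assumes R: "is_vrep Q R" and U: "direct_sum Q R 2 U"
  shows "subrep Q R (U 0)" "subrep Q R (U 1)"
    "q \<in> verts Q \<Longrightarrow> x \<in> U 0 q \<Longrightarrow> x \<in> U 1 q \<Longrightarrow> x = 0"
    "q \<in> verts Q \<Longrightarrow> x \<in> vobj R q \<Longrightarrow> \<exists>a\<in>U 0 q. \<exists>b\<in>U 1 q. x = a + b"
proof -
  interpret vector_space "vscale R" using R by (rule is_vrepD)
  show A: "subrep Q R (U 0)" and B: "subrep Q R (U 1)" using U by (auto simp: direct_sum_def)
  have ex1: "\<exists>!y. y \<in> (\<Pi>\<^sub>E i\<in>{..<2}. U i q) \<and> x = (\<Sum>i<2. y i)"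
    if "q \<in> verts Q" "x \<in> vobj R q" for q x using U that by (auto simp: direct_sum_def)
  show "x = 0" if q: "q \<in> verts Q" and x: "x \<in> U 0 q" "x \<in> U 1 q"
  proof -
    let ?y = "\<lambda>a b (i::nat). if i = 0 then a else if i = 1 then b else undefined"
    have 0: "0 \<in> U 0 q" "0 \<in> U 1 q" "0 \<in> vobj R q"
      using subspace_0 subrepD(1)[OF A q] subrepD(1)[OF B q] is_vrepD(3)[OF R q] by auto
    have "- x \<in> U 1 q" using subrepD(1)[OF B q] x by (simp add: subspace_neg)
    then have "?y x (- x) \<in> (\<Pi>\<^sub>E i\<in>{..<2}. U i q) \<and> 0 = (\<Sum>i<2. ?y x (- x) i)"
      using x by (auto simp: PiE_iff extensional_def numeral_2_eq_2 less_Suc_eq)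
    moreover have "?y 0 0 \<in> (\<Pi>\<^sub>E i\<in>{..<2}. U i q) \<and> 0 = (\<Sum>i<2. ?y 0 (0::'d) i)"
      using 0 by (auto simp: PiE_iff extensional_def numeral_2_eq_2 less_Suc_eq)
    ultimately have "?y x (- x) = ?y 0 0" using ex1[OF q 0(3)] by blast
    then show "x = 0" by (metis (full_types))
  qed
  show "\<exists>a\<in>U 0 q. \<exists>b\<in>U 1 q. x = a + b" if "q \<in> verts Q" "x \<in> vobj R q"
  proof -
    obtain y where "y \<in> (\<Pi>\<^sub>E i\<in>{..<2}. U i q)" "x = (\<Sum>i<2. y i)"
      using ex1_implies_ex[OF ex1[OF \<open>q \<in> verts Q\<close> \<open>x \<in> vobj R q\<close>]] by blast
    then have "y 0 \<in> U 0 q" "y 1 \<in> U 1 q" "x = y 0 + y 1"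
      by (auto simp: PiE_iff numeral_2_eq_2)
    then show ?thesis by blast
  qed
qed

text \<open>Given \<open>x\<close> in \<open>E\<close>, choose \<open>y\<close> with
  \<open>p (i y) = p x\<close>; then \<open>x - i y\<close> lies in the kernel of \<open>p\<close>.
  Allowing \<open>p \<circ> i\<close> to be bijective instead of the identity matters for strings,
  where it is a triangular matrix.\<close>

lemma vrep_hom_image_kernel:
  assumes Q: "wf_digraph Q" and D: "is_vrep Q D" and E: "is_vrep Q E"
    and i: "vrep_hom Q D E i" and p: "vrep_hom Q E D p"
    and b: "\<And>q. q \<in> verts Q \<Longrightarrow> bij_betw (\<lambda>x. p q (i q x)) (vobj D q) (vobj D q)"
  shows "direct_sum Q E 2 (\<lambda>k. if k = 0 then (\<lambda>q. i q ` vobj D q) else (\<lambda>q. {x\<in>vobj E q. p q x = 0}))"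
    "vrep_iso Q D (vrestrict E (\<lambda>q. i q ` vobj D q))"
proof -
  interpret d: vector_space "vscale D" using D by (rule is_vrepD)
  interpret e: vector_space "vscale E" using E by (rule is_vrepD)
  interpret wf_digraph Q by fact
  have il: "linear_betw (vscale D) (vscale E) (vobj D q) (vobj E q) (i q)" if "q \<in> verts Q" for q
    using i that by (simp add: vrep_hom_def)
  have pl: "linear_betw (vscale E) (vscale D) (vobj E q) (vobj D q) (p q)" if "q \<in> verts Q" for q
    using p that by (simp add: vrep_hom_def)
  have sub1: "subrep Q E (\<lambda>q. i q ` vobj D q)"
  proof (rule subrepI[OF E Q])
    show "e.subspace (i q ` vobj D q)" if "q \<in> verts Q" for q
      using d.subspace_image_betw[OF il is_vrepD(3)[OF D] e.vector_space_axioms] that by simp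
    show "i q ` vobj D q \<subseteq> vobj E q" if "q \<in> verts Q" for q
      using linear_betw_mem[OF il[OF that]] by auto
    show "vmap E a x \<in> i (head Q a) ` vobj D (head Q a)"
      if "a \<in> arcs Q" "x \<in> i (tail Q a) ` vobj D (tail Q a)" for a x
      using that i linear_betw_mem[OF is_vrepD(4)[OF D that(1)]]
      by (auto simp: vrep_hom_def) (metis imageI)
  qed
  have sub2: "subrep Q E (\<lambda>q. {x\<in>vobj E q. p q x = 0})"
  proof (rule subrepI[OF E Q])
    show "e.subspace {x\<in>vobj E q. p q x = 0}" if "q \<in> verts Q" for q
      using e.subspace_kernel_betw[OF pl is_vrepD(3)[OF E] d.vector_space_axioms] that by simp
    show "vmap E a x \<in> {x\<in>vobj E (head Q a). p (head Q a) x = 0}"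
      if "a \<in> arcs Q" "x \<in> {x\<in>vobj E (tail Q a). p (tail Q a) x = 0}" for a x
      using that p linear_betw_mem[OF is_vrepD(4)[OF E that(1)]]
        linear_betw_zero[OF is_vrepD(4)[OF D that(1)] d.subspace_0[OF is_vrepD(3)[OF D]]]
      by (auto simp: vrep_hom_def)
  qed auto
  have zero: "i q 0 = 0" "p q 0 = 0" "0 \<in> vobj D q" "0 \<in> vobj E q" if "q \<in> verts Q" for q
    using linear_betw_zero[OF il[OF that]] linear_betw_zero[OF pl[OF that]]
      d.subspace_0[OF is_vrepD(3)[OF D that]] e.subspace_0[OF is_vrepD(3)[OF E that]] by auto
  show "direct_sum Q E 2 (\<lambda>k. if k = 0 then (\<lambda>q. i q ` vobj D q) else (\<lambda>q. {x\<in>vobj E q. p q x = 0}))"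
  proof (rule direct_sum_2I[OF E sub1 sub2])
    fix q x assume q: "q \<in> verts Q" and "x \<in> i q ` vobj D q" "x \<in> {x\<in>vobj E q. p q x = 0}"
    then obtain y where y: "y \<in> vobj D q" "x = i q y" "p q (i q y) = 0" by auto
    then have "y = 0"
      using bij_betw_imp_inj_on[OF b[OF q]] zero[OF q] by (auto dest!: inj_onD[of _ _ y 0])
    then show "x = 0" using y zero[OF q] by simp
  next
    fix q x assume q: "q \<in> verts Q" and x: "x \<in> vobj E q"
    then have "p q x \<in> (\<lambda>x. p q (i q x)) ` vobj D q"
      using linear_betw_mem[OF pl] b[OF q] by (simp add: bij_betw_def)
    then obtain y where y: "y \<in> vobj D q" "p q x = p q (i q y)" by auto
    have iy: "i q y \<in> vobj E q" using linear_betw_mem[OF il[OF q] y(1)] .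
    have "p q (x - i q y) = 0"
      using e.linear_betw_diff[OF pl[OF q] is_vrepD(3)[OF E q] x iy] y by simp
    then have "x - i q y \<in> {x\<in>vobj E q. p q x = 0}"
      using x iy e.subspace_diff[OF is_vrepD(3)[OF E q]] by simp
    then show "\<exists>a\<in>i q ` vobj D q. \<exists>b\<in>{x\<in>vobj E q. p q x = 0}. x = a + b"
      using y(1) by (intro bexI[of _ "i q y"] bexI[of _ "x - i q y"]) auto
  qed
  show "vrep_iso Q D (vrestrict E (\<lambda>q. i q ` vobj D q))"
    unfolding vrep_iso_iff_hom
  proof (intro exI[of _ i] conjI ballI)
    show "vrep_hom Q D (vrestrict E (\<lambda>q. i q ` vobj D q)) i"
      using i by (auto simp: vrep_hom_def intro: linear_betw_mono)
    fix q assume q: "q \<in> verts Q"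
    have "inj_on (i q) (vobj D q)"
      using bij_betw_imp_inj_on[OF b[OF q]] by (auto simp: inj_on_def)
    then show "bij_betw (i q) (vobj D q) (vobj (vrestrict E (\<lambda>q. i q ` vobj D q)) q)"
      by (simp add: bij_betw_def)
  qed
qed

text \<open>The kernel of \<open>p\<close> is a complement of the nonzero image of \<open>i\<close>,
  so it vanishes.\<close>

lemma indecomposable_iso_retract:
  assumes Q: "wf_digraph Q" and D: "is_vrep Q D" and E: "indecomposable Q E"
    and i: "vrep_hom Q D E i" and p: "vrep_hom Q E D p"
    and b: "\<And>q. q \<in> verts Q \<Longrightarrow> bij_betw (\<lambda>x. p q (i q x)) (vobj D q) (vobj D q)"
    and nz: "\<not> zero_family Q (vobj D)"
  shows "vrep_iso Q E D"
proof -
  have E': "is_vrep Q E" using E by (simp add: indecomposable_def)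
  interpret d: vector_space "vscale D" using D by (rule is_vrepD)
  interpret e: vector_space "vscale E" using E' by (rule is_vrepD)
  note ik = vrep_hom_image_kernel[OF Q D E' i p b]
  have "zero_family Q (\<lambda>q. i q ` vobj D q) \<or> zero_family Q (\<lambda>q. {x\<in>vobj E q. p q x = 0})"
    using E ik(1) unfolding indecomposable_def by (auto dest: spec)
  moreover have "\<not> zero_family Q (\<lambda>q. i q ` vobj D q)"
  proof
    assume z: "zero_family Q (\<lambda>q. i q ` vobj D q)"
    have "vobj D q = {0}" if q: "q \<in> verts Q" for q
    proof -
      have 0: "0 \<in> vobj D q" using d.subspace_0[OF is_vrepD(3)[OF D q]] .
      have "x = 0" if "x \<in> vobj D q" for x
      proof -
        have "i q x \<in> {0}" "i q 0 \<in> {0}"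
          using z q that 0 unfolding zero_family_def by blast+
        then show ?thesis
          using bij_betw_imp_inj_on[OF b[OF q]] that 0 by (auto dest!: inj_onD[of _ _ x 0])
      qed
      with 0 show ?thesis by auto
    qed
    with nz show False by (simp add: zero_family_def)
  qed
  ultimately have ker: "zero_family Q (\<lambda>q. {x\<in>vobj E q. p q x = 0})" by blast
  show ?thesis unfolding vrep_iso_iff_hom
  proof (intro exI[of _ p] conjI ballI)
    show "vrep_hom Q E D p" by fact
    fix q assume q: "q \<in> verts Q"
    have il: "linear_betw (vscale D) (vscale E) (vobj D q) (vobj E q) (i q)"
      using i q by (simp add: vrep_hom_def)
    have pl: "linear_betw (vscale E) (vscale D) (vobj E q) (vobj D q) (p q)"
      using p q by (simp add: vrep_hom_def)
    have "inj_on (p q) (vobj E q)"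
      using e.linear_betw_inj_onI[OF pl is_vrepD(3)[OF E' q]] ker q by (auto simp: zero_family_def)
    moreover have "p q ` vobj E q = vobj D q"
    proof
      show "p q ` vobj E q \<subseteq> vobj D q" using linear_betw_mem[OF pl] by auto
      show "vobj D q \<subseteq> p q ` vobj E q"
      proof
        fix y assume "y \<in> vobj D q"
        then have "y \<in> (\<lambda>x. p q (i q x)) ` vobj D q"
          using b[OF q] by (simp add: bij_betw_def)
        then show "y \<in> p q ` vobj E q" using linear_betw_mem[OF il] by auto
      qed
    qed
    ultimately show "bij_betw (p q) (vobj E q) (vobj D q)" by (simp add: bij_betw_def)
  qed
qed

lemma direct_summandI:
  assumes "wf_digraph Q" "is_vrep Q D" "is_vrep Q E" "vrep_hom Q D E i" "vrep_hom Q E D p"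
    and "\<And>q x. q \<in> verts Q \<Longrightarrow> x \<in> vobj D q \<Longrightarrow> p q (i q x) = x"
  shows "direct_summand Q D E"
proof -
  have b: "bij_betw (\<lambda>x. p q (i q x)) (vobj D q) (vobj D q)" if "q \<in> verts Q" for q
    using assms(6)[OF that] by (auto simp: bij_betw_def inj_on_def)
  from vrep_hom_image_kernel[OF assms(1-5) b] show ?thesis
    unfolding direct_summand_def
    by (intro exI[of _ "\<lambda>k. if k = 0 then (\<lambda>q. i q ` vobj D q) else (\<lambda>q. {x\<in>vobj E q. p q x = 0})"]) auto
qed

lemma vrep_iso_refl: "vrep_iso Q R R"
  unfolding vrep_iso_def by (intro exI[of _ "\<lambda>_ x. x"]) (auto simp: linear_betw_def bij_betw_def)

lemma vrep_hom_comp: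
  assumes "wf_digraph Q" "vrep_hom Q R S h" "vrep_hom Q S T k"
  shows "vrep_hom Q R T (\<lambda>q x. k q (h q x))"
proof -
  interpret wf_digraph Q by fact
  have "h (tail Q a) x \<in> vobj S (tail Q a)" if "a \<in> arcs Q" "x \<in> vobj R (tail Q a)" for a x
    using assms(2) that linear_betw_mem tail_in_verts unfolding vrep_hom_def by metis
  then show ?thesis
    using assms(2,3) unfolding vrep_hom_def by (auto intro: linear_betw_comp)
qed

lemma vrep_iso_trans:
  assumes "wf_digraph Q" "vrep_iso Q R S" "vrep_iso Q S T"
  shows "vrep_iso Q R T"
proof -
  obtain h k where hk: "vrep_hom Q R S h" "\<forall>q\<in>verts Q. bij_betw (h q) (vobj R q) (vobj S q)"
    "vrep_hom Q S T k" "\<forall>q\<in>verts Q. bij_betw (k q) (vobj S q) (vobj T q)"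
    using assms by (auto simp: vrep_iso_iff_hom)
  have "bij_betw (\<lambda>x. k q (h q x)) (vobj R q) (vobj T q)" if "q \<in> verts Q" for q
    using bij_betw_trans[of "h q" _ _ "k q"] hk(2,4) that by (auto simp: comp_def)
  then show ?thesis unfolding vrep_iso_iff_hom
    using vrep_hom_comp[OF assms(1) hk(1,3)] by (intro exI[of _ "\<lambda>q x. k q (h q x)"]) simp
qed

lemma vrep_hom_inv:
  assumes Q: "wf_digraph Q" and R: "is_vrep Q R" and h: "vrep_hom Q R S h"
    and b: "\<And>q. q \<in> verts Q \<Longrightarrow> bij_betw (h q) (vobj R q) (vobj S q)"
  shows "vrep_hom Q S R (\<lambda>q. inv_into (vobj R q) (h q))"
proof -
  interpret vector_space "vscale R" using R by (rule is_vrepD)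
  interpret wf_digraph Q by fact
  show ?thesis unfolding vrep_hom_def
  proof (intro conjI ballI)
    show "linear_betw (vscale S) (vscale R) (vobj S q) (vobj R q) (inv_into (vobj R q) (h q))"
      if "q \<in> verts Q" for q
      using linear_betw_inv[OF _ is_vrepD(3)[OF R that] b[OF that]] h that by (simp add: vrep_hom_def)
    fix a x assume a: "a \<in> arcs Q" and x: "x \<in> vobj S (tail Q a)"
    let ?y = "inv_into (vobj R (tail Q a)) (h (tail Q a)) x"
    have ta: "tail Q a \<in> verts Q" "head Q a \<in> verts Q" using a by auto
    have y: "?y \<in> vobj R (tail Q a)" "h (tail Q a) ?y = x"
      using b[OF ta(1)] x by (auto simp: bij_betw_def inv_into_into f_inv_into_f)
    have "vmap R a ?y \<in> vobj R (head Q a)" using linear_betw_mem[OF is_vrepD(4)[OF R a] y(1)] .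
    moreover have "h (head Q a) (vmap R a ?y) = vmap S a x"
      using h a y by (auto simp: vrep_hom_def)
    ultimately show "inv_into (vobj R (head Q a)) (h (head Q a)) (vmap S a x) = vmap R a ?y"
      using b[OF ta(2)] by (metis bij_betw_def inv_into_f_f)
  qed
qed

lemma bij_betw_inv_cancel:
  assumes "bij_betw f A B"
  shows "x \<in> A \<Longrightarrow> inv_into A f (f x) = x" "y \<in> B \<Longrightarrow> f (inv_into A f y) = y"
  using assms by (auto simp: bij_betw_def f_inv_into_f)

lemma direct_summandD:
  assumes Q: "wf_digraph Q" and D: "is_vrep Q D" and E: "is_vrep Q E" and s: "direct_summand Q D E"
  obtains i p where "vrep_hom Q D E i" "vrep_hom Q E D p"
    "\<And>q x. q \<in> verts Q \<Longrightarrow> x \<in> vobj D q \<Longrightarrow> p q (i q x) = x"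
proof -
  interpret e: vector_space "vscale E" using E by (rule is_vrepD)
  interpret wf_digraph Q by fact
  obtain U h where U: "direct_sum Q E 2 U" and h: "vrep_hom Q D (vrestrict E (U 0)) h"
    "\<And>q. q \<in> verts Q \<Longrightarrow> bij_betw (h q) (vobj D q) (U 0 q)"
    using s by (auto simp: direct_summand_def vrep_iso_iff_hom)
  note U' = direct_sum_2D[OF E U]
  \<comment> \<open>The projection to \<open>U 0\<close> along \<open>U 1\<close>. Uniqueness of the
    component (\<open>un\<close>) gives linearity and compatibility with the arrows.\<close>
  define \<pi> where "\<pi> q x = (SOME a. a \<in> U 0 q \<and> x - a \<in> U 1 q)" for q x
  have ex: "\<pi> q x \<in> U 0 q \<and> x - \<pi> q x \<in> U 1 q" if "q \<in> verts Q" "x \<in> vobj E q" for q x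
    unfolding \<pi>_def
    by (rule someI_ex) (use U'(4)[OF that] in \<open>auto simp: algebra_simps\<close>)
  have un: "\<pi> q x = a" if q: "q \<in> verts Q" and x: "x \<in> vobj E q" and a: "a \<in> U 0 q" "x - a \<in> U 1 q" for q x a
  proof -
    have "a - \<pi> q x \<in> U 0 q"
      using ex[OF q x] a e.subspace_diff[OF subrepD(1)[OF U'(1) q]] by blast
    moreover have "(x - \<pi> q x) - (x - a) \<in> U 1 q"
      using ex[OF q x] a e.subspace_diff[OF subrepD(1)[OF U'(2) q]] by blast
    ultimately have "a - \<pi> q x = 0" using U'(3)[OF q, of "a - \<pi> q x"] by simp
    then show ?thesis by simp
  qed
  have "vrep_hom Q E (vrestrict E (U 0)) \<pi>"
    unfolding vrep_hom_def
  proof (intro conjI ballI)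
    fix q assume q: "q \<in> verts Q"
    note s0 = subrepD(1)[OF U'(1) q] and s1 = subrepD(1)[OF U'(2) q] and sE = is_vrepD(3)[OF E q]
    have "linear_betw (vscale E) (vscale E) (vobj E q) (U 0 q) (\<pi> q)"
    proof (rule linear_betwI)
      show "\<pi> q x \<in> U 0 q" if "x \<in> vobj E q" for x using ex[OF q that] by simp
      show "\<pi> q (x + y) = \<pi> q x + \<pi> q y" if "x \<in> vobj E q" "y \<in> vobj E q" for x y
      proof (rule un[OF q])
        show "x + y \<in> vobj E q" "\<pi> q x + \<pi> q y \<in> U 0 q"
          using ex[OF q that(1)] ex[OF q that(2)] that e.subspace_add s0 sE by blast+
        have "(x - \<pi> q x) + (y - \<pi> q y) \<in> U 1 q"
          using ex[OF q that(1)] ex[OF q that(2)] e.subspace_add s1 by blast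
        then show "x + y - (\<pi> q x + \<pi> q y) \<in> U 1 q" by (simp add: algebra_simps)
      qed
      show "\<pi> q (vscale E c x) = vscale E c (\<pi> q x)" if "x \<in> vobj E q" for c x
      proof (rule un[OF q])
        show "vscale E c x \<in> vobj E q" "vscale E c (\<pi> q x) \<in> U 0 q"
          using ex[OF q that] that e.subspace_scale s0 sE by blast+
        have "vscale E c (x - \<pi> q x) \<in> U 1 q"
          using ex[OF q that] e.subspace_scale s1 by blast
        then show "vscale E c x - vscale E c (\<pi> q x) \<in> U 1 q" by (simp add: e.scale_right_diff_distrib)
      qed
    qed
    then show "linear_betw (vscale E) (vscale (vrestrict E (U 0))) (vobj E q) (vobj (vrestrict E (U 0)) q) (\<pi> q)"
      by simp
  next
    fix a x assume a: "a \<in> arcs Q" and x: "x \<in> vobj E (tail Q a)"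
    have ta: "tail Q a \<in> verts Q" "head Q a \<in> verts Q" using a by auto
    note al = is_vrepD(4)[OF E a]
    have e': "\<pi> (tail Q a) x \<in> U 0 (tail Q a)" "x - \<pi> (tail Q a) x \<in> U 1 (tail Q a)"
      using ex[OF ta(1) x] by auto
    have "vmap E a (x - \<pi> (tail Q a) x) = vmap E a x - vmap E a (\<pi> (tail Q a) x)"
      using e.linear_betw_diff[OF al is_vrepD(3)[OF E ta(1)] x] e' subrepD(2)[OF U'(1) ta(1)] by blast
    then have "\<pi> (head Q a) (vmap E a x) = vmap E a (\<pi> (tail Q a) x)"
      using subrepD(3)[OF U'(1) a e'(1)] subrepD(3)[OF U'(2) a e'(2)] linear_betw_mem[OF al x]
      by (intro un[OF ta(2)]) auto
    then show "\<pi> (head Q a) (vmap E a x) = vmap (vrestrict E (U 0)) a (\<pi> (tail Q a) x)" by simp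
  qed
  moreover have "vrep_hom Q (vrestrict E (U 0)) D (\<lambda>q. inv_into (vobj D q) (h q))"
    using vrep_hom_inv[OF Q D h(1)] h(2) by simp
  ultimately have p: "vrep_hom Q E D (\<lambda>q x. inv_into (vobj D q) (h q) (\<pi> q x))"
    by (rule vrep_hom_comp[OF Q])
  have U0E: "U 0 q \<subseteq> vobj E q" if "q \<in> verts Q" for q using subrepD(2)[OF U'(1) that] .
  have i: "vrep_hom Q D E h"
    using h(1) U0E unfolding vrep_hom_def by (auto simp: linear_betw_def image_subset_iff) blast
  have "inv_into (vobj D q) (h q) (\<pi> q (h q x)) = x" if q: "q \<in> verts Q" and x: "x \<in> vobj D q" for q x
  proof -
    have "h q x \<in> U 0 q" using bij_betwE[OF h(2)[OF q]] x by blast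
    then have "\<pi> q (h q x) = h q x"
      using un[OF q, of "h q x" "h q x"] U0E[OF q] e.subspace_0[OF subrepD(1)[OF U'(2) q]] by auto
    then show ?thesis using bij_betw_inv_cancel(1)[OF h(2)[OF q] x] by simp
  qed
  with i p show thesis by (rule that)
qed

lemma indecomposable_iso:
  assumes Q: "wf_digraph Q" and R: "indecomposable Q R" and S: "is_vrep Q S" and iso: "vrep_iso Q R S"
  shows "indecomposable Q S"
proof -
  have R': "is_vrep Q R" using R by (simp add: indecomposable_def)
  obtain h where h: "vrep_hom Q R S h" "\<And>q. q \<in> verts Q \<Longrightarrow> bij_betw (h q) (vobj R q) (vobj S q)"
    using iso by (auto simp: vrep_iso_iff_hom)
  interpret r: vector_space "vscale R" using R' by (rule is_vrepD)
  interpret s: vector_space "vscale S" using S by (rule is_vrepD)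
  interpret wf_digraph Q by fact
  have hl: "linear_betw (vscale R) (vscale S) (vobj R q) (vobj S q) (h q)" if "q \<in> verts Q" for q
    using h that by (simp add: vrep_hom_def)
  have h0: "h q x = 0 \<longleftrightarrow> x = 0" if "q \<in> verts Q" "x \<in> vobj R q" for q x
    using linear_betw_zero[OF hl[OF that(1)]] r.subspace_0[OF is_vrepD(3)[OF R' that(1)]]
      inj_on_eq_iff[OF bij_betw_imp_inj_on[OF h(2)[OF that(1)]] that(2), of 0] by auto
  define pre where "pre U q = {x\<in>vobj R q. h q x \<in> U q}" for U q
  have pre: "subrep Q R (pre U)" if U: "subrep Q S U" for U
  proof (rule subrepI[OF R' Q])
    show "r.subspace (pre U q)" if "q \<in> verts Q" for q
      unfolding pre_def
      using r.subspace_vimage_betw[OF hl is_vrepD(3)[OF R'] s.vector_space_axioms subrepD(1)[OF U]] that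
      by simp
    show "vmap R a x \<in> pre U (head Q a)" if "a \<in> arcs Q" "x \<in> pre U (tail Q a)" for a x
      using that h(1) subrepD(3)[OF U that(1)] linear_betw_mem[OF is_vrepD(4)[OF R' that(1)]]
      by (auto simp: pre_def vrep_hom_def)
  qed (auto simp: pre_def)
  have zpre: "zero_family Q U" if U: "subrep Q S U" and z: "zero_family Q (pre U)" for U
    unfolding zero_family_def
  proof
    fix q assume q: "q \<in> verts Q"
    have "y = 0" if "y \<in> U q" for y
    proof -
      have "y \<in> vobj S q" using subrepD(2)[OF U q] that by auto
      then obtain x where "x \<in> vobj R q" "y = h q x"
        using h(2)[OF q] by (auto simp: bij_betw_def)
      with that z q h0[OF q] show ?thesis by (auto simp: pre_def zero_family_def)
    qed
    then show "U q = {0}" using s.subspace_0[OF subrepD(1)[OF U q]] by auto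
  qed
  have "zero_family Q (U 0) \<or> zero_family Q (U 1)" if U: "direct_sum Q S 2 U" for U
  proof -
    note U' = direct_sum_2D[OF S U]
    have "direct_sum Q R 2 (\<lambda>i. if i = 0 then pre (U 0) else pre (U 1))"
    proof (rule direct_sum_2I[OF R' pre[OF U'(1)] pre[OF U'(2)]])
      fix q x assume "q \<in> verts Q" "x \<in> pre (U 0) q" "x \<in> pre (U 1) q"
      then show "x = 0" using U'(3)[of q "h q x"] h0[of q x] by (auto simp: pre_def)
    next
      fix q x assume q: "q \<in> verts Q" and x: "x \<in> vobj R q"
      then obtain a b where ab: "a \<in> U 0 q" "b \<in> U 1 q" "h q x = a + b"
        using U'(4)[OF q linear_betw_mem[OF hl]] by blast
      then have "a \<in> h q ` vobj R q" "b \<in> h q ` vobj R q"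
        using subrepD(2)[OF U'(1) q] subrepD(2)[OF U'(2) q] h(2)[OF q] by (auto simp: bij_betw_def)
      then obtain a' b' where ab': "a' \<in> vobj R q" "a = h q a'" "b' \<in> vobj R q" "b = h q b'" by auto
      then have "h q x = h q (a' + b')" using ab linear_betw_add[OF hl[OF q]] by simp
      then have "x = a' + b'"
        using bij_betw_imp_inj_on[OF h(2)[OF q]] x ab' r.subspace_add[OF is_vrepD(3)[OF R' q]]
        by (auto dest: inj_onD)
      then show "\<exists>a\<in>pre (U 0) q. \<exists>b\<in>pre (U 1) q. x = a + b"
        using ab ab' by (auto simp: pre_def)
    qed
    then have "zero_family Q (pre (U 0)) \<or> zero_family Q (pre (U 1))"
      using R unfolding indecomposable_def by (auto dest: spec)
    then show ?thesis using zpre[OF U'(1)] zpre[OF U'(2)] by blast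
  qed
  moreover have "\<not> zero_family Q (vobj S)"
  proof
    assume z: "zero_family Q (vobj S)"
    have "vobj R q = {0}" if q: "q \<in> verts Q" for q
      using h0[OF q] linear_betw_mem[OF hl[OF q]] z q r.subspace_0[OF is_vrepD(3)[OF R' q]]
      by (auto simp: zero_family_def)
    then show False using R by (auto simp: indecomposable_def zero_family_def)
  qed
  ultimately show ?thesis using S by (simp add: indecomposable_def)
qed

section \<open>String representations\<close>

lemma cyc_quiver_simps [simp]:
  "verts (cyc_quiver n fwd) = {..n}" "arcs (cyc_quiver n fwd) = {..n}"
  "tail (cyc_quiver n fwd) i = (if fwd i then i else Suc i mod Suc n)"
  "head (cyc_quiver n fwd) i = (if fwd i then Suc i mod Suc n else i)"
  by (simp_all add: cyc_quiver_def)

lemma mod_Suc_le [simp]: "i mod Suc n \<le> n"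
  by (simp add: less_Suc_eq_le[symmetric])

lemma wf_cyc_quiver: "wf_digraph (cyc_quiver n fwd)"
  by unfold_locales auto

lemma vector_space_free: "vector_space (\<lambda>(r::'f::field) c (x::'s). r * c x)"
  by unfold_locales (auto simp: algebra_simps fun_eq_iff)

lemma linear_free_map:
  fixes A :: "('s \<Rightarrow> 'f::field) set"
  assumes "\<And>x. x \<in> S \<Longrightarrow> g x \<in> B"
  shows "linear_betw (\<lambda>r c x. r * c x) (\<lambda>r c x. r * c x) A (free_obj B) (free_map S g)"
proof (rule linear_betwI)
  fix c :: "'s \<Rightarrow> 'f"
  have "free_map S g c y = 0" if "y \<notin> B" for y
  proof -
    have "{x\<in>S. g x = y} = {}" using assms that by auto
    then show ?thesis by (simp only: free_map_def sum.empty)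
  qed
  then show "free_map S g c \<in> free_obj B"
    by (simp add: free_obj_def)
qed (auto simp: free_map_def fun_eq_iff sum.distrib sum_distrib_left)

lemma sum_apply: "(\<Sum>a\<in>A. f a) x = (\<Sum>a\<in>A. f a x)"
  by (induction A rule: infinite_finite_induct) auto

lemma Suc_mod_eq_iff: "a \<le> n \<Longrightarrow> Suc i mod Suc n = Suc a mod Suc n \<longleftrightarrow> i mod Suc n = a"
  by (auto simp: mod_Suc split: if_splits)

lemma subspace_free_obj: "module.subspace (\<lambda>(r::'f::field) c x. r * c x) (free_obj A)"
proof -
  interpret vector_space "\<lambda>(r::'f) c (x::'a). r * c x" by (rule vector_space_free)
  show ?thesis by (rule subspaceI) (auto simp: free_obj_def)
qed

lemma fdsub_free_obj:
  assumes "finite A"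
  shows "fdsub (\<lambda>(r::'f::field) c x. r * c x) (free_obj A)"
proof -
  interpret vector_space "\<lambda>(r::'f) c (x::'a). r * c x" by (rule vector_space_free)
  let ?e = "\<lambda>a x. if x = a then 1 else (0::'f)"
  have "free_obj A = span (?e ` A)"
  proof
    show "free_obj A \<subseteq> span (?e ` A)"
    proof
      fix c :: "'a \<Rightarrow> 'f" assume "c \<in> free_obj A"
      then have "c = (\<Sum>a\<in>A. (\<lambda>x. c a * ?e a x))"
        using assms by (auto simp: fun_eq_iff free_obj_def sum_apply if_distrib cong: if_cong)
      also have "\<dots> \<in> span (?e ` A)"
        by (intro span_sum span_scale span_base) auto
      finally show "c \<in> span (?e ` A)" .
    qed
    show "span (?e ` A) \<subseteq> free_obj A"
      by (rule span_minimal[OF _ subspace_free_obj]) (auto simp: free_obj_def)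
  qed
  then show ?thesis using assms by (auto simp: fdsub_def)
qed

lemma is_vrep_free_rep:
  assumes "is_srep Q S" "wf_digraph Q"
  shows "is_vrep Q (free_rep Q S :: ('q, 'a, 'f::field, 's \<Rightarrow> 'f) vrep)"
proof (rule is_vrepI)
  show "linear_betw (vscale (free_rep Q S)) (vscale (free_rep Q S)) (vobj (free_rep Q S) (tail Q a))
     (vobj (free_rep Q S) (head Q a)) (vmap (free_rep Q S) a)" if "a \<in> arcs Q" for a
    unfolding free_rep_def using assms that by (auto intro!: linear_free_map simp: is_srep_def)
qed (use assms in \<open>auto simp: free_rep_def vector_space_free fdsub_free_obj is_srep_def\<close>)

section \<open>String representations in coordinates\<close>

abbreviation string_rep :: "nat \<Rightarrow> (nat \<Rightarrow> bool) \<Rightarrow> nat \<Rightarrow> nat \<Rightarrow> (nat, nat, 'f::field, nat option \<Rightarrow> 'f) vrep" where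
  "string_rep n fwd c m \<equiv> free_pt_rep (cyc_quiver n fwd) (string_psrep n fwd c m)"

lemma string_rep_vscale [simp]: "vscale (string_rep n fwd c m) = (\<lambda>r b x. r * b x)"
  by (simp add: free_pt_rep_def)

lemma string_rep_vobj: "vobj (string_rep n fwd c m) q =
    {b. b None = 0 \<and> (\<forall>l. \<not> (1 \<le> l \<and> l \<le> m \<and> (c + l) mod Suc n = q) \<longrightarrow> b (Some l) = 0)}"
proof -
  have "sobj (string_psrep n fwd c m) q - {spt (string_psrep n fwd c m) q} =
      {y. \<exists>l. y = Some l \<and> 1 \<le> l \<and> l \<le> m \<and> (c + l) mod Suc n = q}"
    by (auto simp: string_psrep_def)
  moreover have "vobj (string_rep n fwd c m) q =
      free_obj (sobj (string_psrep n fwd c m) q - {spt (string_psrep n fwd c m) q})"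
    by (simp add: free_pt_rep_def)
  ultimately show ?thesis by (auto simp: free_obj_def split_option_all)
qed

lemma string_rep_vobjD:
  "b \<in> vobj (string_rep n fwd c m) q \<Longrightarrow> b None = 0"
  "b \<in> vobj (string_rep n fwd c m) q \<Longrightarrow> \<not> (1 \<le> l \<and> l \<le> m \<and> (c + l) mod Suc n = q) \<Longrightarrow> b (Some l) = 0"
  by (auto simp: string_rep_vobj)

text \<open>Only the neighbour of \<open>l\<close> on the source side can be mapped to
  \<open>l\<close>. If that neighbour is 0 or \<open>m + 1\<close>, or lies over a vertex other than
  the tail, then \<open>b\<close> vanishes there, so the formula gives the required 0.\<close>

lemma string_rep_vmap:
  assumes b: "b \<in> vobj (string_rep n fwd c m) (tail (cyc_quiver n fwd) a)"
  shows "vmap (string_rep n fwd c m) a b = (\<lambda>y. case y of None \<Rightarrow> 0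
    | Some l \<Rightarrow> if 1 \<le> l \<and> l \<le> m then b (Some (if fwd a then l - 1 else l + 1)) else 0)"
proof
  fix y
  define q where "q = tail (cyc_quiver n fwd) a"
  define T where "T = {x \<in> {x \<in> sobj (string_psrep n fwd c m) q - {None}.
    smap (string_psrep n fwd c m) a x \<noteq> None}. smap (string_psrep n fwd c m) a x = y}"
  have eq: "vmap (string_rep n fwd c m) a b y = sum b T"
    by (simp add: free_pt_rep_def free_map_def T_def q_def del: cyc_quiver_simps)
      (simp add: string_psrep_def)
  show "vmap (string_rep n fwd c m) a b y = (case y of None \<Rightarrow> 0
    | Some l \<Rightarrow> if 1 \<le> l \<and> l \<le> m then b (Some (if fwd a then l - 1 else l + 1)) else 0)"
  proof (cases y)
    case None
    have "T = {}" unfolding T_def None by force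
    then show ?thesis unfolding eq using None by simp
  next
    case (Some l)
    let ?k = "if fwd a then l - 1 else l + 1"
    show ?thesis
    proof (cases "1 \<le> l \<and> l \<le> m \<and> 1 \<le> ?k \<and> ?k \<le> m \<and> (c + ?k) mod Suc n = q")
      case True
      then have "T = {Some ?k}"
        unfolding T_def using Some by (auto simp: string_psrep_def split: if_splits)
      then show ?thesis unfolding eq using Some True by simp
    next
      case False
      have "T = {}"
        unfolding T_def using False Some by (auto simp: string_psrep_def split: if_splits)
      moreover have "1 \<le> l \<and> l \<le> m \<longrightarrow> b (Some ?k) = 0"
        using False string_rep_vobjD(2)[OF b, of ?k] unfolding q_def by blast
      ultimately show ?thesis unfolding eq using Some by simp
    qed
  qed
qed

lemma is_vrep_string_rep: "is_vrep (cyc_quiver n fwd) (string_rep n fwd c m)"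
proof (rule is_vrepI)
  show "fdsub (vscale (string_rep n fwd c m)) (vobj (string_rep n fwd c m) q)" for q
    by (auto simp: free_pt_rep_def string_psrep_def intro!: fdsub_free_obj)
  fix a assume "a \<in> arcs (cyc_quiver n fwd)"
  then have "a \<le> n" by simp
  have "smap (string_psrep n fwd c m) a x \<in> sobj (string_psrep n fwd c m) (head (cyc_quiver n fwd) a) -
      {spt (string_psrep n fwd c m) (head (cyc_quiver n fwd) a)}"
    if x: "x \<in> {x \<in> sobj (string_psrep n fwd c m) (tail (cyc_quiver n fwd) a) -
        {spt (string_psrep n fwd c m) (tail (cyc_quiver n fwd) a)}.
      smap (string_psrep n fwd c m) a x \<noteq> spt (string_psrep n fwd c m) (head (cyc_quiver n fwd) a)}" for x
  proof -
    from x obtain l where l: "x = Some l" "1 \<le> l" "l \<le> m"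
      "(c + l) mod Suc n = tail (cyc_quiver n fwd) a" "smap (string_psrep n fwd c m) a (Some l) \<noteq> None"
      by (auto simp: string_psrep_def simp del: cyc_quiver_simps)
    show ?thesis
    proof (cases "fwd a")
      case True
      with l have "l < m" "Suc (c + l) mod Suc n = Suc a mod Suc n"
        using \<open>a \<le> n\<close> by (auto simp: string_psrep_def Suc_mod_eq_iff split: if_splits)
      with l True show ?thesis by (auto simp: string_psrep_def)
    next
      case False
      with l have "1 < l" by (auto simp: string_psrep_def split: if_splits)
      then obtain k where k: "l = Suc k" "1 \<le> k" by (cases l) auto
      have "(c + k) mod Suc n = a" using l(4) False k \<open>a \<le> n\<close> by (simp add: Suc_mod_eq_iff)
      with l False k show ?thesis by (auto simp: string_psrep_def)
    qed
  qed
  then show "linear_betw (vscale (string_rep n fwd c m)) (vscale (string_rep n fwd c m))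
     (vobj (string_rep n fwd c m) (tail (cyc_quiver n fwd) a))
     (vobj (string_rep n fwd c m) (head (cyc_quiver n fwd) a)) (vmap (string_rep n fwd c m) a)"
    unfolding free_pt_rep_def
    by (simp only: vrep.simps) (rule linear_free_map)
qed (simp add: vector_space_free)

text \<open>A string \<open>x\<close> in \<open>R\<close> with a dual string \<open>\<xi>\<close> of
  functionals. The zeros at positions 0 and \<open>Suc m\<close> make the end conditions instances
  of the four step rules: an arrow leaving an end kills \<open>x\<close> there, and
  \<open>\<xi>\<close> kills the image of an arrow entering an end.\<close>

locale string_datum =
  fixes n :: nat and fwd :: "nat \<Rightarrow> bool" and R :: "(nat, nat, 'f::field, 'v::ab_group_add) vrep"
    and c m :: nat and x :: "nat \<Rightarrow> 'v" and \<xi> :: "nat \<Rightarrow> 'v \<Rightarrow> 'f"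
  assumes R: "is_vrep (cyc_quiver n fwd) R" and m: "1 \<le> m"
    and x_mem: "1 \<le> l \<Longrightarrow> l \<le> m \<Longrightarrow> x l \<in> vobj R ((c + l) mod Suc n)"
    and \<xi>_lin: "1 \<le> l \<Longrightarrow> l \<le> m \<Longrightarrow>
      linear_betw (vscale R) (*) (vobj R ((c + l) mod Suc n)) UNIV (\<xi> l)"
    and pair: "1 \<le> l \<Longrightarrow> l \<le> m \<Longrightarrow> \<xi> l (x l) = 1"
    and x_ends: "x 0 = 0" "x (Suc m) = 0"
    and \<xi>_ends: "\<xi> 0 y = 0" "\<xi> (Suc m) y = 0"
    and x_fwd: "1 \<le> l \<Longrightarrow> l \<le> m \<Longrightarrow> fwd ((c + l) mod Suc n) \<Longrightarrow>
      vmap R ((c + l) mod Suc n) (x l) = x (Suc l)"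
    and x_bwd: "l < m \<Longrightarrow> \<not> fwd ((c + l) mod Suc n) \<Longrightarrow>
      vmap R ((c + l) mod Suc n) (x (Suc l)) = x l"
    and \<xi>_fwd: "l < m \<Longrightarrow> fwd ((c + l) mod Suc n) \<Longrightarrow> y \<in> vobj R ((c + l) mod Suc n) \<Longrightarrow>
      \<xi> (Suc l) (vmap R ((c + l) mod Suc n) y) = \<xi> l y"
    and \<xi>_bwd: "1 \<le> l \<Longrightarrow> l \<le> m \<Longrightarrow> \<not> fwd ((c + l) mod Suc n) \<Longrightarrow>
      y \<in> vobj R (Suc (c + l) mod Suc n) \<Longrightarrow> \<xi> l (vmap R ((c + l) mod Suc n) y) = \<xi> (Suc l) y"
begin

interpretation vector_space "vscale R" using R by (rule is_vrepD)

text \<open>A morphism between a string module and a shifted copy of it is governed by the arrow at the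
  end of the string, so the pairing matrix is triangular, on the side prescribed by that arrow.\<close>

lemma pairing_upper:
  assumes "fwd ((c + m) mod Suc n)"
  shows "1 \<le> l \<Longrightarrow> l < l' \<Longrightarrow> l' \<le> m \<Longrightarrow> (c + l) mod Suc n = (c + l') mod Suc n \<Longrightarrow> \<xi> l (x l') = 0"
proof (induction "m - l'" arbitrary: l l')
  case 0
  then have l': "l' = m" by simp
  have "x m \<in> vobj R ((c + l) mod Suc n)" using x_mem[OF m] 0 l' by simp
  \<comment> \<open>The arrow leaving the end \<open>m\<close> also leaves \<open>l\<close>, a
    position over the same vertex: it moves \<open>\<xi>\<close> on to \<open>Suc l\<close> but
    kills \<open>x m\<close>.\<close>
  then have "\<xi> l (x m) = \<xi> (Suc l) (vmap R ((c + l) mod Suc n) (x m))"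
    using \<xi>_fwd[of l "x m"] 0 l' assms by simp
  also have "vmap R ((c + l) mod Suc n) (x m) = 0"
    using x_fwd[OF m] x_ends(2) 0 l' assms by simp
  also have "\<xi> (Suc l) 0 = 0"
    using linear_betw_zero[OF \<xi>_lin[of "Suc l"]] 0 l' subspace_0[OF is_vrepD(3)[OF R]] by simp
  finally show ?case using l' by simp
next
  case (Suc d)
  then have l': "l' < m" by simp
  have "Suc ((c + l) mod Suc n) mod Suc n = Suc ((c + l') mod Suc n) mod Suc n" using Suc by simp
  then have *: "(c + Suc l) mod Suc n = (c + Suc l') mod Suc n" by (simp add: mod_Suc_eq)
  have IH: "\<xi> (Suc l) (x (Suc l')) = 0"
    by (rule Suc(1)) (use Suc(2-) l' * in auto)
  show ?case
  proof (cases "fwd ((c + l) mod Suc n)")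
    case True
    then show ?thesis
      using \<xi>_fwd[of l "x l'"] x_fwd[of l'] x_mem[of l'] Suc(2-) l' IH by simp
  next
    case False
    then show ?thesis
      using \<xi>_bwd[of l "x (Suc l')"] x_bwd[of l'] x_mem[of "Suc l'"] Suc(2-) l' IH * by simp
  qed
qed

lemma pairing_lower:
  assumes "\<not> fwd ((c + m) mod Suc n)"
  shows "1 \<le> l' \<Longrightarrow> l' < l \<Longrightarrow> l \<le> m \<Longrightarrow> (c + l) mod Suc n = (c + l') mod Suc n \<Longrightarrow> \<xi> l (x l') = 0"
proof (induction "m - l" arbitrary: l l')
  case 0
  then have l: "l = m" by simp
  have "Suc ((c + l) mod Suc n) mod Suc n = Suc ((c + l') mod Suc n) mod Suc n" using 0 by simp
  then have *: "(c + Suc l) mod Suc n = (c + Suc l') mod Suc n" by (simp add: mod_Suc_eq)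
  \<comment> \<open>Here \<open>x l'\<close> is in the image of the arrow entering the end
    \<open>m\<close>, and \<open>\<xi> m\<close> kills this image.\<close>
  have "vmap R ((c + l) mod Suc n) (x (Suc l')) = x l'"
    using x_bwd[of l'] 0 l assms by simp
  then show ?case
    using \<xi>_bwd[of m "x (Suc l')"] \<xi>_ends(2) x_mem[of "Suc l'"] 0 l assms m * by simp
next
  case (Suc d)
  then have l: "l < m" by simp
  have "Suc ((c + l) mod Suc n) mod Suc n = Suc ((c + l') mod Suc n) mod Suc n" using Suc by simp
  then have *: "(c + Suc l) mod Suc n = (c + Suc l') mod Suc n" by (simp add: mod_Suc_eq)
  have IH: "\<xi> (Suc l) (x (Suc l')) = 0"
    by (rule Suc(1)) (use Suc(2-) l * in auto)
  show ?case
  proof (cases "fwd ((c + l) mod Suc n)")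
    case True
    then show ?thesis
      using \<xi>_fwd[of l "x l'"] x_fwd[of l'] x_mem[of l'] Suc(2-) l IH by simp
  next
    case False
    then show ?thesis
      using \<xi>_bwd[of l "x (Suc l')"] x_bwd[of l'] x_mem[of "Suc l'"] Suc(2-) l IH * by simp
  qed
qed

definition from_string :: "nat \<Rightarrow> (nat option \<Rightarrow> 'f) \<Rightarrow> 'v" where
  "from_string q b = (\<Sum>l\<in>{1..m}. vscale R (b (Some l)) (x l))"

definition to_string :: "nat \<Rightarrow> 'v \<Rightarrow> nat option \<Rightarrow> 'f" where
  "to_string q y = (\<lambda>o'. case o' of None \<Rightarrow> 0
     | Some l \<Rightarrow> if 1 \<le> l \<and> l \<le> m \<and> (c + l) mod Suc n = q then \<xi> l y else 0)"

lemma from_string_eq: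
  assumes "b \<in> vobj (string_rep n fwd c m) q"
  shows "from_string q b = (\<Sum>l\<in>{l\<in>{1..m}. (c + l) mod Suc n = q}. vscale R (b (Some l)) (x l))"
  unfolding from_string_def using string_rep_vobjD(2)[OF assms]
  by (intro sum.mono_neutral_right) auto

lemma from_string_mem:
  assumes "b \<in> vobj (string_rep n fwd c m) q" "q \<le> n"
  shows "from_string q b \<in> vobj R q"
  unfolding from_string_eq[OF assms(1)]
  using x_mem is_vrepD(3)[OF R, of q] assms(2)
  by (intro subspace_sum subspace_scale) auto

lemma linear_to_string:
  "linear_betw (vscale R) (vscale (string_rep n fwd c m)) (vobj R q) (vobj (string_rep n fwd c m) q) (to_string q)"
proof (rule linear_betwI)
  fix y assume y: "y \<in> vobj R q"
  show "to_string q y \<in> vobj (string_rep n fwd c m) q"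
    by (auto simp: to_string_def string_rep_vobj)
  fix r
  show "to_string q (vscale R r y) = vscale (string_rep n fwd c m) r (to_string q y)"
    using y by (auto simp: to_string_def fun_eq_iff linear_betw_scale[OF \<xi>_lin] split: option.split)
  fix z assume z: "z \<in> vobj R q"
  show "to_string q (y + z) = to_string q y + to_string q z"
    using y z by (auto simp: to_string_def fun_eq_iff linear_betw_add[OF \<xi>_lin] split: option.split)
qed

lemma hom_to_string: "vrep_hom (cyc_quiver n fwd) R (string_rep n fwd c m) to_string"
  unfolding vrep_hom_def
proof (intro conjI ballI linear_to_string)
  fix a y assume "a \<in> arcs (cyc_quiver n fwd)" and y: "y \<in> vobj R (tail (cyc_quiver n fwd) a)"
  then have a: "a \<le> n" by simp
  note b = linear_betw_mem[OF linear_to_string y]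
  show "to_string (head (cyc_quiver n fwd) a) (vmap R a y) =
        vmap (string_rep n fwd c m) a (to_string (tail (cyc_quiver n fwd) a) y)"
    unfolding string_rep_vmap[OF b]
  proof
    fix o'
    show "to_string (head (cyc_quiver n fwd) a) (vmap R a y) o' =
      (case o' of None \<Rightarrow> 0 | Some l \<Rightarrow> if 1 \<le> l \<and> l \<le> m
         then to_string (tail (cyc_quiver n fwd) a) y (Some (if fwd a then l - 1 else l + 1)) else 0)"
    proof (cases o')
      case None then show ?thesis by (simp add: to_string_def)
    next
      case (Some l)
      consider "1 \<le> l" "l \<le> m" | "\<not> (1 \<le> l \<and> l \<le> m)" by blast
      then show ?thesis
      proof cases
        case 1
        then obtain k where k: "l = Suc k" by (cases l) auto
        show ?thesis
        proof (cases "fwd a")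
          case True
          have "(c + l) mod Suc n = Suc a mod Suc n \<longleftrightarrow> (c + k) mod Suc n = a"
            using a k by (simp add: Suc_mod_eq_iff)
          moreover have "\<xi> l (vmap R a y) = \<xi> k y" if "(c + k) mod Suc n = a"
            using \<xi>_fwd[of k y] that 1 k True y by simp
          moreover have "\<xi> k y = 0" if "\<not> 1 \<le> k" using that \<xi>_ends(1) by (cases k) auto
          ultimately show ?thesis using Some 1 k True by (auto simp: to_string_def)
        next
          case False
          have eq: "(c + Suc l) mod Suc n = Suc a mod Suc n \<longleftrightarrow> (c + l) mod Suc n = a"
            using a by (simp add: Suc_mod_eq_iff)
          moreover have "\<xi> l (vmap R a y) = \<xi> (Suc l) y" if "(c + l) mod Suc n = a"
            using \<xi>_bwd[of l y] that 1 False y eq by simp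
          moreover note eq
          moreover have "\<xi> (Suc l) y = 0" if "\<not> Suc l \<le> m"
            using that \<xi>_ends(2) 1 by (metis le_antisym not_less_eq_eq)
          ultimately show ?thesis using Some 1 False by (auto simp: to_string_def)
        qed
      qed (auto simp: to_string_def Some)
    qed
  qed
qed

lemma hom_from_string: "vrep_hom (cyc_quiver n fwd) (string_rep n fwd c m) R from_string"
  unfolding vrep_hom_def
proof (intro conjI ballI)
  fix q assume "q \<in> verts (cyc_quiver n fwd)"
  then show "linear_betw (vscale (string_rep n fwd c m)) (vscale R) (vobj (string_rep n fwd c m) q) (vobj R q) (from_string q)"
    using from_string_mem
    by (intro linear_betwI) (auto simp: from_string_def scale_left_distrib sum.distrib scale_sum_right)
next
  fix a and b :: "nat option \<Rightarrow> 'f"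
  assume "a \<in> arcs (cyc_quiver n fwd)"
    and b: "b \<in> vobj (string_rep n fwd c m) (tail (cyc_quiver n fwd) a)"
  then have a: "a \<le> n" by simp
  define t where "t = tail (cyc_quiver n fwd) a"
  have t: "t \<le> n" using a by (simp add: t_def)
  define L where "L = {l\<in>{1..m}. (c + l) mod Suc n = t}"
  define w where "w l = (if fwd a then x (Suc l) else x (l - 1))" for l
  have al: "linear_betw (vscale R) (vscale R) (vobj R t) (vobj R (head (cyc_quiver n fwd) a)) (vmap R a)"
    using is_vrepD(4)[OF R, of a] a by (simp add: t_def)
  have mem: "x l \<in> vobj R t" if "l \<in> L" for l
    using that x_mem[of l] by (auto simp: L_def)
  have sub: "subspace (vobj R t)" using is_vrepD(3)[OF R] t by simp
  have step: "vmap R a (x l) = w l" if "l \<in> L" for l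
  proof (cases "fwd a")
    case True
    then show ?thesis using x_fwd[of l] that by (auto simp: L_def t_def w_def)
  next
    case False
    with that obtain k where k: "l = Suc k" "k < m" "(c + k) mod Suc n = a"
      using a by (cases l) (auto simp: L_def t_def Suc_mod_eq_iff)
    then show ?thesis using x_bwd[of k] False by (simp add: w_def)
  qed
  have b0: "b (Some l) = 0" if "l \<notin> L" for l
    using string_rep_vobjD(2)[OF b, of l] that unfolding L_def t_def by auto
  have "vmap R a (from_string t b) = (\<Sum>l\<in>L. vmap R a (vscale R (b (Some l)) (x l)))"
    unfolding from_string_eq[OF b[folded t_def]] L_def[symmetric]
    by (rule linear_betw_sum[OF al sub]) (use mem subspace_scale[OF sub] in auto)
  also have "\<dots> = (\<Sum>l\<in>L. vscale R (b (Some l)) (w l))"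
    by (intro sum.cong) (auto simp: linear_betw_scale[OF al] mem step)
  \<comment> \<open>Over \<open>{0..Suc m}\<close> the shift by one position can be carried out in
    either direction; the added terms are 0.\<close>
  also have "\<dots> = (\<Sum>l\<in>{0..Suc m}. vscale R (b (Some l)) (w l))"
    using b0 by (intro sum.mono_neutral_left) (auto simp: L_def)
  also have "\<dots> = (\<Sum>l\<in>{1..m}. vscale R (b (Some (if fwd a then l - 1 else l + 1))) (x l))"
  proof (cases "fwd a")
    case True
    have "(\<Sum>l\<in>{0..Suc m}. vscale R (b (Some l)) (w l)) = (\<Sum>l\<in>{0..m}. vscale R (b (Some l)) (x (Suc l)))"
      using b0[of "Suc m"] True by (simp add: L_def w_def)
    also have "\<dots> = (\<Sum>l\<in>{1..Suc m}. vscale R (b (Some (l - 1))) (x l))"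
      unfolding One_nat_def sum.atLeast_Suc_atMost_Suc_shift by simp
    also have "\<dots> = (\<Sum>l\<in>{1..m}. vscale R (b (Some (l - 1))) (x l))"
      using x_ends by simp
    finally show ?thesis using True by simp
  next
    case False
    have "(\<Sum>l\<in>{0..Suc m}. vscale R (b (Some l)) (w l)) = (\<Sum>l\<in>{1..Suc m}. vscale R (b (Some l)) (x (l - 1)))"
      using b0[of 0] False by (simp add: L_def w_def sum.atLeast_Suc_atMost[of 0])
    also have "\<dots> = (\<Sum>l\<in>{0..m}. vscale R (b (Some (Suc l))) (x l))"
      unfolding One_nat_def sum.atLeast_Suc_atMost_Suc_shift by simp
    also have "\<dots> = (\<Sum>l\<in>{1..m}. vscale R (b (Some (Suc l))) (x l))"
      using x_ends by (simp add: sum.atLeast_Suc_atMost[of 0])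
    finally show ?thesis using False by simp
  qed
  also have "\<dots> = from_string (head (cyc_quiver n fwd) a) (vmap (string_rep n fwd c m) a b)"
    unfolding from_string_def string_rep_vmap[OF b] by (intro sum.cong) auto
  finally show "from_string (head (cyc_quiver n fwd) a) (vmap (string_rep n fwd c m) a b) =
      vmap R a (from_string (tail (cyc_quiver n fwd) a) b)" by (simp add: t_def)
qed

lemma to_from_string:
  assumes b: "b \<in> vobj (string_rep n fwd c m) q" and q: "q \<le> n"
    and l: "1 \<le> l" "l \<le> m" "(c + l) mod Suc n = q"
  shows "to_string q (from_string q b) (Some l) =
    (\<Sum>l'\<in>{l'\<in>{1..m}. (c + l') mod Suc n = q}. b (Some l') * \<xi> l (x l'))"
proof -
  have sub: "subspace (vobj R q)" using is_vrepD(3)[OF R] q by simp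
  have lin: "linear_betw (vscale R) (*) (vobj R q) UNIV (\<xi> l)" using \<xi>_lin[of l] l by simp
  have mem: "x l' \<in> vobj R q" if "l' \<in> {l'\<in>{1..m}. (c + l') mod Suc n = q}" for l'
    using that x_mem[of l'] by auto
  have "\<xi> l (from_string q b) = (\<Sum>l'\<in>{l'\<in>{1..m}. (c + l') mod Suc n = q}. \<xi> l (vscale R (b (Some l')) (x l')))"
    unfolding from_string_eq[OF b]
    by (rule linear_betw_sum[OF lin sub]) (use mem subspace_scale[OF sub] in auto)
  also have "\<dots> = (\<Sum>l'\<in>{l'\<in>{1..m}. (c + l') mod Suc n = q}. b (Some l') * \<xi> l (x l'))"
    by (intro sum.cong) (auto simp: linear_betw_scale[OF lin mem])
  finally show ?thesis using l by (simp add: to_string_def)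
qed

lemma to_from_string_eq_0:
  assumes b: "b \<in> vobj (string_rep n fwd c m) q" and q: "q \<le> n"
    and z: "to_string q (from_string q b) = 0"
  shows "b = 0"
proof (rule ccontr)
  assume "b \<noteq> 0"
  define L where "L = {l\<in>{1..m}. (c + l) mod Suc n = q}"
  define B where "B = {l\<in>L. b (Some l) \<noteq> 0}"
  have "\<exists>l. b (Some l) \<noteq> 0"
    using \<open>b \<noteq> 0\<close> string_rep_vobjD(1)[OF b] by (auto simp: fun_eq_iff) (metis not_None_eq)
  then have "B \<noteq> {}" using string_rep_vobjD(2)[OF b] by (auto simp: B_def L_def)
  have fin: "finite B" "finite L" by (auto simp: B_def L_def)
  have row: "(\<Sum>l'\<in>L. b (Some l') * \<xi> l (x l')) = 0" if "l \<in> L" for l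
    using to_from_string[OF b q, of l] that z by (auto simp: L_def)
  obtain l where l: "l \<in> B" "\<And>l'. l' \<in> B \<Longrightarrow> l' \<noteq> l \<Longrightarrow> \<xi> l (x l') = 0"
  proof (cases "fwd ((c + m) mod Suc n)")
    case True
    have "\<xi> (Min B) (x l') = 0" if "l' \<in> B" "l' \<noteq> Min B" for l'
    proof (rule pairing_upper[OF True])
      show "Min B < l'" using Min_le[OF fin(1) that(1)] that(2) by simp
    qed (use Min_in[OF fin(1) \<open>B \<noteq> {}\<close>] that in \<open>auto simp: B_def L_def\<close>)
    then show ?thesis using that[of "Min B"] Min_in[OF fin(1) \<open>B \<noteq> {}\<close>] by blast
  next
    case False
    have "\<xi> (Max B) (x l') = 0" if "l' \<in> B" "l' \<noteq> Max B" for l'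
    proof (rule pairing_lower[OF False])
      show "l' < Max B" using Max_ge[OF fin(1) that(1)] that(2) by simp
    qed (use Max_in[OF fin(1) \<open>B \<noteq> {}\<close>] that in \<open>auto simp: B_def L_def\<close>)
    then show ?thesis using that[of "Max B"] Max_in[OF fin(1) \<open>B \<noteq> {}\<close>] by blast
  qed
  have lL: "l \<in> L" using l by (simp add: B_def)
  have "0 = (\<Sum>l'\<in>L. b (Some l') * \<xi> l (x l'))" using row[OF lL] by simp
  also have "\<dots> = (\<Sum>l'\<in>{l}. b (Some l') * \<xi> l (x l'))"
    using lL l(2) fin by (intro sum.mono_neutral_right) (auto simp: B_def)
  also have "\<dots> = b (Some l)" using pair[of l] lL by (simp add: L_def)
  finally show False using l(1) by (simp add: B_def)
qed

lemma iso_string_rep: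
  assumes "indecomposable (cyc_quiver n fwd) R"
  shows "vrep_iso (cyc_quiver n fwd) R (string_rep n fwd c m)"
proof (rule indecomposable_iso_retract[OF wf_cyc_quiver is_vrep_string_rep assms hom_from_string hom_to_string])
  interpret s: vector_space "vscale (string_rep n fwd c m)" using is_vrep_string_rep by (rule is_vrepD)
  fix q assume "q \<in> verts (cyc_quiver n fwd)"
  then have q: "q \<le> n" by simp
  have S: "fdsub (vscale (string_rep n fwd c m)) (vobj (string_rep n fwd c m) q)"
    using is_vrepD(2)[OF is_vrep_string_rep] q by simp
  have lin: "linear_betw (vscale (string_rep n fwd c m)) (vscale (string_rep n fwd c m))
      (vobj (string_rep n fwd c m) q) (vobj (string_rep n fwd c m) q) (\<lambda>b. to_string q (from_string q b))"
  proof (rule linear_betw_comp[OF _ linear_to_string])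
    show "linear_betw (vscale (string_rep n fwd c m)) (vscale R) (vobj (string_rep n fwd c m) q) (vobj R q) (from_string q)"
      using hom_from_string q unfolding vrep_hom_def by simp
  qed
  have inj: "inj_on (\<lambda>b. to_string q (from_string q b)) (vobj (string_rep n fwd c m) q)"
    by (rule s.linear_betw_inj_onI[OF lin s.fdsub_subspace[OF S]]) (rule to_from_string_eq_0[OF _ q])
  with s.inj_endo_surj[OF S lin inj]
  show "bij_betw (\<lambda>b. to_string q (from_string q b)) (vobj (string_rep n fwd c m) q) (vobj (string_rep n fwd c m) q)"
    by (simp add: bij_betw_def)
next
  let ?q = "(c + m) mod Suc n"
  let ?b = "\<lambda>y. if y = Some m then 1 else (0::'f)"
  have "?b \<in> vobj (string_rep n fwd c m) ?q"
    using m by (auto simp: string_rep_vobj)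
  moreover have "?b \<noteq> 0" by (auto simp: fun_eq_iff)
  ultimately show "\<not> zero_family (cyc_quiver n fwd) (vobj (string_rep n fwd c m :: (nat, nat, 'f, _) vrep))"
    unfolding zero_family_def by (metis atMost_iff cyc_quiver_simps(1) mod_Suc_le singletonD)
qed

end

section \<open>Strings obtained by unrolling the quiver from a vertex\<close>

context
  fixes n :: nat and fwd :: "nat \<Rightarrow> bool" and R :: "(nat, nat, 'f::field, 'v::ab_group_add) vrep"
  assumes R: "is_vrep (cyc_quiver n fwd) R"
begin

lemma periodic_walk_right:
  "periodic_walk (vscale R) (\<lambda>k. vobj R ((v + k) mod Suc n)) (\<lambda>k. fwd ((v + k) mod Suc n))
     (\<lambda>k. vmap R ((v + k) mod Suc n)) (Suc n)"
proof -
  interpret vector_space "vscale R" using R by (rule is_vrepD)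
  have eq: "Suc ((v + k) mod Suc n) mod Suc n = (v + Suc k) mod Suc n" for k
    by (simp add: mod_Suc_eq)
  show ?thesis
  proof
    fix k
    show "subspace (vobj R ((v + k) mod Suc n))" using is_vrepD(3)[OF R] by simp
    note l = is_vrepD(4)[OF R, of "(v + k) mod Suc n"]
    show "fwd ((v + k) mod Suc n) \<Longrightarrow> linear_betw (vscale R) (vscale R) (vobj R ((v + k) mod Suc n))
       (vobj R ((v + Suc k) mod Suc n)) (vmap R ((v + k) mod Suc n))"
      using l unfolding cyc_quiver_simps eq by simp
    show "\<not> fwd ((v + k) mod Suc n) \<Longrightarrow> linear_betw (vscale R) (vscale R) (vobj R ((v + Suc k) mod Suc n))
       (vobj R ((v + k) mod Suc n)) (vmap R ((v + k) mod Suc n))"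
      using l unfolding cyc_quiver_simps eq by simp
    show "fdsub (vscale R) (vobj R ((v + 0) mod Suc n))" using is_vrepD(2)[OF R] by simp
    have "(v + (k + Suc n)) mod Suc n = (v + k) mod Suc n" by (metis add.assoc mod_add_self2)
    then show "vobj R ((v + (k + Suc n)) mod Suc n) = vobj R ((v + k) mod Suc n)"
      "fwd ((v + (k + Suc n)) mod Suc n) = fwd ((v + k) mod Suc n)"
      "vmap R ((v + (k + Suc n)) mod Suc n) = vmap R ((v + k) mod Suc n)" by simp_all
  qed simp
qed

text \<open>Adding \<open>n\<close> is stepping back by one modulo \<open>n + 1\<close>. Step
  \<open>k\<close> crosses the arrow numbered by the vertex that it reaches, hence
  \<open>Suc k\<close>, and this arrow leads onwards iff it does not point clockwise.\<close>

lemma periodic_walk_left: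
  "periodic_walk (vscale R) (\<lambda>k. vobj R ((v + n * k) mod Suc n)) (\<lambda>k. \<not> fwd ((v + n * Suc k) mod Suc n))
     (\<lambda>k. vmap R ((v + n * Suc k) mod Suc n)) (Suc n)"
proof -
  interpret vector_space "vscale R" using R by (rule is_vrepD)
  have eq: "Suc ((v + n * Suc k) mod Suc n) mod Suc n = (v + n * k) mod Suc n" for k
  proof -
    have "Suc (v + n * Suc k) = (v + n * k) + Suc n" by simp
    then show ?thesis by (metis mod_Suc_eq mod_add_self2)
  qed
  show ?thesis
  proof
    fix k
    show "subspace (vobj R ((v + n * k) mod Suc n))" using is_vrepD(3)[OF R] by simp
    note l = is_vrepD(4)[OF R, of "(v + n * Suc k) mod Suc n"]
    show "\<not> fwd ((v + n * Suc k) mod Suc n) \<Longrightarrow> linear_betw (vscale R) (vscale R) (vobj R ((v + n * k) mod Suc n))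
       (vobj R ((v + n * Suc k) mod Suc n)) (vmap R ((v + n * Suc k) mod Suc n))"
      using l unfolding cyc_quiver_simps eq by simp
    show "\<not> \<not> fwd ((v + n * Suc k) mod Suc n) \<Longrightarrow> linear_betw (vscale R) (vscale R) (vobj R ((v + n * Suc k) mod Suc n))
       (vobj R ((v + n * k) mod Suc n)) (vmap R ((v + n * Suc k) mod Suc n))"
      using l unfolding cyc_quiver_simps eq by simp
    show "fdsub (vscale R) (vobj R ((v + n * 0) mod Suc n))" using is_vrepD(2)[OF R] by simp
    have "(v + n * (k + Suc n)) mod Suc n = (v + n * k) mod Suc n" for k
      by (simp only: add_mult_distrib2 add.assoc[symmetric] mod_mult_self1)
    note this[of k] this[of "Suc k"]
    then show "vobj R ((v + n * (k + Suc n)) mod Suc n) = vobj R ((v + n * k) mod Suc n)"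
      "(\<not> fwd ((v + n * Suc (k + Suc n)) mod Suc n)) = (\<not> fwd ((v + n * Suc k) mod Suc n))"
      "vmap R ((v + n * Suc (k + Suc n)) mod Suc n) = vmap R ((v + n * Suc k) mod Suc n)"
      by (simp_all only: add_Suc)
  qed simp
qed

text \<open>The chain occupies positions 1 to \<open>Suc k\<close>. Position 1 lies over
  \<open>v\<close>, as \<open>v + n + 1\<close> is \<open>v\<close> modulo \<open>n + 1\<close>.
  Arrow \<open>n\<close> of the walk closes the cycle at \<open>v\<close>, so \<open>start\<close>
  is the condition at the first position of the string.\<close>

lemma string_datum_right:
  fixes v k :: nat
  defines "W \<equiv> \<lambda>k. vobj R ((v + k) mod Suc n)" and "out \<equiv> \<lambda>k. fwd ((v + k) mod Suc n)"
    and "g \<equiv> \<lambda>k. vmap R ((v + k) mod Suc n)"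
  assumes x: "walk.end_chain W out g k x" and \<xi>: "walk.end_cochain (vscale R) W out g k \<xi>"
    and one: "\<And>j. j \<le> k \<Longrightarrow> \<xi> j (x j) = 1"
    and start: "if out n then \<forall>y\<in>W n. \<xi> 0 (g n y) = 0 else g n (x 0) = 0"
  shows "string_datum n fwd R (v + n) (Suc k)
    (\<lambda>l. if 1 \<le> l \<and> l \<le> Suc k then x (l - 1) else 0)
    (\<lambda>l. if 1 \<le> l \<and> l \<le> Suc k then \<xi> (l - 1) else (\<lambda>_. 0))"
proof -
  interpret periodic_walk "vscale R" W out g "Suc n"
    unfolding W_def out_def g_def by (rule periodic_walk_right)
  have eq: "(v + n + Suc l) mod Suc n = (v + l) mod Suc n" for l
  proof -
    have "v + n + Suc l = (v + l) + Suc n" by simp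
    then show ?thesis by (metis mod_add_self2)
  qed
  have eq': "Suc (v + n + l) mod Suc n = (v + l) mod Suc n" for l
    using eq[of l] by simp
  \<comment> \<open>Cases 10 to 13 below are \<open>x_fwd\<close>, \<open>x_bwd\<close>,
    \<open>\<xi>_fwd\<close> and \<open>\<xi>_bwd\<close>. The far end of the string enters in 10
    and 13, the assumption \<open>start\<close> in 11 and 12.\<close>
  show ?thesis
  proof (rule string_datum.intro, goal_cases)
    case 1 then show ?case by (rule R)
  next
    case 2 then show ?case by simp
  next
    case (3 l)
    have "x (l - 1) \<in> W (l - 1)" using x 3 by (auto simp: end_chain_def chain_def)
    then show ?case using 3 eq[of "l - 1"] by (simp add: W_def)
  next
    case (4 l)
    have "linear_betw (vscale R) (*) (W (l - 1)) UNIV (\<xi> (l - 1))"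
      using \<xi> 4 by (auto simp: end_cochain_def cochain_def)
    then show ?case using 4 eq[of "l - 1"] by (simp add: W_def)
  next
    case (5 l)
    then show ?case using one[of "l - 1"] by auto
  next
    case (10 l)
    then obtain j where j: "l = Suc j" "j \<le> k" by (cases l) auto
    have "out j" using 10 eq[of j] j by (simp add: out_def)
    moreover have "g j (x j) = (if j < k then x (Suc j) else 0)"
      using x \<open>out j\<close> j by (auto simp: end_chain_def chain_def)
    ultimately show ?case using j eq[of j] by (simp add: g_def)
  next
    case (11 l)
    show ?case
    proof (cases l)
      case 0
      then show ?thesis using 11 start by (simp add: out_def g_def)
    next
      case (Suc j)
      then have "\<not> out j" "j < k" using 11 eq[of j] by (auto simp: out_def)
      then have "g j (x (Suc j)) = x j" using x by (auto simp: end_chain_def chain_def)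
      then show ?thesis using Suc \<open>j < k\<close> eq[of j] by (simp add: g_def)
    qed
  next
    case (12 l y)
    show ?case
    proof (cases l)
      case 0
      then show ?thesis using 12 start by (simp add: out_def g_def W_def)
    next
      case (Suc j)
      then have "out j" "j < k" "y \<in> W j" using 12 eq[of j] by (auto simp: out_def W_def)
      then have "\<xi> (Suc j) (g j y) = \<xi> j y" using \<xi> by (auto simp: end_cochain_def cochain_def)
      then show ?thesis using Suc \<open>j < k\<close> eq[of j] by (simp add: g_def)
    qed
  next
    case (13 l y)
    then obtain j where j: "l = Suc j" "j \<le> k" by (cases l) auto
    have "\<not> out j" "y \<in> W (Suc j)" using 13 eq[of j] eq'[of l] j by (auto simp: out_def W_def)
    then have "\<xi> j (g j y) = (if j < k then \<xi> (Suc j) y else 0)"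
      using \<xi> j by (auto simp: end_cochain_def cochain_def)
    then show ?case using j eq[of j] by (simp add: g_def)
  qed auto
qed

text \<open>A string runs clockwise, so the chain is read backwards: position \<open>Suc k\<close>
  lies over \<open>v\<close>, and \<open>start\<close> becomes the condition at the last
  position.\<close>

lemma string_datum_left:
  fixes v k :: nat
  defines "W \<equiv> \<lambda>k. vobj R ((v + n * k) mod Suc n)" and "out \<equiv> \<lambda>k. \<not> fwd ((v + n * Suc k) mod Suc n)"
    and "g \<equiv> \<lambda>k. vmap R ((v + n * Suc k) mod Suc n)"
  assumes x: "walk.end_chain W out g k x" and \<xi>: "walk.end_cochain (vscale R) W out g k \<xi>"
    and one: "\<And>j. j \<le> k \<Longrightarrow> \<xi> j (x j) = 1"
    and start: "if out n then \<forall>y\<in>W n. \<xi> 0 (g n y) = 0 else g n (x 0) = 0"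
  shows "string_datum n fwd R (v + n * Suc k) (Suc k)
    (\<lambda>l. if 1 \<le> l \<and> l \<le> Suc k then x (Suc k - l) else 0)
    (\<lambda>l. if 1 \<le> l \<and> l \<le> Suc k then \<xi> (Suc k - l) else (\<lambda>_. 0))"
proof -
  interpret periodic_walk "vscale R" W out g "Suc n"
    unfolding W_def out_def g_def by (rule periodic_walk_left)
  have eq: "(v + n * Suc k + l) mod Suc n = (v + n * (Suc k - l)) mod Suc n" if "l \<le> Suc k" for l
  proof -
    obtain d where d: "Suc k = l + d" using le_Suc_ex[OF \<open>l \<le> Suc k\<close>] by blast
    have "v + n * Suc k + l = (v + n * (Suc k - l)) + l * Suc n"
      unfolding d by (simp add: add_mult_distrib2)
    then show ?thesis by (simp only: mod_mult_self1)
  qed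
  have sq: "(v + n * Suc n) mod Suc n = v mod Suc n"
    by (rule mod_mult_self1)
  have sq': "(v + n * n) mod Suc n = Suc v mod Suc n"
  proof (cases n)
    case (Suc i)
    have "v + n * n = Suc v + i * Suc n" unfolding Suc by simp
    then show ?thesis by (simp only: mod_mult_self1)
  qed simp
  show ?thesis
  proof (rule string_datum.intro, goal_cases)
    case 1 then show ?case by (rule R)
  next
    case 2 then show ?case by simp
  next
    case (3 l)
    have "x (Suc k - l) \<in> W (Suc k - l)" using x 3 by (auto simp: end_chain_def chain_def)
    then show ?case using 3 eq[of l] by (simp add: W_def)
  next
    case (4 l)
    have "linear_betw (vscale R) (*) (W (Suc k - l)) UNIV (\<xi> (Suc k - l))"
      using \<xi> 4 by (auto simp: end_cochain_def cochain_def)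
    then show ?case using 4 eq[of l] by (simp add: W_def)
  next
    case (5 l)
    then show ?case using one[of "Suc k - l"] by auto
  next
    case (10 l)
    show ?case
    proof (cases "l = Suc k")
      case True
      have "\<not> out n" using 10 True eq[of l] sq by (simp add: out_def)
      then have "g n (x 0) = 0" using start by simp
      then show ?thesis using True eq[of l] sq by (simp add: g_def)
    next
      case False
      define j where "j = k - l"
      have j: "Suc k - l = Suc j" "Suc k - Suc l = j" "j < k"
        using 10 False by (auto simp: j_def)
      have "\<not> out j" using 10 eq[of l] j by (simp add: out_def)
      then have "g j (x (Suc j)) = x j" using x j by (auto simp: end_chain_def chain_def)
      then show ?thesis using 10 False eq[of l] j by (simp add: g_def)
    qed
  next
    case (11 l)
    then have j: "Suc k - l = Suc (k - l)" "l \<le> k" by auto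
    have "out (k - l)" using 11 eq[of l] j by (simp add: out_def)
    then have "g (k - l) (x (k - l)) = (if l = 0 then 0 else x (Suc (k - l)))"
      using x j by (auto simp: end_chain_def chain_def)
    then show ?case using eq[of l] j by (auto simp: g_def)
  next
    case (12 l y)
    then have j: "Suc k - l = Suc (k - l)" "l \<le> k" by auto
    have "\<not> out (k - l)" "y \<in> W (Suc (k - l))" using 12 eq[of l] j by (simp_all add: out_def W_def)
    then have "\<xi> (k - l) (g (k - l) y) = (if l = 0 then 0 else \<xi> (Suc (k - l)) y)"
      using \<xi> j by (auto simp: end_cochain_def cochain_def)
    then show ?case using eq[of l] j by (auto simp: g_def)
  next
    case (13 l y)
    show ?case
    proof (cases "l = Suc k")
      case True
      have "out n" using 13 True eq[of l] sq by (simp add: out_def)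
      moreover have "y \<in> W n"
      proof -
        have "Suc ((v + n * Suc k + l) mod Suc n) mod Suc n = Suc v mod Suc n"
          using eq[of l] True by (simp add: mod_Suc_eq)
        then show ?thesis using 13 sq' by (simp add: W_def mod_Suc_eq)
      qed
      ultimately have "\<xi> 0 (g n y) = 0" using start by simp
      then show ?thesis using True eq[of l] sq by (simp add: g_def)
    next
      case False
      define j where "j = k - l"
      have j: "Suc k - l = Suc j" "Suc k - Suc l = j" "j < k"
        using 13 False by (auto simp: j_def)
      have "out j" using 13 eq[of l] j by (simp add: out_def)
      moreover have "y \<in> W j" using 13 False eq[of "Suc l"] j by (simp add: W_def)
      ultimately have "\<xi> (Suc j) (g j y) = \<xi> j y" using \<xi> j by (auto simp: end_cochain_def cochain_def)
      then show ?thesis using 13 False eq[of l] j by (simp add: g_def)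
    qed
  qed auto
qed

end
text \<open>The walk starts at the tail of a non-injective arrow, or else at the head of a
  non-surjective one, and sets out away from that arrow, which therefore closes the period.
  Orientation decides between the two walks. Cokernels come second because
  \<open>cokernel_string\<close> needs all arrows to be injective.\<close>

lemma indecomposable_string_rep:
  fixes R :: "(nat, nat, 'f::field, 'v::ab_group_add) vrep"
  assumes ind: "indecomposable (cyc_quiver n fwd) R" and a: "a \<le> n"
    and nb: "\<not> bij_betw (vmap R a) (vobj R (tail (cyc_quiver n fwd) a)) (vobj R (head (cyc_quiver n fwd) a))"
  shows "is_string_rep n fwd R"
proof -
  have R: "is_vrep (cyc_quiver n fwd) R" using ind by (simp add: indecomposable_def)
  interpret vector_space "vscale R" using R by (rule is_vrepD)
  have conclude: "is_string_rep n fwd R" if "string_datum n fwd R c m x \<xi>" for c m x \<xi>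
    using string_datum.iso_string_rep[OF that ind] string_datum.m[OF that]
    unfolding is_string_rep_def by blast
  have mods: "(a + n * Suc n) mod Suc n = a" "(Suc a mod Suc n + n) mod Suc n = a"
    "(Suc a mod Suc n + 0) mod Suc n = Suc a mod Suc n" "(a + n * 0) mod Suc n = a"
    "(a + n * n) mod Suc n = Suc a mod Suc n" if "a \<le> n" for a
  proof -
    show "(a + n * Suc n) mod Suc n = a" using that by (simp only: mod_mult_self1) simp
    have "Suc a + n = a + Suc n" by simp
    then show "(Suc a mod Suc n + n) mod Suc n = a"
      using that by (simp only: mod_add_left_eq mod_add_self2) simp
    show "(a + n * n) mod Suc n = Suc a mod Suc n"
    proof (cases n)
      case (Suc i)
      have "a + n * n = Suc a + i * Suc n" unfolding Suc by simp
      then show ?thesis by (simp only: mod_mult_self1)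
    qed (use that in simp)
  qed (use that in auto)
  show ?thesis
  proof (cases "\<exists>a\<le>n. \<exists>x\<in>vobj R (tail (cyc_quiver n fwd) a). x \<noteq> 0 \<and> vmap R a x = 0")
    case True
    then obtain a x where a: "a \<le> n" and x: "x \<in> vobj R (tail (cyc_quiver n fwd) a)" "x \<noteq> 0" "vmap R a x = 0"
      by blast
    show ?thesis
    proof (cases "fwd a")
      case True
      interpret w: periodic_walk "vscale R" "\<lambda>k. vobj R ((a + n * k) mod Suc n)"
        "\<lambda>k. \<not> fwd ((a + n * Suc k) mod Suc n)" "\<lambda>k. vmap R ((a + n * Suc k) mod Suc n)" "Suc n"
        by (rule periodic_walk_left[OF R])
      obtain k y \<xi> where "w.end_chain k y" "w.end_cochain k \<xi>" "y 0 = x" "\<And>j. j \<le> k \<Longrightarrow> \<xi> j (y j) = 1"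
      proof (rule w.kernel_string[of x])
        show "\<not> \<not> fwd ((a + n * Suc (Suc n - 1)) mod Suc n)"
          unfolding diff_Suc_1 mods[OF a] using True by simp
        show "vmap R ((a + n * Suc (Suc n - 1)) mod Suc n) x = 0"
          unfolding diff_Suc_1 mods[OF a] by (rule x)
        show "x \<in> vobj R ((a + n * 0) mod Suc n)"
          unfolding mods[OF a] using x True by simp
      qed (use x in auto)
      note * = this
      show ?thesis
        by (rule conclude, rule string_datum_left[OF R *(1,2,4)])
          (unfold mods[OF a], use True x \<open>y 0 = x\<close> in simp_all)
    next
      case False
      interpret w: periodic_walk "vscale R" "\<lambda>k. vobj R ((Suc a mod Suc n + k) mod Suc n)"
        "\<lambda>k. fwd ((Suc a mod Suc n + k) mod Suc n)" "\<lambda>k. vmap R ((Suc a mod Suc n + k) mod Suc n)" "Suc n"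
        by (rule periodic_walk_right[OF R])
      obtain k y \<xi> where "w.end_chain k y" "w.end_cochain k \<xi>" "y 0 = x" "\<And>j. j \<le> k \<Longrightarrow> \<xi> j (y j) = 1"
      proof (rule w.kernel_string[of x])
        show "\<not> fwd ((Suc a mod Suc n + (Suc n - 1)) mod Suc n)"
          unfolding diff_Suc_1 mods[OF a] using False by simp
        show "vmap R ((Suc a mod Suc n + (Suc n - 1)) mod Suc n) x = 0"
          unfolding diff_Suc_1 mods[OF a] by (rule x)
        show "x \<in> vobj R ((Suc a mod Suc n + 0) mod Suc n)"
          unfolding mods[OF a] using x False by simp
      qed (use x in auto)
      note * = this
      show ?thesis
        by (rule conclude, rule string_datum_right[OF R *(1,2,4)])
          (unfold mods[OF a], use False x \<open>y 0 = x\<close> in simp_all)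
    qed
  next
    case False
    then have inj: "x = 0" if "i \<le> n" "x \<in> vobj R (tail (cyc_quiver n fwd) i)" "vmap R i x = 0" for i x
      using that by blast
    have lin: "linear_betw (vscale R) (vscale R) (vobj R (tail (cyc_quiver n fwd) a)) (vobj R (head (cyc_quiver n fwd) a)) (vmap R a)"
      using is_vrepD(4)[OF R] a by simp
    have "inj_on (vmap R a) (vobj R (tail (cyc_quiver n fwd) a))"
      by (rule linear_betw_inj_onI[OF lin]) (use is_vrepD(3)[OF R] inj a in auto)
    with nb have ns: "vmap R a ` vobj R (tail (cyc_quiver n fwd) a) \<noteq> vobj R (head (cyc_quiver n fwd) a)"
      by (simp add: bij_betw_def)
    show ?thesis
    proof (cases "fwd a")
      case True
      let ?v = "Suc a mod Suc n"
      interpret w: periodic_walk "vscale R" "\<lambda>k. vobj R ((?v + k) mod Suc n)"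
        "\<lambda>k. fwd ((?v + k) mod Suc n)" "\<lambda>k. vmap R ((?v + k) mod Suc n)" "Suc n"
        by (rule periodic_walk_right[OF R])
      obtain k y \<xi> where *: "w.end_chain k y" "w.end_cochain k \<xi>"
        "\<And>z. z \<in> vobj R ((?v + n) mod Suc n) \<Longrightarrow> \<xi> 0 (vmap R ((?v + n) mod Suc n) z) = 0"
        "\<And>j. j \<le> k \<Longrightarrow> \<xi> j (y j) = 1"
      proof (rule w.cokernel_string, goal_cases)
        case 1 show ?case unfolding diff_Suc_1 mods[OF a] using True by simp
      next
        case 2 show ?case unfolding diff_Suc_1 mods[OF a] using True ns by simp
      next
        case (3 k x)
        then show ?case using inj[of "(?v + k) mod Suc n" x] by simp
      next
        case (4 k x)
        have "Suc ((?v + k) mod Suc n) mod Suc n = (?v + Suc k) mod Suc n" by (simp add: mod_Suc_eq)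
        with 4 show ?case using inj[of "(?v + k) mod Suc n" x] unfolding cyc_quiver_simps by simp
      next
        case (5 k y \<xi>) then show ?case unfolding diff_Suc_1 by blast
      qed
      show ?thesis
        by (rule conclude, rule string_datum_right[OF R *(1,2,4)])
          (use *(3) True in \<open>unfold mods[OF a], simp_all\<close>)
    next
      case fw: False
      interpret w: periodic_walk "vscale R" "\<lambda>k. vobj R ((a + n * k) mod Suc n)"
        "\<lambda>k. \<not> fwd ((a + n * Suc k) mod Suc n)" "\<lambda>k. vmap R ((a + n * Suc k) mod Suc n)" "Suc n"
        by (rule periodic_walk_left[OF R])
      have eq: "Suc ((a + n * Suc k) mod Suc n) mod Suc n = (a + n * k) mod Suc n" for k
      proof -
        have "Suc (a + n * Suc k) = (a + n * k) + Suc n" by simp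
        then show ?thesis by (metis mod_Suc_eq mod_add_self2)
      qed
      obtain k y \<xi> where *: "w.end_chain k y" "w.end_cochain k \<xi>"
        "\<And>z. z \<in> vobj R ((a + n * n) mod Suc n) \<Longrightarrow> \<xi> 0 (vmap R ((a + n * Suc n) mod Suc n) z) = 0"
        "\<And>j. j \<le> k \<Longrightarrow> \<xi> j (y j) = 1"
      proof (rule w.cokernel_string, goal_cases)
        case 1 show ?case unfolding diff_Suc_1 mods[OF a] using fw by simp
      next
        case 2 show ?case unfolding diff_Suc_1 mods[OF a] using fw ns by simp
      next
        case (3 k x)
        then show ?case using inj[of "(a + n * Suc k) mod Suc n" x] eq[of k] unfolding cyc_quiver_simps by simp
      next
        case (4 k x)
        then show ?case using inj[of "(a + n * Suc k) mod Suc n" x] unfolding cyc_quiver_simps by simp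
      next
        case (5 k y \<xi>) then show ?case unfolding diff_Suc_1 by blast
      qed
      show ?thesis
        by (rule conclude, rule string_datum_left[OF R *(1,2,4)])
          (use *(3) fw in \<open>unfold mods[OF a], simp_all\<close>)
    qed
  qed
qed

section \<open>Factors of \<open>X^g - 1\<close>\<close>

lemma poly_ideal_principal:
  fixes I :: "'f::field poly set"
  assumes nz: "p \<in> I" "p \<noteq> 0"
    and add: "\<And>p q. p \<in> I \<Longrightarrow> q \<in> I \<Longrightarrow> p + q \<in> I"
    and mult: "\<And>p q. p \<in> I \<Longrightarrow> q * p \<in> I"
  obtains h where "h \<in> I" "lead_coeff h = 1" "\<And>q. q \<in> I \<Longrightarrow> h dvd q"
proof -
  obtain d where d: "d \<in> I \<and> d \<noteq> 0" and min: "\<And>q. q \<in> I \<and> q \<noteq> 0 \<Longrightarrow> degree d \<le> degree q"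
    using ex_has_least_nat[of "\<lambda>q. q \<in> I \<and> q \<noteq> 0" p degree] nz by blast
  have dvd: "d dvd q" if "q \<in> I" for q
  proof (rule ccontr)
    assume nd: "\<not> d dvd q"
    have "q mod d = q + (- (q div d)) * d" by (simp add: minus_div_mult_eq_mod[symmetric])
    then have "q mod d \<in> I" using add[OF that mult[of d "- (q div d)"]] d by simp
    moreover have "q mod d \<noteq> 0" using nd by (simp add: mod_eq_0_iff_dvd)
    ultimately have "degree d \<le> degree (q mod d)" using min by blast
    then show False using degree_mod_less[of d q] d \<open>q mod d \<noteq> 0\<close> by simp
  qed
  define h where "h = [:inverse (lead_coeff d):] * d"
  have "lead_coeff h = 1" using d by (simp add: h_def)
  moreover have "h dvd d" using d unfolding h_def by (simp add: smult_dvd_iff)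
  ultimately show thesis
    using that[of h] mult[of d "[:inverse (lead_coeff d):]"] d dvd dvd_trans[of h d]
    unfolding h_def by blast
qed

text \<open>Coprimality as a Bezout identity. Such identities multiply, and on a module killed by
  \<open>p * q\<close> they provide the projections of a direct decomposition.\<close>

definition comaximal :: "'a::comm_ring_1 \<Rightarrow> 'a \<Rightarrow> bool" where
  "comaximal p q \<longleftrightarrow> (\<exists>a b. a * p + b * q = 1)"

lemma comaximal_mult:
  assumes "comaximal p q" "comaximal p' q"
  shows "comaximal (p * p') q"
proof -
  obtain a b a' b' where "a * p + b * q = 1" "a' * p' + b' * q = 1"
    using assms by (auto simp: comaximal_def)
  then have "(a * p + b * q) * (a' * p' + b' * q) = 1" by simp
  then have "(a * a') * (p * p') + (a * p * b' + b * (a' * p' + b' * q)) * q = 1"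
    by (simp add: algebra_simps)
  then show ?thesis unfolding comaximal_def by blast
qed

lemma comaximal_sym: "comaximal p q \<Longrightarrow> comaximal q p"
  unfolding comaximal_def by (metis add.commute)

lemma comaximal_one: "comaximal 1 q"
  unfolding comaximal_def by (rule exI[of _ 1], rule exI[of _ 0]) simp

lemma comaximal_power: "comaximal p q \<Longrightarrow> comaximal (p ^ k) q"
  by (induction k) (auto intro: comaximal_mult comaximal_one)

lemma comaximal_power2: "comaximal p q \<Longrightarrow> comaximal (p ^ k) (q ^ l)"
  by (intro comaximal_power comaximal_sym[OF comaximal_power[OF comaximal_sym]])

lemma comaximal_dvd_is_unit:
  assumes "comaximal p q" "d dvd p" "d dvd q"
  shows "is_unit d"
proof -
  obtain a b where "a * p + b * q = 1" using assms by (auto simp: comaximal_def)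
  moreover have "d dvd a * p + b * q" by (intro dvd_add dvd_mult assms)
  ultimately show ?thesis by simp
qed

text \<open>A generator of the ideal of \<open>f\<close> and \<open>q\<close> divides
  \<open>f\<close>, so it is a unit or an associate of \<open>f\<close>; the latter would make
  \<open>f\<close> divide \<open>q\<close>.\<close>

lemma irreducible_comaximal:
  fixes f :: "'f::field poly"
  assumes f: "irreducible f" and nd: "\<not> f dvd q"
  shows "comaximal f q"
proof -
  let ?I = "{a * f + b * q |a b. True}"
  have f0: "f \<noteq> 0" using f by auto
  have fI: "f \<in> ?I" by (rule CollectI, rule exI[of _ 1], rule exI[of _ 0]) simp
  have qI: "q \<in> ?I" by (rule CollectI, rule exI[of _ 0], rule exI[of _ 1]) simp
  obtain h where h: "h \<in> ?I" "\<And>r. r \<in> ?I \<Longrightarrow> h dvd r"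
  proof (rule poly_ideal_principal[OF fI f0], goal_cases)
    case (1 p r)
    then obtain a b a' b' where "p = a * f + b * q" "r = a' * f + b' * q" by blast
    then have "p + r = (a + a') * f + (b + b') * q" by (simp add: algebra_simps)
    then show ?case by blast
  next
    case (2 p r)
    then obtain a b where "p = a * f + b * q" by blast
    then have "r * p = (r * a) * f + (r * b) * q" by (simp add: algebra_simps)
    then show ?case by blast
  qed blast
  obtain a b where ab: "h = a * f + b * q" using h by auto
  from h(2)[OF fI] obtain c where c: "f = h * c" by (auto elim: dvdE)
  have "is_unit h"
  proof (rule ccontr)
    assume "\<not> is_unit h"
    then have "is_unit c" using f c by (auto simp: irreducible_def)
    then have "f dvd h" using c by simp
    then show False using h(2)[OF qI] nd dvd_trans[of f h q] by simp
  qed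
  then obtain u where "1 = h * u" by (auto elim: dvdE)
  then have "(u * a) * f + (u * b) * q = 1" using ab by (simp add: algebra_simps)
  then show ?thesis unfolding comaximal_def by blast
qed

lemma irreducible_dvd_power:
  fixes f :: "'f::field poly"
  assumes "irreducible f" "f dvd q ^ k"
  shows "f dvd q"
proof (rule ccontr)
  assume "\<not> f dvd q"
  then have "comaximal f (q ^ k)"
    using irreducible_comaximal[OF assms(1)] comaximal_sym comaximal_power by blast
  then have "is_unit f" using comaximal_dvd_is_unit[of f "q ^ k" f] assms by simp
  then show False using assms(1) by (auto simp: irreducible_def)
qed

section \<open>Irreducible factors and their multiplicities\<close>

lemma irreducible_monic_factor:
  fixes h :: "'f::field poly"
  assumes "0 < degree h"
  obtains f where "irreducible f" "lead_coeff f = 1" "f dvd h" "0 < degree f"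
proof -
  have "h dvd h \<and> 0 < degree h" using assms by simp
  then obtain d where d: "d dvd h \<and> 0 < degree d"
    and min: "\<And>q. q dvd h \<and> 0 < degree q \<Longrightarrow> degree d \<le> degree q"
    using ex_has_least_nat[of "\<lambda>q. q dvd h \<and> 0 < degree q" h degree] by blast
  have d0: "d \<noteq> 0" using d by auto
  define f where "f = smult (inverse (lead_coeff d)) d"
  have f: "f dvd h" "degree f = degree d" "lead_coeff f = 1"
    using d d0 by (simp_all add: f_def smult_dvd_iff)
  have "irreducible f"
  proof (rule irreducibleI)
    show "f \<noteq> 0" using f(3) by auto
    show "\<not> is_unit f" using f(2) d by (simp add: is_unit_iff_degree \<open>f \<noteq> 0\<close>)
    fix a b assume ab: "f = a * b"
    then have "a \<noteq> 0" "b \<noteq> 0" using \<open>f \<noteq> 0\<close> by auto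
    then have deg: "degree a + degree b = degree d" using f(2) ab by (simp add: degree_mult_eq)
    have "a dvd h" using f(1) ab dvd_trans[of a f h] by simp
    then have "degree a = 0 \<or> degree d \<le> degree a" using min[of a] by (cases "degree a") simp_all
    then show "is_unit a \<or> is_unit b"
      using deg \<open>a \<noteq> 0\<close> \<open>b \<noteq> 0\<close> by (auto simp: is_unit_iff_degree)
  qed
  then show thesis using that[of f] f d by simp
qed

lemma irreducible_power_factor:
  fixes h :: "'f::field poly"
  assumes f: "irreducible f" "0 < degree f" "f dvd h" and h: "h \<noteq> 0"
  obtains m e where "h = f ^ m * e" "1 \<le> m" "\<not> f dvd e"
proof -
  have f0: "f \<noteq> 0" using f by auto
  let ?M = "{k. f ^ k dvd h}"
  have bound: "k \<le> degree h" if "k \<in> ?M" for k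
  proof -
    have "degree (f ^ k) \<le> degree h" using that h by (auto intro: dvd_imp_degree_le)
    moreover have "k \<le> degree (f ^ k)" using f(2) f0 by (simp add: degree_power_eq)
    ultimately show ?thesis by simp
  qed
  then have fin: "finite ?M" by (meson finite_nat_set_iff_bounded_le)
  have "1 \<in> ?M" using f(3) by simp
  define m where "m = Max ?M"
  have "m \<in> ?M" unfolding m_def by (rule Max_in[OF fin]) (use \<open>1 \<in> ?M\<close> in blast)
  then obtain e where e: "h = f ^ m * e" by (auto elim: dvdE)
  have "\<not> f dvd e"
  proof
    assume "f dvd e"
    then have "f ^ Suc m dvd h" unfolding e power_Suc2 by (intro mult_dvd_mono) auto
    then have "Suc m \<le> m" unfolding m_def using fin by (intro Max_ge) auto
    then show False by simp
  qed
  moreover have "1 \<le> m" unfolding m_def using fin \<open>1 \<in> ?M\<close> by (intro Max_ge) auto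
  ultimately show thesis using that e by blast
qed

text \<open>For positive \<open>g\<close> this is not the cyclotomic polynomial of index
  \<open>g\<close>, but the product of those whose index divides \<open>g\<close>.\<close>

definition cyclo :: "nat \<Rightarrow> 'f::field poly" where
  "cyclo g = monom 1 g - 1"

lemma cyclo_nonzero: "0 < g \<Longrightarrow> cyclo g \<noteq> 0"
proof
  assume "0 < g" "cyclo g = (0 :: 'a poly)"
  then have "coeff (cyclo g :: 'a poly) g = 0" by simp
  with \<open>0 < g\<close> show False by (simp add: cyclo_def)
qed

text \<open>With \<open>D\<close> for the derivative, \<open>X * D (X^g - 1) - g * (X^g - 1)\<close>
  is the constant \<open>g\<close>, a unit. Inserting \<open>f * w\<close> and the product rule
  displays it as a combination of \<open>f\<close> and \<open>w\<close>.\<close>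

lemma cyclo_factor_separable:
  fixes f :: "'f::field poly"
  assumes g: "of_nat g \<noteq> (0::'f)" and eq: "cyclo g = f * w"
  shows "comaximal f w"
proof -
  have g0: "0 < g" using g by (cases g) auto
  obtain i where i: "g = Suc i" using g0 by (cases g) auto
  have "pderiv (cyclo g) = monom (of_nat g) i" unfolding cyclo_def i
    by (simp add: pderiv_diff pderiv_monom)
  then have "[:0, 1:] * pderiv (cyclo g) = monom (of_nat g :: 'f) g"
    unfolding i by (simp add: monom_Suc)
  moreover have "[:of_nat g:] * cyclo g = monom (of_nat g :: 'f) g - [:of_nat g:]"
    by (simp add: cyclo_def smult_diff_right smult_monom)
  ultimately have "[:0, 1:] * pderiv (cyclo g) - [:of_nat g:] * cyclo g = [:of_nat g :: 'f:]"
    by simp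
  moreover have "pderiv (f * w) = pderiv f * w + f * pderiv w"
    by (simp add: pderiv_mult mult.commute)
  ultimately have *: "[:0, 1:] * (pderiv f * w + f * pderiv w) - [:of_nat g:] * (f * w) = [:of_nat g:]"
    by (simp only: eq)
  have rearrange: "(c * t * w') * f + (c * (t * f' - u * f)) * w = c * (t * (f' * w + f * w') - u * (f * w))"
    for c t u f f' w w' :: "'f poly"
    by (simp add: algebra_simps)
  have "[:inverse (of_nat g):] * [:of_nat g:] = (1 :: 'f poly)" using g by (simp add: one_pCons)
  then have "([:inverse (of_nat g):] * [:0, 1:] * pderiv w) * f
      + ([:inverse (of_nat g):] * ([:0, 1:] * pderiv f - [:of_nat g:] * f)) * w = 1"
    unfolding rearrange * .
  then show ?thesis unfolding comaximal_def by blast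
qed

text \<open>Frobenius is applied to \<open>cyclo g + 1\<close>, a monomial, which avoids any
  question about the sign of a power of -1.\<close>

lemma cyclo_power:
  assumes "prime CHAR('f::field)"
  shows "(cyclo (g * CHAR('f) ^ k) :: 'f poly) = cyclo g ^ (CHAR('f) ^ k)"
proof -
  let ?P = "CHAR('f) ^ k"
  have "prime CHAR('f poly)" "?P = CHAR('f poly) ^ k" using assms by simp_all
  from freshmans_dream'[OF this, of "cyclo g" 1]
  have "(cyclo g + 1) ^ ?P = cyclo g ^ ?P + (1 :: 'f poly)" by simp
  then show ?thesis by (simp add: cyclo_def monom_power)
qed

lemma cyclo_decompose:
  assumes "0 < g"
  obtains g' P where "g = g' * P" "of_nat g' \<noteq> (0::'f::field)" "(cyclo g :: 'f poly) = cyclo g' ^ P"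
    "if CHAR('f) = 0 then P = 1 else \<exists>k. P = CHAR('f) ^ k"
proof (cases "CHAR('f) = 0")
  case True
  then have "of_nat g \<noteq> (0::'f)" using assms by (simp add: of_nat_eq_0_iff_char_dvd)
  then show thesis using that[of g 1] True by simp
next
  case False
  then have pr: "prime CHAR('f)" by (intro prime_CHAR_semidom) auto
  obtain g' where g': "g = CHAR('f) ^ multiplicity CHAR('f) g * g'" "\<not> CHAR('f) dvd g'"
    using multiplicity_decompose'[of g "CHAR('f)"] assms pr by (metis not_gr_zero not_prime_unit)
  define k where "k = multiplicity CHAR('f) g"
  have gk: "g = g' * CHAR('f) ^ k" using g'(1) by (simp add: k_def mult.commute)
  show thesis
    using that[of g' "CHAR('f) ^ k"] gk g'(2) cyclo_power[OF pr, of g' k] False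
    by (auto simp: of_nat_eq_0_iff_char_dvd)
qed

section \<open>Evaluation at points of the algebraic closure\<close>

lemma map_poly_to_ac_eval_mult:
  "poly (map_poly to_ac (p * q)) z = poly (map_poly to_ac p) z * poly (map_poly to_ac q) z"
proof -
  have add: "poly (map_poly to_ac (p + q)) z = poly (map_poly to_ac p) z + poly (map_poly to_ac q) z"
    for p q :: "'a poly"
    by (induction p q rule: poly_induct2) (simp_all add: map_poly_pCons algebra_simps)
  have smult: "poly (map_poly to_ac (smult c q)) z = to_ac c * poly (map_poly to_ac q) z"
    for c and q :: "'a poly"
    by (induction q) (simp_all add: map_poly_pCons algebra_simps)
  show ?thesis
    by (induction p) (simp_all add: map_poly_pCons add smult algebra_simps)
qed

lemma map_poly_to_ac_eval_add:
  "poly (map_poly to_ac (p + q)) z = poly (map_poly to_ac p) z + poly (map_poly to_ac q) z"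
  by (induction p q rule: poly_induct2) (simp_all add: map_poly_pCons algebra_simps)

lemma map_poly_to_ac_cyclo: "poly (map_poly to_ac (cyclo g)) z = z ^ g - 1"
proof -
  have m: "poly (map_poly to_ac (monom 1 g)) z = z ^ g"
    by (simp add: map_poly_monom poly_monom)
  have "monom 1 g = cyclo g + (1 :: 'a poly)" by (simp add: cyclo_def)
  then have "z ^ g = poly (map_poly to_ac (cyclo g)) z + 1"
    using m map_poly_to_ac_eval_add[of "cyclo g" 1 z] by (simp add: map_poly_1')
  then show ?thesis by simp
qed

lemma irreducible_root_min_poly:
  fixes f :: "'f::field poly" and z :: "'f alg_closure"
  assumes f: "irreducible f" "lead_coeff f = 1" and z: "poly (map_poly to_ac f) z = 0"
  shows "is_min_poly f z"
  unfolding is_min_poly_def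
proof (intro conjI allI impI f z)
  fix q assume q: "poly (map_poly to_ac q) z = 0"
  show "f dvd q"
  proof (rule ccontr)
    assume "\<not> f dvd q"
    then obtain a b where "a * f + b * q = 1"
      using irreducible_comaximal[OF f(1), of q] unfolding comaximal_def by blast
    then have "poly (map_poly to_ac (a * f + b * q)) z = 1" by (simp add: map_poly_1')
    then show False using q z by (simp add: map_poly_to_ac_eval_add map_poly_to_ac_eval_mult)
  qed
qed

text \<open>In \<open>cyclo g = cyclo g' ^ P\<close> the factor \<open>f\<close> occurs exactly
  \<open>P\<close> times, being a simple factor of the separable \<open>cyclo g'\<close>. As
  \<open>h'\<close> is comaximal to \<open>f ^ m\<close>, the power \<open>f ^ m\<close> is the
  whole contribution of \<open>f\<close>, so \<open>m = P\<close>.\<close>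

lemma cyclo_primary_factor:
  fixes f :: "'f::field poly"
  assumes g: "0 < g" and f: "irreducible f" "lead_coeff f = 1" "0 < degree f" and m: "1 \<le> m"
    and eq: "cyclo g = f ^ m * h'" and co: "comaximal (f ^ m) h'"
  shows "\<exists>z :: 'f alg_closure. root_of_unity z \<and> is_min_poly f z"
    "if CHAR('f) = 0 then m = 1 else \<exists>k. m = CHAR('f) ^ k"
proof -
  have f0: "f \<noteq> 0" using f by auto
  have "degree (map_poly to_ac f) = degree f" by (simp add: degree_map_poly)
  then obtain z :: "'f alg_closure" where z: "poly (map_poly to_ac f) z = 0"
    using f(3) alg_closed_imp_poly_has_root[of "map_poly to_ac f"] by auto
  obtain i where i: "m = Suc i" using m by (cases m) auto
  have "z ^ g - 1 = 0"
    using map_poly_to_ac_cyclo[of g z] z unfolding eq i power_Suc by (simp add: map_poly_to_ac_eval_mult)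
  then have "root_of_unity z" using g by (auto simp: root_of_unity_def)
  then show "\<exists>z :: 'f alg_closure. root_of_unity z \<and> is_min_poly f z"
    using irreducible_root_min_poly[OF f(1,2) z] by blast
  obtain g' P where gP: "g = g' * P" "of_nat g' \<noteq> (0::'f)" "(cyclo g :: 'f poly) = cyclo g' ^ P"
    "if CHAR('f) = 0 then P = 1 else \<exists>k. P = CHAR('f) ^ k"
    using cyclo_decompose[OF g, where ?'f = 'f] by metis
  have nu: "\<not> is_unit f" using f by (simp add: irreducible_def)
  have ndh: "\<not> f dvd h'"
    using comaximal_dvd_is_unit[OF co, of f] nu m by (auto intro: dvd_power)
  have "f dvd cyclo g' ^ P" unfolding gP(3)[symmetric] eq i power_Suc by simp
  then have "f dvd cyclo g'" using irreducible_dvd_power[OF f(1)] by blast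
  then obtain w where w: "cyclo g' = f * w" by (auto elim: dvdE)
  have ndw: "\<not> f dvd w ^ P"
    using comaximal_dvd_is_unit[OF cyclo_factor_separable[OF gP(2) w], of f] nu
      irreducible_dvd_power[OF f(1)] by auto
  have main: "f ^ m * h' = f ^ P * w ^ P"
    using eq gP(3) w by (simp add: power_mult_distrib)
  have "m = P"
  proof (rule ccontr)
    assume "m \<noteq> P"
    then consider d where "P = m + Suc d" | d where "m = P + Suc d"
      by (metis less_imp_Suc_add linorder_neqE_nat add_Suc_right)
    then show False
    proof cases
      case 1
      then have "f ^ m * h' = f ^ m * (f * (f ^ d * w ^ P))" using main by (simp add: power_add mult.assoc)
      then have "h' = f * (f ^ d * w ^ P)" using f0 by simp
      then show False using ndh by simp
    next
      case 2
      then have "f ^ P * (f * (f ^ d * h')) = f ^ P * w ^ P" using main by (simp add: power_add mult.assoc)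
      then have "f * (f ^ d * h') = w ^ P" using f0 by simp
      then show False using ndw by (metis dvd_triv_left)
    qed
  qed
  then show "if CHAR('f) = 0 then m = 1 else \<exists>k. m = CHAR('f) ^ k" using gP(4) by simp
qed

text \<open>If \<open>z ^ N = 1\<close> and \<open>g'\<close> is the part of \<open>N\<close> prime
  to the characteristic, then \<open>z\<close> is already a root of \<open>cyclo g'\<close>, because
  a power of the value there is 0. So \<open>cyclo g' = f * w\<close> with comaximal factors, and
  \<open>g = g' * m\<close> works: passing from \<open>cyclo g'\<close> to \<open>cyclo g\<close> is
  raising to the power \<open>m\<close>.\<close>

lemma min_poly_primary_factor:
  fixes f :: "'f::field poly" and z :: "'f alg_closure"
  assumes z: "root_of_unity z" "is_min_poly f z"
    and m: "if CHAR('f) = 0 then m = 1 else \<exists>k. m = CHAR('f) ^ k"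
  obtains g h' where "0 < g" "cyclo g = f ^ m * h'" "comaximal (f ^ m) h'"
proof -
  obtain N where N: "0 < N" "z ^ N = 1" using z by (auto simp: root_of_unity_def)
  obtain g' P where gP: "N = g' * P" "of_nat g' \<noteq> (0::'f)" "(cyclo N :: 'f poly) = cyclo g' ^ P"
    using cyclo_decompose[OF N(1), where ?'f = 'f] by metis
  have pw: "poly (map_poly to_ac (q ^ k)) z = poly (map_poly to_ac q) z ^ k" for q :: "'f poly" and k
    by (induction k) (simp_all add: map_poly_to_ac_eval_mult map_poly_1')
  have "poly (map_poly to_ac (cyclo g' :: 'f poly)) z ^ P = 0"
    using N map_poly_to_ac_cyclo[of N z] unfolding pw[symmetric] gP(3)[symmetric] by simp
  then have "poly (map_poly to_ac (cyclo g' :: 'f poly)) z = 0" by simp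
  then have "f dvd cyclo g'" using z by (auto simp: is_min_poly_def)
  then obtain w where w: "cyclo g' = f * w" by (auto elim: dvdE)
  have co: "comaximal (f ^ m) (w ^ m)"
    by (rule comaximal_power2[OF cyclo_factor_separable[OF gP(2) w]])
  have g'0: "0 < g'" using gP(2) by (cases g') auto
  have "(cyclo (g' * m) :: 'f poly) = cyclo g' ^ m \<and> 0 < m"
  proof (cases "CHAR('f) = 0")
    case False
    then have pr: "prime CHAR('f)" by (intro prime_CHAR_semidom) auto
    then show ?thesis using m False cyclo_power[OF pr, of g'] by (auto simp: prime_gt_0_nat)
  qed (use m in auto)
  then show thesis using that[of "g' * m" "w ^ m"] co w g'0 by (simp add: power_mult_distrib)
qed

section \<open>Automorphisms as modules over the polynomial ring\<close>

lemma fdsub_image: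
  assumes s: "vector_space s" and t: "vector_space t" and V: "fdsub s V" and h: "linear_betw s t V W h"
  shows "fdsub t (h ` V)"
proof -
  interpret s: vector_space s by fact
  interpret t: vector_space t by fact
  obtain B where B: "finite B" "V = s.span B" using V by (auto simp: fdsub_def)
  have sV: "s.subspace V" using V by (rule s.fdsub_subspace)
  have BV: "B \<subseteq> V" using B s.span_superset by auto
  have "h ` V = t.span (h ` B)"
  proof
    have "V \<subseteq> {x\<in>V. h x \<in> t.span (h ` B)}"
      unfolding B(2) by (rule s.span_minimal[OF _ s.subspace_vimage_betw[OF h[unfolded B(2)] _ t t.subspace_span]])
        (auto intro: s.span_base t.span_base)
    then show "h ` V \<subseteq> t.span (h ` B)" by auto
    show "t.span (h ` B) \<subseteq> h ` V"
      by (rule t.span_minimal[OF _ s.subspace_image_betw[OF h sV t]]) (use BV in auto)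
  qed
  then show ?thesis using B(1) unfolding fdsub_def by (intro exI[of _ "h ` B"]) auto
qed

locale aut_module = vector_space scale
  for scale :: "'f::field \<Rightarrow> 'v::ab_group_add \<Rightarrow> 'v" +
  fixes V :: "'v set" and \<phi> :: "'v \<Rightarrow> 'v"
  assumes fdV: "fdsub scale V" and lin: "linear_betw scale scale V V \<phi>"
    and bij: "bij_betw \<phi> V V"
begin

lemma subV: "subspace V" using fdV by (rule fdsub_subspace)

lemma zero_mem [simp]: "0 \<in> V" using subV by (rule subspace_0)

lemma phi_zero [simp]: "\<phi> 0 = 0" using linear_betw_zero[OF lin] by simp

lemma phi_mem: "x \<in> V \<Longrightarrow> \<phi> x \<in> V" using linear_betw_mem[OF lin] .

lemma phi_inj: "x \<in> V \<Longrightarrow> y \<in> V \<Longrightarrow> \<phi> x = \<phi> y \<Longrightarrow> x = y"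
  using bij by (auto simp: bij_betw_def dest: inj_onD)

lemma phi_pow_mem: "x \<in> V \<Longrightarrow> (\<phi> ^^ k) x \<in> V"
  by (induction k) (auto intro: phi_mem)

text \<open>Horner evaluation of \<open>p\<close> at \<open>\<phi>\<close>, applied to
  \<open>v\<close>: the module structure of \<open>V\<close> over \<open>F[X]\<close>. Linearity of
  \<open>\<phi>\<close> holds on \<open>V\<close> only, hence the membership conditions in the rules
  below.\<close>

definition act :: "'f poly \<Rightarrow> 'v \<Rightarrow> 'v" where
  "act p v = fold_coeffs (\<lambda>a y. scale a v + \<phi> y) p 0"

lemma act_0 [simp]: "act 0 v = 0"
  by (simp add: act_def)

lemma act_pCons [simp]: "act (pCons a p) v = scale a v + \<phi> (act p v)"
  by (cases "p = 0 \<and> a = 0") (auto simp: act_def)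

lemma act_mem: "v \<in> V \<Longrightarrow> act p v \<in> V"
  by (induction p) (auto intro!: subspace_add[OF subV] subspace_scale[OF subV] phi_mem)

lemma act_add: "v \<in> V \<Longrightarrow> act (p + q) v = act p v + act q v"
  by (induction p q rule: poly_induct2)
    (simp_all add: linear_betw_add[OF lin] act_mem scale_left_distrib algebra_simps)

lemma act_smult: "v \<in> V \<Longrightarrow> act (smult c p) v = scale c (act p v)"
  by (induction p)
    (simp_all add: linear_betw_scale[OF lin] act_mem scale_right_distrib)

lemma act_mult: "v \<in> V \<Longrightarrow> act (p * q) v = act p (act q v)"
  by (induction p) (simp_all add: act_add act_smult)

lemma act_one [simp]: "act 1 v = v"
  by (simp add: one_pCons)

lemma act_minus: "v \<in> V \<Longrightarrow> act (- p) v = - act p v"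
  using act_smult[of v "- 1" p] by simp

lemma act_diff: "v \<in> V \<Longrightarrow> act (p - q) v = act p v - act q v"
  using act_add[of v p "- q"] by (simp add: act_minus)

lemma act_sum: "v \<in> V \<Longrightarrow> act (sum f A) v = (\<Sum>i\<in>A. act (f i) v)"
  by (induction A rule: infinite_finite_induct) (simp_all add: act_add)

lemma act_monom: "v \<in> V \<Longrightarrow> act (monom c k) v = scale c ((\<phi> ^^ k) v)"
  by (induction k) (simp_all add: monom_0 monom_Suc linear_betw_scale[OF lin] phi_pow_mem)

lemma linear_act: "linear_betw scale scale V V (act p)"
proof (rule linear_betwI)
  show "act p (x + y) = act p x + act p y" if "x \<in> V" "y \<in> V" for x y
    using that by (induction p) (simp_all add: linear_betw_add[OF lin] act_mem scale_right_distrib algebra_simps)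
  show "act p (scale c x) = scale c (act p x)" if "x \<in> V" for c x
    using that by (induction p)
      (simp_all add: linear_betw_scale[OF lin] act_mem scale_right_distrib mult.commute)
qed (rule act_mem)

lemma act_zero [simp]: "act p 0 = 0"
  using linear_betw_zero[OF linear_act] by simp

lemma act_commute: "v \<in> V \<Longrightarrow> act p (act q v) = act q (act p v)"
  by (simp flip: act_mult add: mult.commute)

end

section \<open>Indecomposable modules: endomorphisms and cyclic summands\<close>

locale indec_module = aut_module +
  assumes nonzero: "V \<noteq> {0}"
    and indec: "\<And>A B. subspace A \<Longrightarrow> subspace B \<Longrightarrow> A \<subseteq> V \<Longrightarrow> B \<subseteq> V \<Longrightarrow> \<phi> ` A \<subseteq> A \<Longrightarrow> \<phi> ` B \<subseteq> B \<Longrightarrow>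
      A \<inter> B = {0} \<Longrightarrow> (\<And>x. x \<in> V \<Longrightarrow> \<exists>a\<in>A. \<exists>b\<in>B. x = a + b) \<Longrightarrow> A = {0} \<or> B = {0}"
begin

text \<open>For large \<open>k\<close> the space \<open>V\<close> is the direct sum of the kernel
  and the image of \<open>P ^^ k\<close>, both invariant under \<open>\<phi>\<close>. The kernel is
  nonzero because \<open>P\<close> is not injective, so the image vanishes.\<close>

lemma fitting:
  assumes P: "linear_betw scale scale V V P" and comm: "\<And>x. x \<in> V \<Longrightarrow> P (\<phi> x) = \<phi> (P x)"
    and ni: "\<not> inj_on P V"
  obtains k where "\<And>x. x \<in> V \<Longrightarrow> (P ^^ k) x = 0"
proof -
  have Pmem: "x \<in> V \<Longrightarrow> (P ^^ k) x \<in> V" for x k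
    by (induction k) (auto intro: linear_betw_mem[OF P])
  have lk: "linear_betw scale scale V V (P ^^ k)" for k
  proof (induction k)
    case (Suc k)
    from linear_betw_comp[OF Suc P] show ?case by (simp add: comp_def)
  qed (auto simp: linear_betw_def)
  have ck: "x \<in> V \<Longrightarrow> (P ^^ k) (\<phi> x) = \<phi> ((P ^^ k) x)" for x k
    by (induction k) (auto simp: comm Pmem)
  define K where "K k = {x\<in>V. (P ^^ k) x = 0}" for k
  define I where "I k = (P ^^ k) ` V" for k
  have sK: "subspace (K k)" for k
    unfolding K_def by (rule subspace_kernel_betw[OF lk subV vector_space_axioms])
  have sI: "subspace (I k)" for k
    unfolding I_def by (rule subspace_image_betw[OF lk subV vector_space_axioms])
  have P0: "P 0 = 0" using linear_betw_zero[OF P] by simp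
  obtain j where j: "K (Suc j) = K j"
    by (rule increasing_stable[where U = K, OF fdV sK]) (auto simp: K_def P0)
  obtain i where i: "I (Suc i) = I i"
  proof (rule decreasing_stable[where U = I, OF fdV sI])
    show "I (Suc k) \<subseteq> I k" for k
      unfolding I_def using linear_betw_mem[OF P] by (auto simp: funpow_swap1)
  qed (auto simp: I_def)
  have Kst: "K (j + d) = K j" for d
  proof (induction d)
    case (Suc d)
    have "x \<in> K (j + d)" if "x \<in> K (j + Suc d)" for x
    proof -
      have "(P ^^ Suc j) ((P ^^ d) x) = (P ^^ (j + Suc d)) x"
        by (simp only: funpow_add[THEN fun_cong, unfolded comp_apply, symmetric] add_Suc_shift)
      then have "(P ^^ d) x \<in> K (Suc j)" "x \<in> V" using that Pmem by (simp_all add: K_def)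
      then have "(P ^^ d) x \<in> K j" using j by simp
      then show ?thesis using \<open>x \<in> V\<close> by (simp add: K_def funpow_add)
    qed
    moreover have "K (j + d) \<subseteq> K (j + Suc d)" by (auto simp: K_def P0)
    ultimately show ?case using Suc by auto
  qed simp
  have ISuc: "I (Suc k) = P ` I k" for k by (auto simp: I_def)
  have Ist: "I (i + d) = I i" for d
  proof (induction d)
    case (Suc d) then show ?case using i ISuc[of "i + d"] ISuc[of i] by simp
  qed simp
  \<comment> \<open>Past both stabilisation indices, so that \<open>P ^^ k\<close> and
    \<open>P ^^ (k + k)\<close> have the same kernel and the same image.\<close>
  define k where "k = i + j"
  have K2: "K (k + k) = K k" using Kst[of "i + (i + j)"] Kst[of i] by (simp add: k_def ac_simps)
  have I2: "I (k + k) = I k" using Ist[of "j + (i + j)"] Ist[of j] by (simp add: k_def ac_simps)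
  have int: "K k \<inter> I k = {0}"
  proof -
    have "x = 0" if x: "x \<in> K k" "x \<in> I k" for x
    proof -
      from x obtain y where y: "y \<in> V" "x = (P ^^ k) y" by (auto simp: I_def)
      then have "y \<in> K (k + k)" using x by (simp add: K_def funpow_add)
      then have "y \<in> K k" using K2 by simp
      then show ?thesis using y by (simp add: K_def)
    qed
    then show ?thesis using subspace_0[OF sK] subspace_0[OF sI] by auto
  qed
  have sum: "\<exists>a\<in>K k. \<exists>b\<in>I k. x = a + b" if x: "x \<in> V" for x
  proof -
    have "(P ^^ k) x \<in> I (k + k)" using x I2 by (auto simp: I_def)
    then obtain y where y: "y \<in> V" "(P ^^ k) x = (P ^^ k) ((P ^^ k) y)"
      by (auto simp: I_def funpow_add)
    then have "x - (P ^^ k) y \<in> K k"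
      using x Pmem subspace_diff[OF subV] linear_betw_diff[OF lk subV x Pmem[OF y(1)], of k]
      by (simp add: K_def)
    then show ?thesis using y(1)
      by (intro bexI[of _ "x - (P ^^ k) y"] bexI[of _ "(P ^^ k) y"]) (auto simp: I_def)
  qed
  have "K k = {0} \<or> I k = {0}"
  proof (rule indec[OF sK sI _ _ _ _ int sum])
    show "\<phi> ` K k \<subseteq> K k" by (auto simp: K_def phi_mem ck)
    show "\<phi> ` I k \<subseteq> I k" by (auto simp: I_def phi_mem simp flip: ck)
  qed (auto simp: K_def I_def Pmem)
  moreover have "K k \<noteq> {0}"
  proof
    assume "K k = {0}"
    then have "K 1 = {0}"
    proof -
      have "K 1 \<subseteq> K (j + 1)" by (induction j) (auto simp: K_def P0)
      also have "\<dots> = K k" using Kst[of 1] Kst[of i] by (simp add: k_def ac_simps)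
      finally show ?thesis using \<open>K k = {0}\<close> subspace_0[OF sK[of 1]] by auto
    qed
    then have "inj_on P V"
      by (intro linear_betw_inj_onI[OF P subV]) (auto simp: K_def)
    with ni show False by simp
  qed
  ultimately have "I k = {0}" by simp
  then show thesis using that[of k] by (auto simp: I_def)
qed

text \<open>Two non-injective endomorphisms cannot have an injective sum. If \<open>T\<close> is the
  sum of \<open>P c\<close> and \<open>S\<close>, then \<open>N\<close>, which is \<open>P c\<close>
  followed by the inverse of \<open>T\<close>, is nilpotent by \<open>fitting\<close>, yet it fixes
  every vector in the kernel of \<open>S\<close>. In other words, the endomorphism ring is
  local.\<close>

lemma local_endomorphisms:
  assumes fin: "finite C"
    and P: "\<And>c. c \<in> C \<Longrightarrow> linear_betw scale scale V V (P c)"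
    and comm: "\<And>c x. c \<in> C \<Longrightarrow> x \<in> V \<Longrightarrow> P c (\<phi> x) = \<phi> (P c x)"
    and inj: "inj_on (\<lambda>x. \<Sum>c\<in>C. P c x) V"
  shows "\<exists>c\<in>C. inj_on (P c) V"
  using assms
proof (induction C rule: finite_induct)
  case empty
  then have "x = 0" if "x \<in> V" for x
    using inj_onD[of "\<lambda>x. \<Sum>c\<in>{}. P c x" V x 0] that by simp
  then have "V = {0}" using zero_mem by blast
  with nonzero show ?case by simp
next
  case (insert c C)
  define S where "S x = (\<Sum>c\<in>C. P c x)" for x
  have Pd: "linear_betw scale scale V V (P d)" if "d \<in> C" for d
    using insert.prems(1) that by simp
  have Cd: "P d (\<phi> x) = \<phi> (P d x)" if "d \<in> C" "x \<in> V" for d x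
    using insert.prems(2) that by simp
  have Pc: "linear_betw scale scale V V (P c)" using insert.prems(1) by simp
  have Cc: "P c (\<phi> x) = \<phi> (P c x)" if "x \<in> V" for x
    using insert.prems(2) that by simp
  have S: "linear_betw scale scale V V S"
  proof (rule linear_betwI)
    fix x assume x: "x \<in> V"
    show "S x \<in> V" unfolding S_def
      by (rule subspace_sum[OF subV]) (rule linear_betw_mem[OF Pd x])
    show "S (scale r x) = scale r (S x)" for r
      unfolding S_def scale_sum_right by (rule sum.cong[OF refl]) (rule linear_betw_scale[OF Pd x])
    show "S (x + y) = S x + S y" if "y \<in> V" for y
      unfolding S_def sum.distrib[symmetric]
      by (rule sum.cong[OF refl]) (rule linear_betw_add[OF Pd x that])
  qed
  have Sc: "S (\<phi> x) = \<phi> (S x)" if x: "x \<in> V" for x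
  proof -
    have "\<phi> (S x) = (\<Sum>d\<in>C. \<phi> (P d x))"
      unfolding S_def by (rule linear_betw_sum[OF lin subV]) (rule linear_betw_mem[OF Pd x])
    also have "\<dots> = S (\<phi> x)"
      unfolding S_def by (rule sum.cong[OF refl]) (simp add: Cd x)
    finally show ?thesis by simp
  qed
  have T: "inj_on (\<lambda>x. P c x + S x) V"
    using insert.prems(3) insert.hyps by (simp add: S_def)
  show ?case
  proof (rule ccontr)
    assume "\<not> ?case"
    then have nPc: "\<not> inj_on (P c) V" and nC: "\<not> (\<exists>d\<in>C. inj_on (P d) V)" by simp_all
    have nS: "\<not> inj_on S V"
    proof
      assume "inj_on S V"
      moreover have "S = (\<lambda>x. \<Sum>c\<in>C. P c x)" by (rule ext) (rule S_def)
      ultimately have "inj_on (\<lambda>x. \<Sum>c\<in>C. P c x) V" by simp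
      from insert.IH[OF Pd Cd this] nC show False by blast
    qed
    define T where "T x = P c x + S x" for x
    have Tl: "linear_betw scale scale V V T"
      using linear_betw_mem[OF Pc] linear_betw_mem[OF S]
      by (intro linear_betwI) (auto simp: T_def linear_betw_add[OF Pc] linear_betw_add[OF S]
          linear_betw_scale[OF Pc] linear_betw_scale[OF S] subspace_add[OF subV] scale_right_distrib)
    have "T = (\<lambda>x. P c x + S x)" by (rule ext) (rule T_def)
    with T have Ti: "inj_on T V" by simp
    have Tb: "bij_betw T V V" using inj_endo_surj[OF fdV Tl Ti] Ti by (simp add: bij_betw_def)
    have Tc: "T (\<phi> x) = \<phi> (T x)" if "x \<in> V" for x
      using that Cc Sc linear_betw_add[OF lin] linear_betw_mem[OF Pc] linear_betw_mem[OF S]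
      by (simp add: T_def)
    define N where "N x = inv_into V T (P c x)" for x
    have N: "N x \<in> V" "T (N x) = P c x" if "x \<in> V" for x
    proof -
      have "P c x \<in> T ` V" using Tb linear_betw_mem[OF Pc that] by (simp add: bij_betw_def)
      then show "N x \<in> V" "T (N x) = P c x"
        unfolding N_def by (rule inv_into_into, rule f_inv_into_f)
    qed
    have Nl: "linear_betw scale scale V V N"
      unfolding N_def using linear_betw_comp[OF Pc linear_betw_inv[OF Tl subV Tb]] .
    have Nc: "N (\<phi> x) = \<phi> (N x)" if "x \<in> V" for x
      by (rule inj_onD[OF Ti]) (use that N phi_mem Tc Cc in auto)
    have "\<not> inj_on N V"
    proof
      assume "inj_on N V"
      then have "inj_on (T \<circ> N) V" using N(1) Ti by (auto simp: inj_on_def)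
      moreover have "inj_on (T \<circ> N) V \<longleftrightarrow> inj_on (P c) V"
        by (rule inj_on_cong) (simp add: N)
      ultimately have "inj_on (P c) V" by simp
      with nPc show False by simp
    qed
    then obtain k where k: "\<And>x. x \<in> V \<Longrightarrow> (N ^^ k) x = 0"
      using fitting[OF Nl Nc] by metis
    have "\<exists>x\<in>V. x \<noteq> 0 \<and> S x = 0"
      using nS linear_betw_inj_onI[OF S subV] by metis
    then obtain x where x: "x \<in> V" "x \<noteq> 0" "S x = 0" by blast
    have "N x = x"
      by (rule inj_onD[OF Ti]) (use N[OF x(1)] x in \<open>simp_all add: T_def\<close>)
    then have "(N ^^ k) x = x" by (induction k) auto
    with k[OF x(1)] x(2) show False by simp
  qed
qed

end

text \<open>The annihilator of \<open>v0\<close> is a nonzero ideal, as it contains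
  \<open>cyclo g\<close>; \<open>h\<close> is its monic generator.\<close>

lemma (in aut_module) cyclic_generator:
  assumes v0: "v0 \<in> V" "v0 \<noteq> 0" and g: "0 < g" "(\<phi> ^^ g) v0 = v0"
  obtains h where "lead_coeff h = 1" "h dvd cyclo g" "\<And>q. act q v0 = 0 \<longleftrightarrow> h dvd q"
proof -
  let ?I = "{q. act q v0 = 0}"
  have "act (cyclo g) v0 = 0"
    using v0(1) g by (simp add: cyclo_def act_diff act_monom)
  then have cI: "cyclo g \<in> ?I" by simp
  obtain h where h: "h \<in> ?I" "lead_coeff h = 1" "\<And>q. q \<in> ?I \<Longrightarrow> h dvd q"
    by (rule poly_ideal_principal[OF cI cyclo_nonzero[OF g(1)]])
      (use v0(1) in \<open>simp_all add: act_add act_mult\<close>)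
  have "act q v0 = 0 \<longleftrightarrow> h dvd q" for q
  proof
    assume "h dvd q"
    then obtain r where "q = h * r" ..
    then have "q = r * h" by (simp add: mult.commute)
    then show "act q v0 = 0" using h(1) v0(1) by (simp add: act_mult)
  qed (use h(3) in simp)
  then show thesis using that[of h] h(2) h(3)[OF cI] by blast
qed

text \<open>A cyclic module that is a direct summand, via \<open>K\<close>, of $F[X]/(X^g - 1)$, the latter in
  coordinates with respect to the powers of \<open>X\<close>.\<close>

context indec_module
begin

lemma cyclic_summand:
  assumes v0: "v0 \<in> V" and g: "0 < g" "(\<phi> ^^ g) v0 = v0"
    and K_add: "\<And>x y j. x \<in> V \<Longrightarrow> y \<in> V \<Longrightarrow> K (x + y) j = K x j + K y j"
    and K_scale: "\<And>c x j. x \<in> V \<Longrightarrow> K (scale c x) j = c * K x j"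
    and K_Suc: "\<And>x j. x \<in> V \<Longrightarrow> Suc j < g \<Longrightarrow> K (\<phi> x) (Suc j) = K x j"
    and K_0: "\<And>x. x \<in> V \<Longrightarrow> K (\<phi> x) 0 = K x (g - 1)"
    and inj: "inj_on (\<lambda>x. \<Sum>j<g. scale (K x j) ((\<phi> ^^ j) v0)) V"
  obtains f m \<epsilon> where "\<exists>z :: 'a alg_closure. root_of_unity z \<and> is_min_poly f z"
    "if CHAR('a) = 0 then m = 1 else \<exists>k. m = CHAR('a) ^ k"
    "linear_betw smult scale (poly_quot (f ^ m)) V \<epsilon>" "bij_betw \<epsilon> (poly_quot (f ^ m)) V"
    "\<And>q. q \<in> poly_quot (f ^ m) \<Longrightarrow> \<epsilon> (mult_X (f ^ m) q) = \<phi> (\<epsilon> q)"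
proof -
  define P where "P x = (\<Sum>j<g. scale (K x j) ((\<phi> ^^ j) v0))" for x
  \<comment> \<open>\<open>P\<close> is \<open>T\<close> followed by evaluation at
    \<open>v0\<close>, where \<open>T x\<close> represents a class modulo
    \<open>cyclo g\<close>.\<close>
  define T where "T x = (\<Sum>j<g. monom (K x j) j)" for x
  have PT: "act (T x) v0 = P x" for x
    using v0 by (simp add: T_def P_def act_sum act_monom)
  have T_add: "T (x + y) = T x + T y" if "x \<in> V" "y \<in> V" for x y
    using that by (simp add: T_def K_add sum.distrib flip: add_monom)
  have T_scale: "T (scale c x) = smult c (T x)" if "x \<in> V" for c x
    using that by (auto simp: T_def K_scale coeff_sum sum_distrib_left intro!: poly_eqI sum.cong)
  have "P 0 = 0" using K_scale[of 0 0] by (simp add: P_def)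
  have PV: "P x \<in> V" for x using act_mem[OF v0] PT by metis
  have P_lin: "linear_betw scale scale V V P"
    using PV by (intro linear_betwI)
      (simp_all add: T_add T_scale act_add act_smult v0 flip: PT)
  have injP: "inj_on P V" using inj by (simp only: P_def[abs_def])
  have surjP: "P ` V = V" by (rule inj_endo_surj[OF fdV P_lin injP])
  have span: "\<exists>q. x = act q v0" if "x \<in> V" for x
    using that surjP PT by (metis imageE)
  have v0n: "v0 \<noteq> 0"
  proof
    assume "v0 = 0"
    then have "V \<subseteq> {0}" using span by auto
    then show False using nonzero zero_mem by blast
  qed
  obtain h where h: "lead_coeff h = 1" "h dvd cyclo g" "\<And>q. act q v0 = 0 \<longleftrightarrow> h dvd q"
    using cyclic_generator[OF v0 v0n g] by blast
  have h0: "h \<noteq> 0" using h(1) by auto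
  from h(2) obtain h' where h': "cyclo g = h * h'" by (auto elim: dvdE)
  \<comment> \<open>The cyclic shift of coordinates agrees with multiplication by \<open>X\<close>
    up to a multiple of \<open>cyclo g\<close>, so \<open>T\<close> is linear over
    \<open>F[X]\<close> only modulo \<open>cyclo g\<close>.\<close>
  have T_phi: "T (\<phi> x) = [:0, 1:] * T x - [:K x (g - 1):] * cyclo g" if x: "x \<in> V" for x
  proof -
    obtain i where i: "g = Suc i" using g(1) by (cases g) auto
    have "T (\<phi> x) = monom (K x i) 0 + (\<Sum>j<i. monom (K x j) (Suc j))"
      unfolding T_def i sum.lessThan_Suc_shift using K_0[OF x] K_Suc[OF x] i by simp
    moreover have "[:0, 1:] * T x = (\<Sum>j<i. monom (K x j) (Suc j)) + monom (K x i) (Suc i)"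
      unfolding T_def i sum.lessThan_Suc distrib_left sum_distrib_left by (simp add: monom_Suc)
    moreover have "[:K x i:] * cyclo (Suc i) = monom (K x i) (Suc i) - monom (K x i) 0"
      by (simp add: cyclo_def smult_diff_right smult_monom monom_0)
    ultimately show ?thesis using i by simp
  qed
  have T_act: "cyclo g dvd T (act q x) - q * T x" if x: "x \<in> V" for q x
  proof (induction q)
    case 0
    have "T 0 = 0" using T_scale[of 0 0] by simp
    then show ?case by simp
  next
    case (pCons a q)
    have "T (act (pCons a q) x) - pCons a q * T x =
      [:0, 1:] * (T (act q x) - q * T x) - [:K (act q x) (g - 1):] * cyclo g"
      using x by (simp add: T_add T_scale T_phi act_mem phi_mem subspace_scale[OF subV] algebra_simps)
    also have "cyclo g dvd \<dots>" by (rule dvd_diff[OF dvd_mult[OF pCons.IH] dvd_triv_right])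
    finally show ?case .
  qed
  \<comment> \<open>The class of \<open>u = T w\<close> acts as an idempotent cutting out
    \<open>V\<close>: \<open>u\<close> is 1 modulo \<open>h\<close> since \<open>P w = v0\<close>,
    and \<open>h * u\<close> is 0 modulo \<open>cyclo g\<close> since \<open>h\<close> kills
    \<open>w\<close>. Then \<open>h'\<close> divides \<open>u\<close>, so \<open>h\<close> and
    \<open>h'\<close> are comaximal.\<close>
  obtain w where w: "w \<in> V" "P w = v0" using surjP v0 by (metis imageE)
  define u where "u = T w"
  have "act (u - 1) v0 = 0" using PT[of w] w v0 by (simp add: u_def act_diff)
  then have u1: "h dvd u - 1" using h(3) by blast
  have Pact: "P (act q x) = act q (P x)" if x: "x \<in> V" for q x
  proof -
    obtain r where "T (act q x) - q * T x = h * r"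
      using T_act[OF x, of q] h(2) by (meson dvdE dvd_trans)
    then have "h dvd T (act q x) - q * T x" by simp
    then have "act (T (act q x) - q * T x) v0 = 0" using h(3) by blast
    then show ?thesis using v0 by (simp add: act_diff act_mult PT)
  qed
  have "act h w = 0"
  proof (rule inj_onD[OF injP])
    have "act h v0 = 0" using h(3) by simp
    then show "P (act h w) = P 0" using Pact[OF w(1)] w(2) \<open>P 0 = 0\<close> by simp
  qed (use w act_mem in auto)
  then have "cyclo g dvd - (h * u)" using T_act[OF w(1), of h] T_scale[of 0 0] by (simp add: u_def)
  then have "h * h' dvd h * u" using h' by simp
  then have "h' dvd u" using h0 by simp
  have co: "comaximal h h'"
  proof -
    obtain a b where "u = h' * a" "u - 1 = h * b" using \<open>h' dvd u\<close> u1 by (auto elim!: dvdE)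
    then have "(- b) * h + a * h' = 1" by (simp add: algebra_simps)
    then show ?thesis unfolding comaximal_def by blast
  qed
  have deg: "0 < degree h"
  proof (rule ccontr)
    assume "\<not> 0 < degree h"
    then obtain c where "h = [:c:]" using degree_eq_zeroE[of h] by auto
    then have "h = 1" using h(1) by (simp add: one_pCons)
    then have "act 1 v0 = 0" using h(3)[of 1] by simp
    then show False using v0n by simp
  qed
  obtain f where f: "irreducible f" "lead_coeff f = 1" "f dvd h" "0 < degree f"
    by (rule irreducible_monic_factor[OF deg])
  obtain m e where me: "h = f ^ m * e" "1 \<le> m" "\<not> f dvd e"
    by (rule irreducible_power_factor[OF f(1,4,3) h0])
  have coe: "comaximal (f ^ m) e" by (rule comaximal_power[OF irreducible_comaximal[OF f(1) me(3)]])
  \<comment> \<open>Only the kernels of \<open>f ^ m\<close> and of \<open>e\<close> matter. Their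
    product \<open>h\<close> kills \<open>V\<close>, so the Bezout identity splits \<open>V\<close>
    into these kernels, and indecomposability leaves one.\<close>
  define A where "A p = {x\<in>V. act p x = 0}" for p
  have sA: "subspace (A p)" for p
    unfolding A_def by (rule subspace_kernel_betw[OF linear_act subV vector_space_axioms])
  have phiA: "\<phi> ` A p \<subseteq> A p" for p
  proof -
    have "act p (\<phi> x) = \<phi> (act p x)" if "x \<in> V" for x
      using act_commute[OF that, of p "[:0, 1:]"] by simp
    then show ?thesis by (auto simp: A_def phi_mem)
  qed
  obtain a b where ab: "a * f ^ m + b * e = 1" using coe by (auto simp: comaximal_def)
  have split: "x = act (b * e) x + act (a * f ^ m) x" if "x \<in> V" for x
    using act_add[OF that, of "a * f ^ m" "b * e"] ab by (simp add: add.commute)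
  have hz: "act h x = 0" if x: "x \<in> V" for x
  proof -
    obtain q where "x = act q v0" using span[OF x] by blast
    then have "act h x = act q (act h v0)" using act_commute[OF v0] by simp
    also have "act h v0 = 0" using h(3) by simp
    finally show ?thesis by simp
  qed
  have "A (f ^ m) = {0} \<or> A e = {0}"
  proof (rule indec[OF sA sA _ _ phiA phiA])
    have "x = 0" if "x \<in> A (f ^ m)" "x \<in> A e" for x
      using split[of x] that by (simp add: A_def act_mult)
    then show "A (f ^ m) \<inter> A e = {0}" using subspace_0[OF sA] by auto
    fix x assume x: "x \<in> V"
    have "act (f ^ m) (act (b * e) x) = act b (act h x)" "act e (act (a * f ^ m) x) = act a (act h x)"
      using x by (simp_all add: me(1) mult.assoc mult.left_commute mult.commute flip: act_mult)
    then have "act (b * e) x \<in> A (f ^ m)" "act (a * f ^ m) x \<in> A e"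
      using x hz act_mem by (simp_all add: A_def)
    then show "\<exists>y\<in>A (f ^ m). \<exists>z\<in>A e. x = y + z" using split[OF x] by blast
  qed (auto simp: A_def)
  \<comment> \<open>\<open>act e v0\<close> lies in this kernel and is nonzero, because
    \<open>h\<close>, being divisible by \<open>f\<close>, does not divide \<open>e\<close>.\<close>
  moreover have "A (f ^ m) \<noteq> {0}"
  proof
    assume "A (f ^ m) = {0}"
    moreover have "act (f ^ m) (act e v0) = 0" using h(3)[of h] v0 by (simp add: me(1) act_mult)
    then have "act e v0 \<in> A (f ^ m)" using v0 act_mem by (simp add: A_def)
    ultimately have "h dvd e" using h(3) by auto
    then have "f dvd e" using f(3) by (rule dvd_trans[rotated])
    then show False using me(3) by simp
  qed
  ultimately have "A e = {0}" by simp
  moreover have "act e (act (f ^ m) v0) = 0"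
    using h(3)[of h] v0 by (simp add: me(1) mult.commute flip: act_mult)
  then have "act (f ^ m) v0 \<in> A e" using v0 act_mem by (simp add: A_def)
  ultimately have "h dvd f ^ m" using h(3) by auto
  have fm: "f ^ m \<noteq> 0" "lead_coeff (f ^ m) = 1"
    using f(1,2) by (auto simp: lead_coeff_power)
  have "f ^ m * e dvd f ^ m * 1" using \<open>h dvd f ^ m\<close> me(1) by simp
  then have "e dvd 1" using fm(1) dvd_mult_cancel_left by blast
  then obtain c where c: "e = [:c:]" using is_unit_polyE by blast
  have "c = 1" using h(1) fm(2) unfolding me(1) lead_coeff_mult c by simp
  then have "h = f ^ m" using me(1) c by (simp add: one_pCons)
  \<comment> \<open>As \<open>h = f ^ m\<close> generates the annihilator of the generator
    \<open>v0\<close>, evaluation at \<open>v0\<close> identifies \<open>F[X]/(f ^ m)\<close> with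
    \<open>V\<close>.\<close>
  define \<epsilon> where "\<epsilon> q = act q v0" for q
  have q_mod: "act (q mod h) v0 = act q v0" for q
  proof -
    have "act (q - q mod h) v0 = 0" using h(3) by (simp add: dvd_minus_mod)
    then show ?thesis using v0 by (simp add: act_diff)
  qed
  show thesis
  proof (rule that[of f m \<epsilon>])
    show "\<exists>z :: 'a alg_closure. root_of_unity z \<and> is_min_poly f z"
      "if CHAR('a) = 0 then m = 1 else \<exists>k. m = CHAR('a) ^ k"
      using cyclo_primary_factor[OF g(1) f(1,2,4) me(2), of h'] h' co \<open>h = f ^ m\<close> by simp_all
    show "linear_betw smult scale (poly_quot (f ^ m)) V \<epsilon>"
      using v0 by (intro linear_betwI) (simp_all add: \<epsilon>_def act_mem act_add act_smult)
    show "bij_betw \<epsilon> (poly_quot (f ^ m)) V"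
      unfolding \<open>h = f ^ m\<close>[symmetric] bij_betw_def
    proof
      show "inj_on \<epsilon> (poly_quot h)"
      proof (rule inj_onI)
        fix p q assume "p \<in> poly_quot h" "q \<in> poly_quot h" "\<epsilon> p = \<epsilon> q"
        then have "h dvd p - q" using v0 h(3)[of "p - q"] by (simp add: \<epsilon>_def act_diff)
        then have "p mod h = q mod h" by (simp add: mod_eq_dvd_iff)
        moreover have "p mod h = p" "q mod h = q"
          using \<open>p \<in> poly_quot h\<close> \<open>q \<in> poly_quot h\<close> by (auto simp: poly_quot_def)
        ultimately show "p = q" by simp
      qed
      have "x \<in> \<epsilon> ` poly_quot h" if x: "x \<in> V" for x
      proof -
        obtain q where "x = act q v0" using span[OF x] by blast
        then have "x = \<epsilon> (q mod h)" by (simp add: \<epsilon>_def q_mod)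
        then show ?thesis by (auto simp: poly_quot_def)
      qed
      then show "\<epsilon> ` poly_quot h = V" using v0 act_mem by (auto simp: \<epsilon>_def)
    qed
    show "\<epsilon> (mult_X (f ^ m) q) = \<phi> (\<epsilon> q)" for q
      unfolding \<open>h = f ^ m\<close>[symmetric] mult_X_def \<epsilon>_def q_mod by simp
  qed
qed

end

section \<open>Summands of free representations\<close>

text \<open>Coefficients are pushed forward by summing over fibres, and \<open>F\<close>, additive
  in the coefficient, splits these sums.\<close>

lemma free_map_sum:
  fixes F :: "'t \<Rightarrow> 'f::field \<Rightarrow> 'z::comm_monoid_add"
  assumes "finite A" "finite B" "g ` A \<subseteq> B"
    and F: "\<And>b. F b 0 = 0" "\<And>b x y. F b (x + y) = F b x + F b y"
  shows "(\<Sum>b\<in>B. F b (free_map A g c b)) = (\<Sum>a\<in>A. F (g a) (c a))"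
proof -
  have F_sum: "F b (sum f Y) = (\<Sum>x\<in>Y. F b (f x))" if "finite Y" for b Y and f :: "_ \<Rightarrow> 'f"
    using that by (induction Y rule: finite_induct) (simp_all add: F)
  have "(\<Sum>b\<in>B. F b (free_map A g c b)) = (\<Sum>b\<in>B. \<Sum>a\<in>{a\<in>A. g a = b}. F (g a) (c a))"
    unfolding free_map_def by (intro sum.cong refl) (simp add: F_sum assms(1))
  also have "\<dots> = (\<Sum>a\<in>A. F (g a) (c a))"
    by (rule sum.group[OF assms(1-3)])
  finally show ?thesis .
qed

text \<open>The universal cover of the category of elements of \<open>S\<close>: a vertex \<open>(q, a, w)\<close> is an
  element \<open>a\<close> over \<open>q\<close> together with a winding number.\<close>

definition cover_edges :: "nat \<Rightarrow> (nat \<Rightarrow> bool) \<Rightarrow> (nat, nat, 's) srep \<Rightarrow>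
    ((nat \<times> 's \<times> int) \<times> (nat \<times> 's \<times> int)) set" where
  "cover_edges n fwd S = {((tail (cyc_quiver n fwd) j, a, w),
      (head (cyc_quiver n fwd) j, smap S j a, if j = n then w + 1 else w)) |j a w.
      j \<le> n \<and> a \<in> sobj S (tail (cyc_quiver n fwd) j)}"

definition conn :: "nat \<Rightarrow> (nat \<Rightarrow> bool) \<Rightarrow> (nat, nat, 's) srep \<Rightarrow>
    ((nat \<times> 's \<times> int) \<times> (nat \<times> 's \<times> int)) set" where
  "conn n fwd S = (cover_edges n fwd S \<union> (cover_edges n fwd S)\<inverse>)\<^sup>*"

lemma conn_sym: "(x, y) \<in> conn n fwd S \<Longrightarrow> (y, x) \<in> conn n fwd S"
proof -
  have "sym (conn n fwd S)" unfolding conn_def by (rule sym_rtrancl) (rule sym_Un_converse)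
  then show "(x, y) \<in> conn n fwd S \<Longrightarrow> (y, x) \<in> conn n fwd S" by (rule symD)
qed

lemma conn_trans: "(x, y) \<in> conn n fwd S \<Longrightarrow> (y, z) \<in> conn n fwd S \<Longrightarrow> (x, z) \<in> conn n fwd S"
  unfolding conn_def by (rule rtrancl_trans)

lemma conn_refl: "(x, x) \<in> conn n fwd S"
  unfolding conn_def by simp

lemma cover_edges_shift:
  "((q, a, w), (q', a', w')) \<in> cover_edges n fwd S \<Longrightarrow>
   ((q, a, w + k), (q', a', w' + k)) \<in> cover_edges n fwd S"
proof -
  assume "((q, a, w), (q', a', w')) \<in> cover_edges n fwd S"
  then obtain j where "j \<le> n" "a \<in> sobj S (tail (cyc_quiver n fwd) j)" "q = tail (cyc_quiver n fwd) j"
    "q' = head (cyc_quiver n fwd) j" "a' = smap S j a" "w' = (if j = n then w + 1 else w)"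
    unfolding cover_edges_def by blast
  moreover from this have "w' + k = (if j = n then (w + k) + 1 else w + k)" by simp
  ultimately show "((q, a, w + k), (q', a', w' + k)) \<in> cover_edges n fwd S"
    unfolding cover_edges_def by blast
qed

text \<open>Invariance under the deck translations of the cover. It makes the winding numbers of
  closed walks a group.\<close>

lemma conn_shift:
  assumes "((q, a, w), (q', a', w')) \<in> conn n fwd S"
  shows "((q, a, w + k), (q', a', w' + k)) \<in> conn n fwd S"
proof -
  have "(u, v) \<in> (cover_edges n fwd S \<union> (cover_edges n fwd S)\<inverse>)\<^sup>* \<Longrightarrow>
    ((fst u, fst (snd u), snd (snd u) + k), (fst v, fst (snd v), snd (snd v) + k)) \<in> conn n fwd S" for u v
  proof (induction rule: rtrancl_induct)
    case base then show ?case by (rule conn_refl)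
  next
    case (step y z)
    obtain q a w where y: "y = (q, a, w)" by (cases y)
    obtain q' a' w' where z: "z = (q', a', w')" by (cases z)
    have "((q, a, w + k), (q', a', w' + k)) \<in> cover_edges n fwd S \<union> (cover_edges n fwd S)\<inverse>"
      using step(2) cover_edges_shift[of q a w q' a' w' n fwd S k]
        cover_edges_shift[of q' a' w' q a w n fwd S k] unfolding y z by auto
    then have "((q, a, w + k), (q', a', w' + k)) \<in> conn n fwd S"
      unfolding conn_def by (rule r_into_rtrancl)
    with step(3) show ?case unfolding y z by (auto intro: conn_trans)
  qed
  from this[OF assms[unfolded conn_def]] show ?thesis by simp
qed

text \<open>The winding number grows along arrow \<open>n\<close> in its own direction, whether or
  not this is clockwise, because \<open>band_rep\<close> puts \<open>\<phi>\<close> on that arrow.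
  Winding number \<open>w\<close> then stands for the power \<open>w\<close> of
  \<open>\<phi>\<close>.\<close>

lemma conn_step:
  assumes "j \<le> n" "a \<in> sobj S (tail (cyc_quiver n fwd) j)"
  shows "(u, (tail (cyc_quiver n fwd) j, a, w)) \<in> conn n fwd S \<longleftrightarrow>
    (u, (head (cyc_quiver n fwd) j, smap S j a, if j = n then w + 1 else w)) \<in> conn n fwd S"
proof -
  have "((tail (cyc_quiver n fwd) j, a, w), (head (cyc_quiver n fwd) j, smap S j a, if j = n then w + 1 else w)) \<in> cover_edges n fwd S"
    unfolding cover_edges_def using assms by blast
  then have e: "((tail (cyc_quiver n fwd) j, a, w), (head (cyc_quiver n fwd) j, smap S j a, if j = n then w + 1 else w)) \<in> conn n fwd S"
    unfolding conn_def by (intro r_into_rtrancl) simp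
  show ?thesis
    using conn_trans[OF _ e] conn_trans[OF _ conn_sym[OF e]] by blast
qed

section \<open>Band modules that are retracts of free representations\<close>

locale free_summand = indec_module scale V \<phi>
  for scale :: "'f::field \<Rightarrow> 'v::ab_group_add \<Rightarrow> 'v" and V \<phi> +
  fixes n :: nat and fwd :: "nat \<Rightarrow> bool" and S :: "(nat, nat, 's) srep" and i p
  assumes S: "is_srep (cyc_quiver n fwd) S"
    and i: "vrep_hom (cyc_quiver n fwd) (band_rep n scale V \<phi>)
      (free_rep (cyc_quiver n fwd) S :: (nat, nat, 'f, 's \<Rightarrow> 'f) vrep) i"
    and p: "vrep_hom (cyc_quiver n fwd) (free_rep (cyc_quiver n fwd) S) (band_rep n scale V \<phi>) p"
    and pi: "q \<le> n \<Longrightarrow> x \<in> V \<Longrightarrow> p q (i q x) = x"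
begin

abbreviation "src (j :: nat) \<equiv> tail (cyc_quiver n fwd) j"
abbreviation "tgt (j :: nat) \<equiv> head (cyc_quiver n fwd) j"

definition \<psi> :: "nat \<Rightarrow> 'v \<Rightarrow> 'v" where "\<psi> j = (if j = n then \<phi> else id)"
text \<open>The retracted basis vectors: with the coordinates of \<open>i q x\<close> they recover
  \<open>x\<close>, as \<open>decompose\<close> shows.\<close>

definition r :: "nat \<Rightarrow> 's \<Rightarrow> 'v" where "r q a = p q (\<lambda>x. if x = a then 1 else 0)"

lemma ends_le: "j \<le> n \<Longrightarrow> src j \<le> n" "j \<le> n \<Longrightarrow> tgt j \<le> n"
  by auto

lemma fin: "q \<le> n \<Longrightarrow> finite (sobj S q)"
  using S by (simp add: is_srep_def)

lemma smap_mem: "j \<le> n \<Longrightarrow> a \<in> sobj S (src j) \<Longrightarrow> smap S j a \<in> sobj S (tgt j)"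
  using S unfolding is_srep_def by (auto simp del: cyc_quiver_simps(3,4))

lemma i_lin: "q \<le> n \<Longrightarrow> linear_betw scale (\<lambda>r c x. r * c x) V (free_obj (sobj S q)) (i q)"
  using i by (simp add: vrep_hom_def band_rep_def free_rep_def)

lemma p_lin: "q \<le> n \<Longrightarrow> linear_betw (\<lambda>r c x. r * c x) scale (free_obj (sobj S q)) V (p q)"
  using p by (simp add: vrep_hom_def band_rep_def free_rep_def)

lemma i_step: "j \<le> n \<Longrightarrow> x \<in> V \<Longrightarrow> i (tgt j) (\<psi> j x) = free_map (sobj S (src j)) (smap S j) (i (src j) x)"
  using i unfolding vrep_hom_def by (auto simp: band_rep_def free_rep_def \<psi>_def simp del: cyc_quiver_simps(3,4))

lemma p_step: "j \<le> n \<Longrightarrow> c \<in> free_obj (sobj S (src j)) \<Longrightarrow>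
    p (tgt j) (free_map (sobj S (src j)) (smap S j) c) = \<psi> j (p (src j) c)"
  using p unfolding vrep_hom_def by (auto simp: band_rep_def free_rep_def \<psi>_def simp del: cyc_quiver_simps(3,4))

lemma \<psi>_lin: "linear_betw scale scale V V (\<psi> j)"
  using lin by (auto simp: \<psi>_def linear_betw_def)

lemma r_mem: "q \<le> n \<Longrightarrow> a \<in> sobj S q \<Longrightarrow> r q a \<in> V"
  unfolding r_def by (rule linear_betw_mem[OF p_lin]) (auto simp: free_obj_def)

lemma r_step:
  assumes "j \<le> n" "a \<in> sobj S (src j)"
  shows "r (tgt j) (smap S j a) = \<psi> j (r (src j) a)"
proof -
  have f: "finite (sobj S (src j))" using fin ends_le(1) assms(1) by blast
  have "free_map (sobj S (src j)) (smap S j) (\<lambda>x. if x = a then 1 else 0) = (\<lambda>y. if y = smap S j a then 1 else (0::'f))"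
  proof
    fix y
    show "free_map (sobj S (src j)) (smap S j) (\<lambda>x. if x = a then 1 else 0) y = (if y = smap S j a then 1 else (0::'f))"
      unfolding free_map_def using f assms(2) by (auto simp: sum.delta simp del: cyc_quiver_simps(3,4))
  qed
  then show ?thesis
    unfolding r_def using p_step[OF assms(1), of "\<lambda>x. if x = a then 1 else 0"] assms(2)
    by (auto simp: free_obj_def simp del: cyc_quiver_simps(3,4))
qed

lemma decompose:
  assumes "q \<le> n" "x \<in> V"
  shows "x = (\<Sum>a\<in>sobj S q. scale (i q x a) (r q a))"
proof -
  interpret fr: vector_space "\<lambda>(r::'f) c (x::'s). r * c x" by (rule vector_space_free)
  have ix: "i q x \<in> free_obj (sobj S q)" using linear_betw_mem[OF i_lin] assms by blast
  let ?e = "\<lambda>a x. if x = a then 1 else (0::'f)"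
  have "i q x = (\<Sum>a\<in>sobj S q. (\<lambda>y. i q x a * ?e a y))"
    using fin[OF assms(1)] ix by (auto simp: fun_eq_iff free_obj_def sum_apply if_distrib cong: if_cong)
  then have "p q (i q x) = p q (\<Sum>a\<in>sobj S q. (\<lambda>y. i q x a * ?e a y))" by simp
  also have "\<dots> = (\<Sum>a\<in>sobj S q. p q (\<lambda>y. i q x a * ?e a y))"
    by (rule fr.linear_betw_sum[OF p_lin[OF assms(1)] subspace_free_obj]) (auto simp: free_obj_def)
  also have "\<dots> = (\<Sum>a\<in>sobj S q. scale (i q x a) (r q a))"
    unfolding r_def by (intro sum.cong refl linear_betw_scale[OF p_lin[OF assms(1)]]) (auto simp: free_obj_def)
  finally show ?thesis using pi assms by simp
qed

text \<open>A coordinate sum at the head of an arrow is rewritten over its tail. Both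
  \<open>proj\<close> and \<open>wind\<close> are such sums, so their naturality reduces to
  conditions on single elements.\<close>

lemma transport:
  fixes F :: "'s \<Rightarrow> 'f \<Rightarrow> 'z::comm_monoid_add"
  assumes "j \<le> n" "x \<in> V" "\<And>b. F b 0 = 0" "\<And>b x y. F b (x + y) = F b x + F b y"
  shows "(\<Sum>b\<in>sobj S (tgt j). F b (i (tgt j) (\<psi> j x) b)) = (\<Sum>a\<in>sobj S (src j). F (smap S j a) (i (src j) x a))"
  unfolding i_step[OF assms(1,2)]
  by (rule free_map_sum) (use fin ends_le assms smap_mem in \<open>auto simp del: cyc_quiver_simps(3,4)\<close>)

text \<open>Winding numbers may be negative, and \<open>\<phi>\<close> is invertible only on
  \<open>V\<close>, hence \<open>inv_into\<close>.\<close>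

definition zpow :: "int \<Rightarrow> 'v \<Rightarrow> 'v" where
  "zpow w x = (if 0 \<le> w then (\<phi> ^^ nat w) x else (inv_into V \<phi> ^^ nat (- w)) x)"

lemma inv_phi: "x \<in> V \<Longrightarrow> inv_into V \<phi> x \<in> V" "x \<in> V \<Longrightarrow> \<phi> (inv_into V \<phi> x) = x"
  using bij by (auto simp: bij_betw_def inv_into_into f_inv_into_f)

lemma zpow_mem: "x \<in> V \<Longrightarrow> zpow w x \<in> V"
proof -
  have "x \<in> V \<Longrightarrow> (inv_into V \<phi> ^^ k) x \<in> V" for k
    by (induction k) (auto intro: inv_phi)
  then show "x \<in> V \<Longrightarrow> zpow w x \<in> V" by (simp add: zpow_def phi_pow_mem)
qed

lemma zpow_Suc:
  assumes "x \<in> V"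
  shows "zpow (w + 1) x = \<phi> (zpow w x)"
proof (cases "0 \<le> w")
  case True
  then show ?thesis by (simp add: zpow_def nat_add_distrib)
next
  case False
  define k where "k = nat (- w - 1)"
  have w: "w = - int (Suc k)" using False by (simp add: k_def)
  have "zpow (w + 1) x = (inv_into V \<phi> ^^ k) x" unfolding w zpow_def by (cases k) (auto simp: nat_add_distrib)
  moreover have "zpow w x = inv_into V \<phi> ((inv_into V \<phi> ^^ k) x)" unfolding w zpow_def by (simp add: nat_add_distrib)
  moreover have "(inv_into V \<phi> ^^ k) x \<in> V" using assms by (induction k) (auto intro: inv_phi)
  ultimately show ?thesis by (simp add: inv_phi)
qed

text \<open>\<open>r\<close> is compatible with the arrows, and \<open>\<phi>\<close> acts exactly
  at arrow \<open>n\<close>, where the winding number grows. Steps against an arrow are handled by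
  injectivity of \<open>\<phi>\<close>.\<close>

lemma r_zpow:
  assumes "((0, a0, 0), (q, a, w)) \<in> conn n fwd S" and a0: "a0 \<in> sobj S 0"
  shows "q \<le> n \<and> a \<in> sobj S q \<and> r q a = zpow w (r 0 a0)"
proof -
  have v0: "r 0 a0 \<in> V" using r_mem a0 by simp
  have "((0, a0, 0), u) \<in> (cover_edges n fwd S \<union> (cover_edges n fwd S)\<inverse>)\<^sup>* \<Longrightarrow>
    fst u \<le> n \<and> fst (snd u) \<in> sobj S (fst u) \<and> r (fst u) (fst (snd u)) = zpow (snd (snd u)) (r 0 a0)" for u
  proof (induction rule: rtrancl_induct)
    case base then show ?case using a0 by (simp add: zpow_def)
  next
    case (step y z)
    from step(2) consider "(y, z) \<in> cover_edges n fwd S" | "(z, y) \<in> cover_edges n fwd S" by blast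
    then show ?case
    proof cases
      case 1
      then obtain j a w where e: "y = (src j, a, w)" "z = (tgt j, smap S j a, if j = n then w + 1 else w)"
        "j \<le> n" "a \<in> sobj S (src j)" unfolding cover_edges_def by blast
      have "r (tgt j) (smap S j a) = zpow (if j = n then w + 1 else w) (r 0 a0)"
        using r_step[OF e(3,4)] step(3) unfolding e(1) by (simp add: \<psi>_def zpow_Suc[OF v0])
      then show ?thesis unfolding e(2) using ends_le(2)[OF e(3)] smap_mem[OF e(3,4)] by simp
    next
      case 2
      then obtain j a w where e: "z = (src j, a, w)" "y = (tgt j, smap S j a, if j = n then w + 1 else w)"
        "j \<le> n" "a \<in> sobj S (src j)" unfolding cover_edges_def by blast
      have rV: "r (src j) a \<in> V" using r_mem e(4) ends_le(1)[OF e(3)] by blast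
      have "\<psi> j (r (src j) a) = zpow (if j = n then w + 1 else w) (r 0 a0)"
        using r_step[OF e(3,4)] step(3) unfolding e(2) by simp
      then have "r (src j) a = zpow w (r 0 a0)"
        using phi_inj[OF rV zpow_mem[OF v0, of w]] by (auto simp: \<psi>_def zpow_Suc[OF v0] split: if_splits)
      then show ?thesis unfolding e(1) using ends_le(1)[OF e(3)] e(4) by simp
    qed
  qed
  from this[OF assms(1)[unfolded conn_def]] show ?thesis by simp
qed

definition component :: "'s \<Rightarrow> nat \<Rightarrow> 's set" where
  "component a0 q = {a. \<exists>w. ((0, a0, 0), (q, a, w)) \<in> conn n fwd S}"

text \<open>The share of the component of \<open>a0\<close> in \<open>decompose\<close>. It is an
  endomorphism since components are closed under arrows in both senses.\<close>

definition proj :: "'s \<Rightarrow> nat \<Rightarrow> 'v \<Rightarrow> 'v" where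
  "proj a0 q x = (\<Sum>a\<in>sobj S q. if a \<in> component a0 q then scale (i q x a) (r q a) else 0)"

text \<open>The coordinate of \<open>x\<close> at winding number \<open>w\<close>; an element
  reached with several winding numbers contributes to each of them. These are the coordinates
  \<open>K\<close> of \<open>cyclic_summand\<close>.\<close>

definition wind :: "'s \<Rightarrow> nat \<Rightarrow> int \<Rightarrow> 'v \<Rightarrow> 'f" where
  "wind a0 q w x = (\<Sum>a\<in>sobj S q. if ((0, a0, 0), (q, a, w)) \<in> conn n fwd S then i q x a else 0)"

lemma component_step:
  assumes "j \<le> n" "a \<in> sobj S (src j)"
  shows "smap S j a \<in> component a0 (tgt j) \<longleftrightarrow> a \<in> component a0 (src j)"
proof
  assume "a \<in> component a0 (src j)"
  then show "smap S j a \<in> component a0 (tgt j)" unfolding component_def using conn_step[OF assms] by blast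
next
  assume "smap S j a \<in> component a0 (tgt j)"
  then obtain w where w: "((0, a0, 0), (tgt j, smap S j a, w)) \<in> conn n fwd S" by (auto simp: component_def)
  have "((0, a0, 0), (src j, a, if j = n then w - 1 else w)) \<in> conn n fwd S"
    by (subst conn_step[OF assms]) (use w in auto)
  then show "a \<in> component a0 (src j)" by (auto simp: component_def)
qed

lemma proj_step:
  assumes j: "j \<le> n" and x: "x \<in> V"
  shows "proj a0 (tgt j) (\<psi> j x) = \<psi> j (proj a0 (src j) x)"
proof -
  have "proj a0 (tgt j) (\<psi> j x) = (\<Sum>a\<in>sobj S (src j). if smap S j a \<in> component a0 (tgt j)
      then scale (i (src j) x a) (r (tgt j) (smap S j a)) else 0)"
    unfolding proj_def by (rule transport[OF j x]) (auto simp: scale_left_distrib)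
  also have "\<dots> = (\<Sum>a\<in>sobj S (src j). \<psi> j (if a \<in> component a0 (src j) then scale (i (src j) x a) (r (src j) a) else 0))"
    using component_step[OF j] r_step[OF j] linear_betw_scale[OF \<psi>_lin r_mem[OF ends_le(1)[OF j]]]
      linear_betw_zero[OF \<psi>_lin]
    by (intro sum.cong refl) (simp del: cyc_quiver_simps(3,4))
  also have "\<dots> = \<psi> j (proj a0 (src j) x)"
    unfolding proj_def using r_mem[OF ends_le(1)[OF j]] subspace_scale[OF subV]
    by (intro linear_betw_sum[OF \<psi>_lin subV, symmetric]) (auto simp del: cyc_quiver_simps(3,4))
  finally show ?thesis .
qed

lemma wind_step:
  assumes j: "j \<le> n" and x: "x \<in> V"
  shows "wind a0 (tgt j) (if j = n then w + 1 else w) (\<psi> j x) = wind a0 (src j) w x"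
proof -
  have "wind a0 (tgt j) (if j = n then w + 1 else w) (\<psi> j x) = (\<Sum>a\<in>sobj S (src j).
      if ((0, a0, 0), (tgt j, smap S j a, if j = n then w + 1 else w)) \<in> conn n fwd S then i (src j) x a else 0)"
    unfolding wind_def by (rule transport[OF j x]) auto
  also have "\<dots> = wind a0 (src j) w x"
    unfolding wind_def
    by (intro sum.cong refl) (simp only: conn_step[OF j, of _ S fwd "(0, a0, 0)" w])
  finally show ?thesis .
qed

text \<open>Arrows 0 to \<open>n - 1\<close> are identities in the band, so naturality makes
  \<open>proj\<close>, and likewise \<open>wind\<close>, the same at all vertices. Arrow
  \<open>n\<close> then gives \<open>proj_phi\<close> and \<open>wind_phi\<close>.\<close>

lemma proj_const: "q \<le> n \<Longrightarrow> x \<in> V \<Longrightarrow> proj a0 q x = proj a0 0 x"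
proof (induction q)
  case (Suc q)
  then have "proj a0 (tgt q) x = proj a0 (src q) x"
    using proj_step[of q x a0] by (simp add: \<psi>_def del: cyc_quiver_simps(3,4))
  then show ?case using Suc by (simp split: if_splits)
qed simp

lemma wind_const: "q \<le> n \<Longrightarrow> x \<in> V \<Longrightarrow> wind a0 q w x = wind a0 0 w x"
proof (induction q)
  case (Suc q)
  then have "wind a0 (tgt q) w x = wind a0 (src q) w x"
    using wind_step[of q x a0 w] by (simp add: \<psi>_def del: cyc_quiver_simps(3,4))
  then show ?case using Suc by (simp split: if_splits)
qed simp

lemma proj_phi: "x \<in> V \<Longrightarrow> proj a0 0 (\<phi> x) = \<phi> (proj a0 0 x)"
  using proj_step[of n x a0] proj_const[of n] phi_mem by (simp add: \<psi>_def split: if_splits)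

lemma wind_phi: "x \<in> V \<Longrightarrow> wind a0 0 (w + 1) (\<phi> x) = wind a0 0 w x"
  using wind_step[of n x a0 w] wind_const[of n] phi_mem by (simp add: \<psi>_def split: if_splits)

lemma proj_linear: "linear_betw scale scale V V (proj a0 0)"
proof (rule linear_betwI)
  have l: "linear_betw scale (\<lambda>r c x. r * c x) V (free_obj (sobj S 0)) (i 0)" by (rule i_lin) simp
  fix x assume x: "x \<in> V"
  show "proj a0 0 x \<in> V"
    unfolding proj_def using r_mem[of 0] subspace_scale[OF subV] by (intro subspace_sum[OF subV]) auto
  show "proj a0 0 (scale c x) = scale c (proj a0 0 x)" for c
    unfolding proj_def scale_sum_right by (intro sum.cong refl) (simp add: linear_betw_scale[OF l x])
  show "proj a0 0 (x + y) = proj a0 0 x + proj a0 0 y" if "y \<in> V" for y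
    unfolding proj_def sum.distrib[symmetric]
    by (intro sum.cong refl) (simp add: linear_betw_add[OF l x that] scale_left_distrib)
qed

lemma wind_add: "x \<in> V \<Longrightarrow> y \<in> V \<Longrightarrow> wind a0 0 w (x + y) = wind a0 0 w x + wind a0 0 w y"
  unfolding wind_def sum.distrib[symmetric]
  by (intro sum.cong refl) (simp add: linear_betw_add[OF i_lin[of 0]])

lemma wind_scale: "x \<in> V \<Longrightarrow> wind a0 0 w (scale c x) = c * wind a0 0 w x"
  unfolding wind_def sum_distrib_left
  by (intro sum.cong refl) (simp add: linear_betw_scale[OF i_lin[of 0]])

text \<open>Each element of the component is counted at the one winding number in \<open>W\<close>
  that reaches it, and there \<open>r\<close> is the corresponding power of \<open>\<phi>\<close>
  applied to \<open>r 0 a0\<close>. \<open>W\<close> will be the set of all occurring winding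
  numbers, or the residues modulo \<open>g\<close>.\<close>

lemma proj_eq_wind:
  assumes a0: "a0 \<in> sobj S 0" and x: "x \<in> V" and W: "finite W"
    and one: "\<And>a. a \<in> sobj S 0 \<Longrightarrow> a \<in> component a0 0 \<Longrightarrow> \<exists>!w. w \<in> W \<and> ((0, a0, 0), (0, a, w)) \<in> conn n fwd S"
  shows "proj a0 0 x = (\<Sum>w\<in>W. scale (wind a0 0 w x) (zpow w (r 0 a0)))"
proof -
  let ?c = "\<lambda>a w. ((0, a0, 0), (0, a, w)) \<in> conn n fwd S"
  have "(\<Sum>w\<in>W. scale (wind a0 0 w x) (zpow w (r 0 a0))) =
      (\<Sum>w\<in>W. \<Sum>a\<in>sobj S 0. if ?c a w then scale (i 0 x a) (r 0 a) else 0)"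
    unfolding wind_def scale_sum_left
  proof (intro sum.cong refl)
    fix w a
    show "scale (if ?c a w then i 0 x a else 0) (zpow w (r 0 a0)) = (if ?c a w then scale (i 0 x a) (r 0 a) else 0)"
      using r_zpow[of a0 0 a w, OF _ a0] by (cases "?c a w") simp_all
  qed
  also have "\<dots> = (\<Sum>a\<in>sobj S 0. \<Sum>w\<in>W. if ?c a w then scale (i 0 x a) (r 0 a) else 0)"
    by (rule sum.swap)
  also have "\<dots> = proj a0 0 x"
    unfolding proj_def
  proof (rule sum.cong[OF refl])
    fix a assume a: "a \<in> sobj S 0"
    show "(\<Sum>w\<in>W. if ?c a w then scale (i 0 x a) (r 0 a) else 0) =
        (if a \<in> component a0 0 then scale (i 0 x a) (r 0 a) else 0)"
    proof (cases "a \<in> component a0 0")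
      case True
      define w where "w = (THE w. w \<in> W \<and> ?c a w)"
      have w: "w \<in> W" "?c a w" using theI'[OF one[OF a True]] unfolding w_def by blast+
      have n: "\<not> ?c a w'" if "w' \<in> W - {w}" for w'
      proof
        assume "?c a w'"
        then have "w = w'" unfolding w_def using that by (intro the1_equality[OF one[OF a True]]) blast
        with that show False by simp
      qed
      have "(\<Sum>w\<in>W. if ?c a w then scale (i 0 x a) (r 0 a) else 0) =
          (\<Sum>w'\<in>{w}. if ?c a w' then scale (i 0 x a) (r 0 a) else 0)"
        by (rule sum.mono_neutral_right[OF W]) (use w(1) n in simp_all)
      then show ?thesis using w True by simp
    next
      case False
      then have "\<not> ?c a w" for w by (auto simp: component_def)
      then show ?thesis using False by simp
    qed
  qed
  finally show ?thesis by simp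
qed

lemma proj_inj_exists: "\<exists>a0\<in>sobj S 0. inj_on (proj a0 0) V"
proof -
  let ?S = "sobj S 0"
  define rel where "rel a b \<longleftrightarrow> (\<exists>w. ((0, a, 0), (0, b, w)) \<in> conn n fwd S)" for a b
  have rel_refl: "rel a a" for a unfolding rel_def using conn_refl by blast
  have sym: "rel b a" if "rel a b" for a b
  proof -
    from that obtain w where "((0, a, 0), (0, b, w)) \<in> conn n fwd S" by (auto simp: rel_def)
    from conn_shift[OF conn_sym[OF this], of "- w"] show ?thesis by (auto simp: rel_def)
  qed
  have trans: "rel a c" if "rel a b" "rel b c" for a b c
  proof -
    from that obtain w w' where "((0, a, 0), (0, b, w)) \<in> conn n fwd S" and w': "((0, b, 0), (0, c, w')) \<in> conn n fwd S"
      by (auto simp: rel_def)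
    from conn_trans[OF this(1)] conn_shift[OF w', of w] show ?thesis by (auto simp: rel_def)
  qed
  \<comment> \<open>One representative for each component that meets \<open>sobj S 0\<close>, so
    that the projections add up to the identity.\<close>
  define rep where "rep a = (SOME b. b \<in> ?S \<and> rel a b)" for a
  have rep: "rep a \<in> ?S" "rel a (rep a)" if "a \<in> ?S" for a
    using someI[of "\<lambda>b. b \<in> ?S \<and> rel a b" a] that rel_refl by (simp_all add: rep_def)
  have rep_eq: "rep a = rep b" if "rel a b" for a b
  proof -
    have "rel a c \<longleftrightarrow> rel b c" for c using that sym trans by blast
    then show ?thesis by (simp add: rep_def)
  qed
  have cls: "{a\<in>?S. rep a = c} = {a\<in>?S. a \<in> component c 0}" if "c \<in> rep ` ?S" for c
  proof -
    from that obtain b where b: "b \<in> ?S" "c = rep b" by auto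
    have c: "rep c = c" using rep_eq[OF rep(2)[OF b(1)]] b(2) by simp
    have "rep a = c \<longleftrightarrow> rel c a" if "a \<in> ?S" for a
      using rep(2)[OF that] sym rep_eq[of c a] c by auto
    then show ?thesis by (auto simp: component_def rel_def)
  qed
  have f: "finite ?S" using fin by simp
  have sum: "(\<Sum>c\<in>rep ` ?S. proj c 0 x) = x" if x: "x \<in> V" for x
  proof -
    have "x = (\<Sum>a\<in>?S. scale (i 0 x a) (r 0 a))" by (rule decompose) (use x in auto)
    also have "\<dots> = (\<Sum>c\<in>rep ` ?S. \<Sum>a\<in>{a\<in>?S. rep a = c}. scale (i 0 x a) (r 0 a))"
      by (rule sum.image_gen[OF f])
    also have "\<dots> = (\<Sum>c\<in>rep ` ?S. proj c 0 x)"
    proof (rule sum.cong[OF refl])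
      fix c assume c: "c \<in> rep ` ?S"
      show "(\<Sum>a\<in>{a\<in>?S. rep a = c}. scale (i 0 x a) (r 0 a)) = proj c 0 x"
        unfolding cls[OF c] proj_def by (rule sum.inter_filter[OF f])
    qed
    finally show ?thesis by simp
  qed
  have "\<exists>c\<in>rep ` ?S. inj_on (proj c 0) V"
  proof (rule local_endomorphisms)
    show "finite (rep ` ?S)" using f by simp
    show "inj_on (\<lambda>x. \<Sum>c\<in>rep ` ?S. proj c 0 x) V" by (rule inj_onI) (simp add: sum)
  qed (auto intro: proj_linear proj_phi)
  then show ?thesis using rep(1) by blast
qed

lemma summand_classification:
  obtains f m \<epsilon> where "\<exists>z :: 'f alg_closure. root_of_unity z \<and> is_min_poly f z"
    "if CHAR('f) = 0 then m = 1 else \<exists>k. m = CHAR('f) ^ k"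
    "linear_betw smult scale (poly_quot (f ^ m)) V \<epsilon>" "bij_betw \<epsilon> (poly_quot (f ^ m)) V"
    "\<And>q. q \<in> poly_quot (f ^ m) \<Longrightarrow> \<epsilon> (mult_X (f ^ m) q) = \<phi> (\<epsilon> q)"
proof -
  obtain a0 where a0: "a0 \<in> sobj S 0" and inj: "inj_on (proj a0 0) V"
    using proj_inj_exists by blast
  define v0 where "v0 = r 0 a0"
  have v0: "v0 \<in> V" using r_mem a0 by (simp add: v0_def)
  \<comment> \<open>The winding numbers of closed walks at \<open>a0\<close>, a subgroup of the
    integers.\<close>
  define D where "D = {w. ((0, a0, 0), (0, a0, w)) \<in> conn n fwd S}"
  have D_diff: "w - w' \<in> D" if "((0, a0, 0), (0, a, w)) \<in> conn n fwd S" "((0, a0, 0), (0, a, w')) \<in> conn n fwd S" for a w w'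
  proof -
    have "((0, a, w), (0, a0, w - w')) \<in> conn n fwd S"
      using conn_shift[OF conn_sym[OF that(2)], of "w - w'"] by simp
    from conn_trans[OF that(1) this] show ?thesis by (simp add: D_def)
  qed
  have D_conn: "((0, a0, 0), (0, a, w + d)) \<in> conn n fwd S" if "d \<in> D" "((0, a0, 0), (0, a, w)) \<in> conn n fwd S" for a w d
    using conn_trans[of "(0, a0, 0)" "(0, a0, d)"] conn_shift[OF that(2), of d] that(1) by (simp add: D_def)
  have D0: "0 \<in> D" by (simp add: D_def conn_refl)
  show thesis
  proof (cases "\<exists>g>0. g \<in> D")
    case False
    have D: "d = 0" if "d \<in> D" for d
    proof (rule ccontr)
      assume "d \<noteq> 0"
      moreover have "- d \<in> D" using D_diff[of a0 0 d] that D0 by (simp add: D_def)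
      ultimately show False using False that by (metis linorder_neqE_linordered_idom neg_0_less_iff_less)
    qed
    define W where "W = {w. \<exists>a\<in>sobj S 0. ((0, a0, 0), (0, a, w)) \<in> conn n fwd S}"
    have uniq: "w = w'" if "((0, a0, 0), (0, a, w)) \<in> conn n fwd S" "((0, a0, 0), (0, a, w')) \<in> conn n fwd S" for a w w'
      using D[OF D_diff[OF that]] by simp
    have "finite {w. ((0, a0, 0), (0, a, w)) \<in> conn n fwd S}" for a
    proof (rule finite_subset[of _ "{THE w. ((0, a0, 0), (0, a, w)) \<in> conn n fwd S}"])
      show "{w. ((0, a0, 0), (0, a, w)) \<in> conn n fwd S} \<subseteq> {THE w. ((0, a0, 0), (0, a, w)) \<in> conn n fwd S}"
        using uniq by (auto intro!: the_equality[symmetric])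
    qed simp
    then have W: "finite W" unfolding W_def using fin[of 0] by auto
    \<comment> \<open>Applying \<open>\<phi>\<close> moves a nonzero coordinate to ever larger
      winding numbers, but only finitely many occur.\<close>
    have zero: "wind a0 0 w x = 0" if x: "x \<in> V" for w x
    proof (rule ccontr)
      assume nz: "wind a0 0 w x \<noteq> 0"
      have eq: "wind a0 0 (w + int k) ((\<phi> ^^ k) x) = wind a0 0 w x" for k
      proof (induction k)
        case (Suc k)
        have "w + int (Suc k) = w + int k + 1" by simp
        then show ?case using wind_phi[OF phi_pow_mem[OF x, of k], of a0 "w + int k"] Suc by (simp add: ac_simps)
      qed simp
      have "w + int k \<in> W" for k
      proof (rule ccontr)
        assume "w + int k \<notin> W"
        then have "wind a0 0 (w + int k) ((\<phi> ^^ k) x) = 0"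
          unfolding wind_def W_def by (intro sum.neutral) auto
        then show False using eq nz by simp
      qed
      then have "range (\<lambda>k. w + int k) \<subseteq> W" by auto
      moreover have "infinite (range (\<lambda>k. w + int k))" by (rule range_inj_infinite) (auto simp: inj_def)
      ultimately show False using W finite_subset by blast
    qed
    have "proj a0 0 x = 0" if x: "x \<in> V" for x
    proof (subst proj_eq_wind[OF a0 x W])
      show "\<exists>!w. w \<in> W \<and> ((0, a0, 0), (0, a, w)) \<in> conn n fwd S" if "a \<in> sobj S 0" "a \<in> component a0 0" for a
        using that uniq by (auto simp: W_def component_def)
    qed (simp add: zero x)
    then have "x = 0" if "x \<in> V" for x
      using inj_onD[OF inj, of x 0] that by simp
    then show thesis using nonzero zero_mem by blast
  next
    case True
    \<comment> \<open>The positive generator of \<open>D\<close>: every element of the component has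
      exactly one winding number among 0 to \<open>g - 1\<close>.\<close>
    define g where "g = (LEAST g::nat. 0 < g \<and> int g \<in> D)"
    have ex: "\<exists>g::nat. 0 < g \<and> int g \<in> D"
    proof -
      from True obtain d where "0 < d" "d \<in> D" by blast
      then show ?thesis by (intro exI[of _ "nat d"]) simp
    qed
    have g: "0 < g" "int g \<in> D" unfolding g_def using LeastI_ex[OF ex] by auto
    have min: "d = 0" if "int d \<in> D" "d < g" for d
      using not_less_Least[of d "\<lambda>g. 0 < g \<and> int g \<in> D"] that unfolding g_def by auto
    have gk: "((0, a0, 0), (0, a, w + int g * int k)) \<in> conn n fwd S"
      if "((0, a0, 0), (0, a, w)) \<in> conn n fwd S" for a w k
    proof (induction k)
      case (Suc k)
      from D_conn[OF g(2) Suc] show ?case by (simp add: algebra_simps)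
    qed (use that in simp)
    have Dneg: "- d \<in> D" if "d \<in> D" for d
      using D_diff[of a0 0 d] that D0 by (simp add: D_def)
    have gneg: "((0, a0, 0), (0, a, w - int g * int k)) \<in> conn n fwd S"
      if "((0, a0, 0), (0, a, w)) \<in> conn n fwd S" for a w k
    proof (induction k)
      case (Suc k)
      from D_conn[OF Dneg[OF g(2)] Suc] show ?case by (simp add: algebra_simps)
    qed (use that in simp)
    have gmod: "((0, a0, 0), (0, a, w mod int g)) \<in> conn n fwd S"
      if "((0, a0, 0), (0, a, w)) \<in> conn n fwd S" for a w
    proof (cases "0 \<le> w div int g")
      case True
      then have "w - int g * int (nat (w div int g)) = w mod int g"
        by (simp add: minus_mult_div_eq_mod)
      with gneg[OF that, of "nat (w div int g)"] show ?thesis by simp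
    next
      case False
      then have "w + int g * int (nat (- (w div int g))) = w mod int g"
        using minus_mult_div_eq_mod[of w "int g"] by simp
      with gk[OF that, of "nat (- (w div int g))"] show ?thesis by simp
    qed
    have period: "wind a0 0 (w + int g) x = wind a0 0 w x" for w x
    proof -
      have "((0, a0, 0), (0, a, w + int g)) \<in> conn n fwd S \<longleftrightarrow> ((0, a0, 0), (0, a, w)) \<in> conn n fwd S" for a
        using gk[of a w 1] gneg[of a "w + int g" 1] by auto
      then show ?thesis by (simp add: wind_def)
    qed
    have "r 0 a0 = zpow (int g) (r 0 a0)"
      using r_zpow[OF _ a0, of 0 a0 "int g"] g(2) by (simp add: D_def)
    then have vg: "(\<phi> ^^ g) v0 = v0" by (simp add: v0_def zpow_def)
    define W where "W = int ` {..<g}"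
    have one: "\<exists>!w. w \<in> W \<and> ((0, a0, 0), (0, a, w)) \<in> conn n fwd S" if a: "a \<in> component a0 0" for a
    proof -
      from a obtain w where w: "((0, a0, 0), (0, a, w)) \<in> conn n fwd S" by (auto simp: component_def)
      have "0 \<le> w mod int g" "w mod int g < int g" using g(1) by simp_all
      then have "w mod int g \<in> W" unfolding W_def
        by (intro image_eqI[of _ _ "nat (w mod int g)"]) auto
      moreover have "u = u'" if u: "u \<in> W" "u' \<in> W" "((0, a0, 0), (0, a, u)) \<in> conn n fwd S"
        "((0, a0, 0), (0, a, u')) \<in> conn n fwd S" for u u'
      proof -
        have le: "u = u'" if "u' \<le> u" "u \<in> W" "u' \<in> W" "((0, a0, 0), (0, a, u)) \<in> conn n fwd S"
          "((0, a0, 0), (0, a, u')) \<in> conn n fwd S" for u u'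
        proof -
          have "int (nat (u - u')) \<in> D" using D_diff[OF that(4,5)] that(1) by simp
          moreover have "nat (u - u') < g" using that(1-3) by (auto simp: W_def)
          ultimately have "nat (u - u') = 0" by (rule min)
          then show ?thesis using that(1) by simp
        qed
        show ?thesis using le[of u u'] le[of u' u] u by (cases "u' \<le> u") auto
      qed
      ultimately show ?thesis using gmod[OF w] by blast
    qed
    have proj: "proj a0 0 x = (\<Sum>j<g. scale (wind a0 0 (int j) x) ((\<phi> ^^ j) v0))" if x: "x \<in> V" for x
    proof -
      have "proj a0 0 x = (\<Sum>w\<in>W. scale (wind a0 0 w x) (zpow w (r 0 a0)))"
        by (rule proj_eq_wind[OF a0 x]) (simp add: W_def, rule one)
      also have "\<dots> = (\<Sum>j<g. scale (wind a0 0 (int j) x) ((\<phi> ^^ j) v0))"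
        unfolding W_def by (subst sum.reindex) (auto simp: inj_on_def zpow_def v0_def)
      finally show ?thesis .
    qed
    show thesis
    proof (rule cyclic_summand[of v0 g "\<lambda>x j. wind a0 0 (int j) x"])
      show "inj_on (\<lambda>x. \<Sum>j<g. scale (wind a0 0 (int j) x) ((\<phi> ^^ j) v0)) V"
        using inj proj by (simp add: inj_on_def)
      show "wind a0 0 (int (Suc j)) (\<phi> x) = wind a0 0 (int j) x" if "x \<in> V" for x j
        using wind_phi[OF that, of a0 "int j"] by (simp add: add.commute)
      \<comment> \<open>Winding number 0 for \<open>\<phi> x\<close> is -1 for \<open>x\<close>,
        which by periodicity is \<open>g - 1\<close>.\<close>
      show "wind a0 0 (int 0) (\<phi> x) = wind a0 0 (int (g - 1)) x" if "x \<in> V" for x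
        using wind_phi[OF that, of a0 "- 1"] period[of "- 1" x] g(1) by (simp add: of_nat_diff)
      show "wind a0 0 (int j) (x + y) = wind a0 0 (int j) x + wind a0 0 (int j) y" if "x \<in> V" "y \<in> V" for x y j
        using wind_add that .
      show "wind a0 0 (int j) (scale c x) = c * wind a0 0 (int j) x" if "x \<in> V" for x c j
        using wind_scale that .
    qed (fact v0 g(1) vg that)+
  qed
qed

end

section \<open>The additive image\<close>

lemma vrep_hom_cong:
  assumes "wf_digraph Q" "vscale R' = vscale R" "vmap R' = vmap R" "\<And>q. q \<in> verts Q \<Longrightarrow> vobj R' q = vobj R q"
  shows "vrep_hom Q R' S h = vrep_hom Q R S h" "vrep_hom Q T R' k = vrep_hom Q T R k"
  using assms wf_digraph.tail_in_verts[OF assms(1)] unfolding vrep_hom_def by auto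

text \<open>Some \<open>U j\<close> is nonzero, and the sum of the others is a complement of it, so
  that sum vanishes.\<close>

lemma direct_sum_indecomposable:
  assumes Q: "wf_digraph Q" and R: "indecomposable Q R" and U: "direct_sum Q R k U"
  obtains j where "j < k" "\<And>q. q \<in> verts Q \<Longrightarrow> U j q = vobj R q"
proof -
  have R': "is_vrep Q R" and nz: "\<not> zero_family Q (vobj R)" using R by (simp_all add: indecomposable_def)
  interpret vector_space "vscale R" using R' by (rule is_vrepD)
  interpret wf_digraph Q by fact
  have sub: "subrep Q R (U j)" if "j < k" for j using U that by (simp add: direct_sum_def)
  have ex1: "\<exists>!y. y \<in> (\<Pi>\<^sub>E l\<in>{..<k}. U l q) \<and> x = (\<Sum>l<k. y l)" if "q \<in> verts Q" "x \<in> vobj R q" for q x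
    using U that by (simp add: direct_sum_def)
  have ex: "\<exists>y. (\<forall>l<k. y l \<in> U l q) \<and> x = (\<Sum>l<k. y l)" if "q \<in> verts Q" "x \<in> vobj R q" for q x
    using ex1_implies_ex[OF ex1[OF that]] by (auto simp: PiE_iff)
  have un: "y l = z l" if q: "q \<in> verts Q" and y: "\<forall>l<k. y l \<in> U l q" and z: "\<forall>l<k. z l \<in> U l q"
    and eq: "(\<Sum>l<k. y l) = (\<Sum>l<k. z l)" and l: "l < k" for q y z l
  proof -
    have mem: "(\<Sum>l<k. y l) \<in> vobj R q"
      using subrepD(2)[OF sub q] y by (intro subspace_sum[OF is_vrepD(3)[OF R' q]]) auto
    let ?P = "\<lambda>u. u \<in> (\<Pi>\<^sub>E l\<in>{..<k}. U l q) \<and> (\<Sum>l<k. y l) = (\<Sum>l<k. u l)"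
    have "?P (restrict y {..<k})" "?P (restrict z {..<k})" using y z eq by auto
    then have "restrict y {..<k} = restrict z {..<k}" using ex1[OF q mem] by blast
    then have "restrict y {..<k} l = restrict z {..<k} l" by simp
    then show ?thesis using l by simp
  qed
  have "\<exists>j<k. \<not> zero_family Q (U j)"
  proof (rule ccontr)
    assume "\<not> (\<exists>j<k. \<not> zero_family Q (U j))"
    then have z: "U j q = {0}" if "j < k" "q \<in> verts Q" for j q using that by (auto simp: zero_family_def)
    have "x = 0" if "q \<in> verts Q" "x \<in> vobj R q" for q x
    proof -
      obtain y where y: "\<forall>l<k. y l \<in> U l q" "x = (\<Sum>l<k. y l)" using ex[OF \<open>q \<in> verts Q\<close> \<open>x \<in> vobj R q\<close>] by blast
      then have "\<forall>l<k. y l = 0" using z that(1) by auto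
      then show "x = 0" using y(2) by simp
    qed
    then have "zero_family Q (vobj R)"
      using subspace_0[OF is_vrepD(3)[OF R']] by (auto simp: zero_family_def)
    with nz show False by simp
  qed
  then obtain j where j: "j < k" "\<not> zero_family Q (U j)" by blast
  define B where "B q = {\<Sum>l<k. y l |y. (\<forall>l<k. y l \<in> U l q) \<and> y j = 0}" for q
  have sU: "subspace (U l q)" if "l < k" "q \<in> verts Q" for l q using subrepD(1)[OF sub] that by blast
  have B: "subrep Q R B"
  proof (rule subrepI[OF R' Q])
    fix q assume q: "q \<in> verts Q"
    show "subspace (B q)"
    proof (rule subspaceI)
      show "0 \<in> B q" unfolding B_def using subspace_0[OF sU[OF _ q]]
        by (intro CollectI exI[of _ "\<lambda>_. 0"]) simp
    next
      fix x y assume "x \<in> B q" "y \<in> B q"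
      then obtain a b where "\<forall>l<k. a l \<in> U l q" "a j = 0" "x = (\<Sum>l<k. a l)"
        "\<forall>l<k. b l \<in> U l q" "b j = 0" "y = (\<Sum>l<k. b l)" by (auto simp: B_def)
      then show "x + y \<in> B q" unfolding B_def using subspace_add[OF sU[OF _ q]]
        by (intro CollectI exI[of _ "\<lambda>l. a l + b l"]) (simp add: sum.distrib)
    next
      fix c x assume "x \<in> B q"
      then obtain a where "\<forall>l<k. a l \<in> U l q" "a j = 0" "x = (\<Sum>l<k. a l)" by (auto simp: B_def)
      then show "vscale R c x \<in> B q" unfolding B_def using subspace_scale[OF sU[OF _ q]]
        by (intro CollectI exI[of _ "\<lambda>l. vscale R c (a l)"]) (simp add: scale_sum_right)
    qed
    show "B q \<subseteq> vobj R q"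
      unfolding B_def using subrepD(2)[OF sub q] by (auto intro!: subspace_sum[OF is_vrepD(3)[OF R' q]])
  next
    fix a x assume a: "a \<in> arcs Q" and "x \<in> B (tail Q a)"
    then obtain y where y: "\<forall>l<k. y l \<in> U l (tail Q a)" "y j = 0" "x = (\<Sum>l<k. y l)" by (auto simp: B_def)
    have t: "tail Q a \<in> verts Q" using a by simp
    note al = is_vrepD(4)[OF R' a]
    have "vmap R a x = (\<Sum>l<k. vmap R a (y l))"
      unfolding y(3) by (rule linear_betw_sum[OF al is_vrepD(3)[OF R' t]]) (use y(1) subrepD(2)[OF sub t] in auto)
    moreover have "vmap R a 0 = 0" using linear_betw_zero[OF al subspace_0[OF is_vrepD(3)[OF R' t]]] .
    ultimately show "vmap R a x \<in> B (head Q a)"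
      unfolding B_def using y subrepD(3)[OF sub a] by (intro CollectI exI[of _ "\<lambda>l. vmap R a (y l)"]) simp
  qed
  have "direct_sum Q R 2 (\<lambda>i. if i = 0 then U j else B)"
  proof (rule direct_sum_2I[OF R' sub[OF j(1)] B])
    fix q x assume q: "q \<in> verts Q" and x: "x \<in> U j q" "x \<in> B q"
    from x(2) obtain y where y: "\<forall>l<k. y l \<in> U l q" "y j = 0" "x = (\<Sum>l<k. y l)" by (auto simp: B_def)
    have "(\<Sum>l<k. if l = j then x else 0) = (\<Sum>l<k. y l)" using j(1) y(3) by simp
    from un[OF q _ y(1) this j(1)] show "x = 0"
      using x(1) y(2) subspace_0[OF sU[OF _ q]] by simp
  next
    fix q x assume q: "q \<in> verts Q" and "x \<in> vobj R q"
    then obtain y where y: "\<forall>l<k. y l \<in> U l q" "x = (\<Sum>l<k. y l)" using ex by blast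
    let ?z = "\<lambda>l. if l = j then 0 else y l"
    have "x = (\<Sum>l<k. (if l = j then y j else 0) + ?z l)" unfolding y(2) by (intro sum.cong) auto
    also have "\<dots> = y j + (\<Sum>l<k. ?z l)" unfolding sum.distrib using j(1) by simp
    finally have "x = y j + (\<Sum>l<k. ?z l)" .
    moreover have "(\<Sum>l<k. ?z l) \<in> B q"
      unfolding B_def using y(1) subspace_0[OF sU[OF _ q]] by (intro CollectI exI[of _ ?z]) simp
    ultimately show "\<exists>a\<in>U j q. \<exists>b\<in>B q. x = a + b" using y(1) j(1) by blast
  qed
  then have "zero_family Q (U j) \<or> zero_family Q B"
    using R unfolding indecomposable_def by (auto dest: spec)
  then have B0: "zero_family Q B" using j(2) by simp
  have "U j q = vobj R q" if q: "q \<in> verts Q" for q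
  proof
    show "U j q \<subseteq> vobj R q" by (rule subrepD(2)[OF sub[OF j(1)] q])
    show "vobj R q \<subseteq> U j q"
    proof
      fix x assume "x \<in> vobj R q"
      then obtain a b where "a \<in> U j q" "b \<in> B q" "x = a + b"
        using direct_sum_2D(4)[OF R' \<open>direct_sum Q R 2 _\<close> q] by simp blast
      then show "x \<in> U j q" using B0 q by (simp add: zero_family_def)
    qed
  qed
  then show thesis using that j(1) by blast
qed

text \<open>One term of the finite direct sum is everything, so an indecomposable in the additive
  image is a retract of a single \<open>T Z\<close>.\<close>

lemma additive_image_indecomposable:
  fixes R :: "('q, 'a, 'f::field, 'v::ab_group_add) vrep" and T :: "'z \<Rightarrow> ('q, 'a, 'f, 'w::ab_group_add) vrep"
  assumes Q: "wf_digraph Q" and R: "indecomposable Q R" and T: "in_additive_image Q T A R"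
  obtains Z i p where "Z \<in> A" "vrep_hom Q R (T Z) i" "vrep_hom Q (T Z) R p"
    "\<And>q x. q \<in> verts Q \<Longrightarrow> x \<in> vobj R q \<Longrightarrow> p q (i q x) = x"
proof -
  obtain k U where U: "direct_sum Q R k U"
    and ZE: "\<forall>i<k. \<exists>Z\<in>A. \<exists>E :: ('q, 'a, 'f, 'w) vrep. is_vrep Q E \<and> vrep_iso Q E (T Z) \<and> direct_summand Q (vrestrict R (U i)) E"
    using T unfolding in_additive_image_def by blast
  obtain j where j: "j < k" "\<And>q. q \<in> verts Q \<Longrightarrow> U j q = vobj R q"
    using direct_sum_indecomposable[OF Q R U] by blast
  obtain Z and E :: "('q, 'a, 'f, 'w) vrep" where Z: "Z \<in> A" and E: "is_vrep Q E" "vrep_iso Q E (T Z)" "direct_summand Q (vrestrict R (U j)) E"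
    using ZE j(1) by blast
  have D: "is_vrep Q (vrestrict R (U j))" using U j(1) by (auto simp: direct_sum_def subrep_def)
  obtain i p where i: "vrep_hom Q (vrestrict R (U j)) E i" and p: "vrep_hom Q E (vrestrict R (U j)) p"
    and pi: "\<And>q x. q \<in> verts Q \<Longrightarrow> x \<in> vobj (vrestrict R (U j)) q \<Longrightarrow> p q (i q x) = x"
    using direct_summandD[OF Q D E(1,3)] by metis
  have "vrep_hom Q (vrestrict R (U j)) E i = vrep_hom Q R E i"
    by (rule vrep_hom_cong(1)[OF Q]) (simp_all add: j(2))
  then have i': "vrep_hom Q R E i" using i by simp
  have "vrep_hom Q E (vrestrict R (U j)) p = vrep_hom Q E R p"
    by (rule vrep_hom_cong(2)[OF Q]) (simp_all add: j(2))
  then have p': "vrep_hom Q E R p" using p by simp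
  obtain h where h: "vrep_hom Q E (T Z) h" "\<And>q. q \<in> verts Q \<Longrightarrow> bij_betw (h q) (vobj E q) (vobj (T Z) q)"
    using E(2) by (auto simp: vrep_iso_iff_hom)
  show thesis
  proof (rule that[OF Z vrep_hom_comp[OF Q i' h(1)] vrep_hom_comp[OF Q vrep_hom_inv[OF Q E(1) h] p']])
    fix q x assume q: "q \<in> verts Q" and x: "x \<in> vobj R q"
    have "linear_betw (vscale R) (vscale E) (vobj R q) (vobj E q) (i q)" using i' q by (simp add: vrep_hom_def)
    from linear_betw_mem[OF this x] show "p q (inv_into (vobj E q) (h q) (h q (i q x))) = x"
      using bij_betw_inv_cancel(1)[OF h(2)[OF q]] pi[OF q] x j(2)[OF q] by simp
  qed
qed

lemma in_additive_imageI:
  assumes Q: "wf_digraph Q" and R: "is_vrep Q R" and Z: "Z \<in> A" "is_vrep Q (T Z)"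
    and i: "vrep_hom Q R (T Z) i" and p: "vrep_hom Q (T Z) R p"
    and pi: "\<And>q x. q \<in> verts Q \<Longrightarrow> x \<in> vobj R q \<Longrightarrow> p q (i q x) = x"
  shows "in_additive_image Q T A R"
proof -
  interpret vector_space "vscale R" using R by (rule is_vrepD)
  have "subrep Q R (vobj R)" using R by (simp add: subrep_def)
  moreover have "\<exists>!y. y \<in> (\<Pi>\<^sub>E i\<in>{..<1::nat}. vobj R q) \<and> x = (\<Sum>i<1. y i)" if "x \<in> vobj R q" for q x
  proof (rule ex1I[of _ "\<lambda>i. if i = 0 then x else undefined"])
    show "y = (\<lambda>i. if i = 0 then x else undefined)"
      if "y \<in> (\<Pi>\<^sub>E i\<in>{..<1::nat}. vobj R q) \<and> x = (\<Sum>i<1. y i)" for y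
      using that by (auto simp: PiE_iff extensional_def fun_eq_iff)
  qed (use that in \<open>auto simp: PiE_iff extensional_def\<close>)
  ultimately have "direct_sum Q R 1 (\<lambda>_. vobj R)" by (simp add: direct_sum_def)
  moreover have "direct_summand Q R (T Z)" by (rule direct_summandI[OF Q R Z(2) i p pi])
  ultimately show ?thesis
    unfolding in_additive_image_def using Z vrep_iso_refl
    by (intro exI[of _ 1] exI[of _ "\<lambda>_. vobj R"]) auto
qed

lemma in_additive_image_iso:
  assumes Q: "wf_digraph Q" and R: "is_vrep Q R" and iso: "vrep_iso Q R D" and Z: "Z \<in> A" "is_vrep Q (T Z)"
    and i: "vrep_hom Q D (T Z) i" and p: "vrep_hom Q (T Z) D p"
    and pi: "\<And>q x. q \<in> verts Q \<Longrightarrow> x \<in> vobj D q \<Longrightarrow> p q (i q x) = x"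
  shows "in_additive_image Q T A R"
proof -
  obtain h where h: "vrep_hom Q R D h" "\<And>q. q \<in> verts Q \<Longrightarrow> bij_betw (h q) (vobj R q) (vobj D q)"
    using iso by (auto simp: vrep_iso_iff_hom)
  show ?thesis
  proof (rule in_additive_imageI[where T = T, OF Q R Z vrep_hom_comp[OF Q h(1) i] vrep_hom_comp[OF Q p vrep_hom_inv[OF Q R h]]])
    fix q x assume q: "q \<in> verts Q" and x: "x \<in> vobj R q"
    show "inv_into (vobj R q) (h q) (p q (i q (h q x))) = x"
      using pi[OF q bij_betw_apply[OF h(2)[OF q] x]] bij_betw_inv_cancel(1)[OF h(2)[OF q] x] by simp
  qed
qed

section \<open>Band representations\<close>

lemma band_rep_simps [simp]:
  "vscale (band_rep n s V \<phi>) = s" "vobj (band_rep n s V \<phi>) q = V"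
  "vmap (band_rep n s V \<phi>) i = (if i = n then \<phi> else id)"
  by (simp_all add: band_rep_def)

lemma is_vrep_band_rep:
  assumes "vector_space s" "fdsub s V" "linear_betw s s V V \<phi>"
  shows "is_vrep (cyc_quiver n fwd) (band_rep n s V \<phi>)"
  using assms by (intro is_vrepI) (auto simp: linear_betw_def)

lemma band_rep_iso:
  assumes "linear_betw s t V W \<epsilon>" "bij_betw \<epsilon> V W" "\<And>x. x \<in> V \<Longrightarrow> \<epsilon> (\<phi> x) = \<phi>' (\<epsilon> x)"
  shows "vrep_iso (cyc_quiver n fwd) (band_rep n s V \<phi>) (band_rep n t W \<phi>')"
  unfolding vrep_iso_def using assms by (intro exI[of _ "\<lambda>_. \<epsilon>"]) auto

text \<open>Constant families of invariant subspaces are subrepresentations, so a decomposition of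
  the module would decompose the band.\<close>

lemma (in aut_module) indec_module_band_rep:
  assumes ind: "indecomposable (cyc_quiver n fwd) (band_rep n scale V \<phi>)"
  shows "indec_module scale V \<phi>"
proof
  have B: "is_vrep (cyc_quiver n fwd) (band_rep n scale V \<phi>)" using ind by (simp add: indecomposable_def)
  show "V \<noteq> {0}" using ind by (auto simp: indecomposable_def zero_family_def)
  fix A C assume *: "subspace A" "subspace C" "A \<subseteq> V" "C \<subseteq> V" "\<phi> ` A \<subseteq> A" "\<phi> ` C \<subseteq> C" "A \<inter> C = {0}"
    "\<And>x. x \<in> V \<Longrightarrow> \<exists>a\<in>A. \<exists>b\<in>C. x = a + b"
  have sub: "subrep (cyc_quiver n fwd) (band_rep n scale V \<phi>) (\<lambda>_. U)" if "subspace U" "U \<subseteq> V" "\<phi> ` U \<subseteq> U" for U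
    by (rule subrepI[OF B wf_cyc_quiver]) (use that in auto)
  have "direct_sum (cyc_quiver n fwd) (band_rep n scale V \<phi>) 2 (\<lambda>i. if i = 0 then (\<lambda>_. A) else (\<lambda>_. C))"
    by (rule direct_sum_2I[OF B sub sub]) (use * in auto)
  then have "zero_family (cyc_quiver n fwd) (\<lambda>_. A) \<or> zero_family (cyc_quiver n fwd) (\<lambda>_. C)"
    using ind unfolding indecomposable_def by (auto dest: spec)
  then show "A = {0} \<or> C = {0}" by (auto simp: zero_family_def)
qed

lemma (in indec_module) indecomposable_loop:
  "indecomposable loop_quiver (band_rep 0 scale V \<phi>)"
proof -
  have B: "is_vrep loop_quiver (band_rep 0 scale V \<phi>)"
    by (rule is_vrep_band_rep[OF vector_space_axioms fdV lin])
  have "zero_family loop_quiver (U 0) \<or> zero_family loop_quiver (U 1)"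
    if U: "direct_sum loop_quiver (band_rep 0 scale V \<phi>) 2 U" for U
  proof -
    note U' = direct_sum_2D[OF B U]
    have "U 0 0 = {0} \<or> U 1 0 = {0}"
    proof (rule indec)
      show "subspace (U 0 0)" "subspace (U 1 0)" "U 0 0 \<subseteq> V" "U 1 0 \<subseteq> V"
        using subrepD(1,2)[OF U'(1), of 0] subrepD(1,2)[OF U'(2), of 0] by simp_all
      show "\<phi> ` U 0 0 \<subseteq> U 0 0" "\<phi> ` U 1 0 \<subseteq> U 1 0"
        using subrepD(3)[OF U'(1), of 0] subrepD(3)[OF U'(2), of 0] by auto
      show "U 0 0 \<inter> U 1 0 = {0}"
        using U'(3)[of 0] subspace_0[of "U 0 0"] subspace_0[of "U 1 0"]
          subrepD(1)[OF U'(1), of 0] subrepD(1)[OF U'(2), of 0] by auto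
      show "\<exists>a\<in>U 0 0. \<exists>b\<in>U 1 0. x = a + b" if "x \<in> V" for x
        using U'(4)[of 0 x] that by simp
    qed
    then show ?thesis by (simp add: zero_family_def)
  qed
  then show ?thesis using B nonzero by (simp add: indecomposable_def zero_family_def)
qed

text \<open>All spaces are identified with the one at vertex 0 by going back through the arrows
  \<open>q - 1\<close> to 0; then \<open>\<phi>\<close> is what arrow \<open>n\<close> becomes.
  Writing it through the tail and the head covers both orientations of that arrow.\<close>

lemma band_transport:
  fixes R :: "(nat, nat, 'f::field, 'v::ab_group_add) vrep"
  assumes R: "is_vrep (cyc_quiver n fwd) R"
    and b: "\<And>a. a \<le> n \<Longrightarrow> bij_betw (vmap R a) (vobj R (tail (cyc_quiver n fwd) a)) (vobj R (head (cyc_quiver n fwd) a))"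
  obtains \<phi> where "aut_module (vscale R) (vobj R 0) \<phi>"
    "vrep_iso (cyc_quiver n fwd) R (band_rep n (vscale R) (vobj R 0) \<phi>)"
proof -
  interpret vector_space "vscale R" using R by (rule is_vrepD)
  let ?V = "vobj R 0"
  \<comment> \<open>A forward arrow \<open>q\<close> points from \<open>q\<close> to
    \<open>Suc q\<close>, so coming back to \<open>q\<close> needs its inverse.\<close>
  define t where "t = rec_nat id (\<lambda>q f. if fwd q then (\<lambda>x. f (inv_into (vobj R q) (vmap R q) x)) else (\<lambda>x. f (vmap R q x)))"
  have t0: "t 0 = id" and tS: "t (Suc q) = (if fwd q then (\<lambda>x. t q (inv_into (vobj R q) (vmap R q) x)) else (\<lambda>x. t q (vmap R q x)))" for q
    by (simp_all add: t_def)
  have sub: "subspace (vobj R q)" if "q \<le> n" for q using is_vrepD(3)[OF R] that by simp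
  have al: "linear_betw (vscale R) (vscale R) (vobj R (tail (cyc_quiver n fwd) a)) (vobj R (head (cyc_quiver n fwd) a)) (vmap R a)"
    if "a \<le> n" for a using is_vrepD(4)[OF R] that by simp
  have t: "linear_betw (vscale R) (vscale R) (vobj R q) ?V (t q) \<and> bij_betw (t q) (vobj R q) ?V" if "q \<le> n" for q
    using that
  proof (induction q)
    case 0 then show ?case by (auto simp: t0 linear_betw_def bij_betw_def)
  next
    case (Suc q)
    then have q: "q \<le> n" "Suc q mod Suc n = Suc q" by simp_all
    from Suc q have IH: "linear_betw (vscale R) (vscale R) (vobj R q) ?V (t q)" "bij_betw (t q) (vobj R q) ?V" by simp_all
    show ?case
    proof (cases "fwd q")
      case True
      then have bq: "bij_betw (vmap R q) (vobj R q) (vobj R (Suc q))"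
        and lq: "linear_betw (vscale R) (vscale R) (vobj R q) (vobj R (Suc q)) (vmap R q)"
        using b[OF q(1)] al[OF q(1)] q(2) by simp_all
      have "linear_betw (vscale R) (vscale R) (vobj R (Suc q)) ?V (\<lambda>x. t q (inv_into (vobj R q) (vmap R q) x))"
        by (rule linear_betw_comp[OF linear_betw_inv[OF lq sub[OF q(1)] bq] IH(1)])
      moreover have "bij_betw (t q \<circ> inv_into (vobj R q) (vmap R q)) (vobj R (Suc q)) ?V"
        by (rule bij_betw_trans[OF bij_betw_inv_into[OF bq] IH(2)])
      ultimately show ?thesis using True by (simp add: tS comp_def)
    next
      case False
      then have bq: "bij_betw (vmap R q) (vobj R (Suc q)) (vobj R q)"
        and lq: "linear_betw (vscale R) (vscale R) (vobj R (Suc q)) (vobj R q) (vmap R q)"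
        using b[OF q(1)] al[OF q(1)] q(2) by simp_all
      have "bij_betw (t q \<circ> vmap R q) (vobj R (Suc q)) ?V" by (rule bij_betw_trans[OF bq IH(2)])
      with linear_betw_comp[OF lq IH(1)] show ?thesis using False by (simp add: tS comp_def)
    qed
  qed
  let ?s = "tail (cyc_quiver n fwd) n" and ?h = "head (cyc_quiver n fwd) n"
  have le: "?s \<le> n" "?h \<le> n" by simp_all
  define \<phi> where "\<phi> x = t ?h (vmap R n (inv_into (vobj R ?s) (t ?s) x))" for x
  have \<phi>_eq: "\<phi> (t ?s x) = t ?h (vmap R n x)" if "x \<in> vobj R ?s" for x
    using bij_betw_inv_cancel(1)[OF conjunct2[OF t[OF le(1)]] that] by (simp add: \<phi>_def del: cyc_quiver_simps)
  have lin: "linear_betw (vscale R) (vscale R) ?V ?V \<phi>"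
    unfolding \<phi>_def
    by (rule linear_betw_comp[OF linear_betw_comp[OF linear_betw_inv[OF _ sub[OF le(1)]] al[OF order_refl]]])
      (use t[OF le(1)] t[OF le(2)] in simp_all)
  have "bij_betw (t ?h \<circ> (vmap R n \<circ> inv_into (vobj R ?s) (t ?s))) ?V ?V"
    by (rule bij_betw_trans[OF bij_betw_trans[OF bij_betw_inv_into b[OF order_refl]]])
      (use t[OF le(1)] t[OF le(2)] in simp_all)
  then have bij: "bij_betw \<phi> ?V ?V" by (simp add: \<phi>_def[abs_def] comp_def del: cyc_quiver_simps)
  have "aut_module (vscale R) ?V \<phi>"
    by unfold_locales (use is_vrepD(2)[OF R] lin bij in auto)
  moreover have "vrep_iso (cyc_quiver n fwd) R (band_rep n (vscale R) ?V \<phi>)"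
    unfolding vrep_iso_def
  proof (intro exI[of _ t] conjI ballI)
    fix q assume "q \<in> verts (cyc_quiver n fwd)"
    then show "linear_betw (vscale R) (vscale (band_rep n (vscale R) ?V \<phi>)) (vobj R q) (vobj (band_rep n (vscale R) ?V \<phi>) q) (t q)"
      "bij_betw (t q) (vobj R q) (vobj (band_rep n (vscale R) ?V \<phi>) q)"
      using t[of q] by simp_all
  next
    fix a x assume a: "a \<in> arcs (cyc_quiver n fwd)" and x: "x \<in> vobj R (tail (cyc_quiver n fwd) a)"
    show "t (head (cyc_quiver n fwd) a) (vmap R a x) = vmap (band_rep n (vscale R) ?V \<phi>) a (t (tail (cyc_quiver n fwd) a) x)"
    proof (cases "a = n")
      case True
      then show ?thesis using \<phi>_eq x by (simp del: cyc_quiver_simps)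
    next
      case False
      with a have "a < n" by simp
      then show ?thesis
        using x bij_betw_inv_cancel(1)[OF b[of a], of x] by (auto simp: tS)
    qed
  qed
  ultimately show thesis by (rule that)
qed

text \<open>\<open>summand_classification\<close> yields a bijection from the quotient to
  \<open>V\<close>. Its inverse carries over to the quotient the finite dimension and the
  indecomposability that \<open>is_band_rep\<close> requires.\<close>

lemma additive_image_string_or_band:
  fixes R :: "(nat, nat, 'f::field, 'v::ab_group_add) vrep"
  assumes ind: "indecomposable (cyc_quiver n fwd) R"
    and img: "in_additive_image (cyc_quiver n fwd)
      (free_rep (cyc_quiver n fwd) :: (nat, nat, 's) srep \<Rightarrow> (nat, nat, 'f, 's \<Rightarrow> 'f) vrep) A R"
    and A: "\<And>Z. Z \<in> A \<Longrightarrow> is_srep (cyc_quiver n fwd) Z"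
  shows "is_string_rep n fwd R \<or>
         (\<exists>f m. (\<exists>z :: 'f alg_closure. root_of_unity z \<and> is_min_poly f z) \<and>
                (if CHAR('f) = 0 then m = 1 else \<exists>k. m = CHAR('f) ^ k) \<and>
                is_band_rep n fwd R smult (poly_quot (f ^ m)) (mult_X (f ^ m)))"
proof (cases "\<forall>a\<le>n. bij_betw (vmap R a) (vobj R (tail (cyc_quiver n fwd) a)) (vobj R (head (cyc_quiver n fwd) a))")
  case False
  then show ?thesis using indecomposable_string_rep[OF ind] by blast
next
  case True
  let ?Q = "cyc_quiver n fwd" and ?V = "vobj R 0"
  note Q = wf_cyc_quiver[of n fwd]
  have R: "is_vrep ?Q R" using ind by (simp add: indecomposable_def)
  obtain \<phi> where aut: "aut_module (vscale R) ?V \<phi>" and iso: "vrep_iso ?Q R (band_rep n (vscale R) ?V \<phi>)"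
    using band_transport[OF R] True by blast
  interpret aut_module "vscale R" ?V \<phi> by (rule aut)
  have B: "is_vrep ?Q (band_rep n (vscale R) ?V \<phi>)"
    by (rule is_vrep_band_rep[OF vector_space_axioms fdV lin])
  have indm: "indec_module (vscale R) ?V \<phi>"
    by (rule indec_module_band_rep[OF indecomposable_iso[OF Q ind B iso]])
  interpret indec_module "vscale R" ?V \<phi> by (rule indm)
  obtain Z i p where Z: "Z \<in> A" and i: "vrep_hom ?Q R (free_rep ?Q Z) i" and p: "vrep_hom ?Q (free_rep ?Q Z) R p"
    and pi: "\<And>q x. q \<in> verts ?Q \<Longrightarrow> x \<in> vobj R q \<Longrightarrow> p q (i q x) = x"
    using additive_image_indecomposable[OF Q ind img] by metis
  obtain h where h: "vrep_hom ?Q R (band_rep n (vscale R) ?V \<phi>) h"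
    "\<And>q. q \<in> verts ?Q \<Longrightarrow> bij_betw (h q) (vobj R q) (vobj (band_rep n (vscale R) ?V \<phi>) q)"
    using iso by (auto simp: vrep_iso_iff_hom)
  let ?h' = "\<lambda>q. inv_into (vobj R q) (h q)"
  \<comment> \<open>Composition with \<open>h\<close> and its inverse replaces \<open>R\<close> by
    the band in the retraction.\<close>
  have fs: "free_summand (vscale R) ?V \<phi> n fwd Z (\<lambda>q x. i q (?h' q x)) (\<lambda>q x. h q (p q x))"
  proof (rule free_summand.intro[OF indm], rule free_summand_axioms.intro)
    show "is_srep ?Q Z" by (rule A[OF Z])
    show "vrep_hom ?Q (band_rep n (vscale R) ?V \<phi>) (free_rep ?Q Z) (\<lambda>q x. i q (?h' q x))"
      by (rule vrep_hom_comp[OF Q vrep_hom_inv[OF Q R h] i])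
    show "vrep_hom ?Q (free_rep ?Q Z) (band_rep n (vscale R) ?V \<phi>) (\<lambda>q x. h q (p q x))"
      by (rule vrep_hom_comp[OF Q p h(1)])
    fix q x assume q: "q \<le> n" and x: "x \<in> ?V"
    have b: "bij_betw (h q) (vobj R q) ?V" using h(2)[of q] q by simp
    have "?h' q x \<in> vobj R q" using b x by (metis bij_betw_def inv_into_into)
    then show "h q (p q (i q (?h' q x))) = x" using pi[of q] q bij_betw_inv_cancel(2)[OF b x] by simp
  qed
  obtain f m \<epsilon> where fm: "\<exists>z :: 'f alg_closure. root_of_unity z \<and> is_min_poly f z"
    "if CHAR('f) = 0 then m = 1 else \<exists>k. m = CHAR('f) ^ k"
    and \<epsilon>: "linear_betw smult (vscale R) (poly_quot (f ^ m)) ?V \<epsilon>" "bij_betw \<epsilon> (poly_quot (f ^ m)) ?V"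
    "\<And>q. q \<in> poly_quot (f ^ m) \<Longrightarrow> \<epsilon> (mult_X (f ^ m) q) = \<phi> (\<epsilon> q)"
    using free_summand.summand_classification[OF fs] by metis
  let ?W = "poly_quot (f ^ m)" and ?\<mu> = "mult_X (f ^ m)"
  interpret poly: vector_space "smult :: 'f \<Rightarrow> 'f poly \<Rightarrow> 'f poly"
    by unfold_locales (simp_all add: smult_add_right smult_add_left)
  have poly_vs: "vector_space (smult :: 'f \<Rightarrow> 'f poly \<Rightarrow> 'f poly)" ..
  have W: "poly.subspace ?W"
  proof (rule poly.subspaceI)
    show "0 \<in> ?W" unfolding poly_quot_def by (rule range_eqI[of _ _ 0]) simp
  qed (auto simp: poly_quot_def poly_mod_add_left[symmetric] mod_smult_left[symmetric])
  let ?\<epsilon>' = "inv_into ?W \<epsilon>"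
  have \<epsilon>': "linear_betw (vscale R) smult ?V ?W ?\<epsilon>'" by (rule poly.linear_betw_inv[OF \<epsilon>(1) W \<epsilon>(2)])
  have b': "bij_betw ?\<epsilon>' ?V ?W" by (rule bij_betw_inv_into[OF \<epsilon>(2)])
  have \<mu>W: "?\<mu> q \<in> ?W" for q by (simp add: mult_X_def poly_quot_def)
  have int: "?\<epsilon>' (\<phi> x) = ?\<mu> (?\<epsilon>' x)" if x: "x \<in> ?V" for x
  proof -
    have w: "?\<epsilon>' x \<in> ?W" using linear_betw_mem[OF \<epsilon>' x] .
    have "\<epsilon> (?\<mu> (?\<epsilon>' x)) = \<phi> x" using \<epsilon>(3)[OF w] bij_betw_inv_cancel(2)[OF \<epsilon>(2) x] by simp
    then show ?thesis using bij_betw_inv_cancel(1)[OF \<epsilon>(2) \<mu>W, of "?\<epsilon>' x"] by simp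
  qed
  have "?\<epsilon>' ` ?V = ?W" using b' by (simp add: bij_betw_def)
  then have fdW: "fdsub smult ?W" using fdsub_image[OF vector_space_axioms poly_vs fdV \<epsilon>'] by simp
  have \<mu>_lin: "linear_betw smult smult ?W ?W ?\<mu>"
    by (rule linear_betwI[OF \<mu>W])
      (simp_all only: mult_X_def distrib_left poly_mod_add_left mult_smult_right mod_smult_left)
  have "bij_betw (?\<epsilon>' \<circ> (\<phi> \<circ> \<epsilon>)) ?W ?W"
    by (intro bij_betw_trans[OF bij_betw_trans[OF \<epsilon>(2) bij] b'])
  then have "bij_betw ?\<mu> ?W ?W"
  proof (rule bij_betw_cong[THEN iffD1, rotated])
    fix q assume q: "q \<in> ?W"
    show "(?\<epsilon>' \<circ> (\<phi> \<circ> \<epsilon>)) q = ?\<mu> q"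
      using int[OF linear_betw_mem[OF \<epsilon>(1) q]] bij_betw_inv_cancel(1)[OF \<epsilon>(2) q] by simp
  qed
  moreover have "vrep_iso ?Q R (band_rep n smult ?W ?\<mu>)"
    by (rule vrep_iso_trans[OF Q iso band_rep_iso[where \<phi> = \<phi> and \<phi>' = ?\<mu>, OF \<epsilon>' b' int]])
  moreover have "indecomposable loop_quiver (band_rep 0 smult ?W ?\<mu>)"
    by (rule indecomposable_iso[OF wf_cyc_quiver indecomposable_loop is_vrep_band_rep[OF poly_vs fdW \<mu>_lin]
          band_rep_iso[where \<phi> = \<phi> and \<phi>' = ?\<mu>, OF \<epsilon>' b' int]])
  ultimately show ?thesis using fm unfolding is_band_rep_def by blast
qed

text \<open>The pointed set of a string, with its base point \<open>0\<close> regarded as an ordinary element. The free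
  representation on it splits into the string representation and the span of \<open>0\<close>.\<close>

definition string_srep :: "nat \<Rightarrow> (nat \<Rightarrow> bool) \<Rightarrow> nat \<Rightarrow> nat \<Rightarrow> (nat, nat, nat) srep" where
  "string_srep n fwd c m =
    \<lparr> sobj = (\<lambda>q. insert 0 {l \<in> {1..m}. (c + l) mod Suc n = q}),
      smap = (\<lambda>i x. if fwd i then (if 1 \<le> x \<and> x < m then x + 1 else 0) else x - 1) \<rparr>"

lemma is_srep_string_srep: "is_srep (cyc_quiver n fwd) (string_srep n fwd c m)"
  unfolding is_srep_def
proof (intro conjI ballI)
  fix a assume "a \<in> arcs (cyc_quiver n fwd)"
  then have a: "a \<le> n" by simp
  show "smap (string_srep n fwd c m) a ` sobj (string_srep n fwd c m) (tail (cyc_quiver n fwd) a)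
      \<subseteq> sobj (string_srep n fwd c m) (head (cyc_quiver n fwd) a)"
  proof
    fix y assume "y \<in> smap (string_srep n fwd c m) a ` sobj (string_srep n fwd c m) (tail (cyc_quiver n fwd) a)"
    then obtain x where x: "x \<in> sobj (string_srep n fwd c m) (tail (cyc_quiver n fwd) a)"
      "y = smap (string_srep n fwd c m) a x" by blast
    show "y \<in> sobj (string_srep n fwd c m) (head (cyc_quiver n fwd) a)"
    proof (cases "y = 0")
      case False
      show ?thesis
      proof (cases "fwd a")
        case True
        then have "1 \<le> x" "x < m" "y = Suc x" "(c + x) mod Suc n = a"
          using x False by (auto simp: string_srep_def split: if_splits)
        moreover from this have "Suc (c + x) mod Suc n = Suc a mod Suc n" using a by (simp add: Suc_mod_eq_iff)
        ultimately show ?thesis using True by (simp add: string_srep_def)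
      next
        case fw: False
        then have *: "x \<le> m" "x = Suc y" "(c + x) mod Suc n = Suc a mod Suc n"
          using x False by (auto simp: string_srep_def split: if_splits)
        then have "(c + y) mod Suc n = a" using a by (simp add: Suc_mod_eq_iff)
        then show ?thesis using fw False * by (simp add: string_srep_def)
      qed
    qed (simp add: string_srep_def)
  qed
qed (simp add: string_srep_def)

text \<open>The condition \<open>2 \<le> l\<close> excludes the neighbour 0 of position 1. Here 0 is
  an element whose coefficient need not vanish, but it is mapped to 0 and so contributes nothing to
  \<open>l\<close>.\<close>

lemma free_map_string_srep:
  assumes e: "e \<in> free_obj (sobj (string_srep n fwd c m) (tail (cyc_quiver n fwd) a))" and l: "1 \<le> l"
  shows "free_map (sobj (string_srep n fwd c m) (tail (cyc_quiver n fwd) a)) (smap (string_srep n fwd c m) a) e l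
    = (if l \<le> m \<and> (fwd a \<longrightarrow> 2 \<le> l) then e (if fwd a then l - 1 else l + 1) else 0)"
proof -
  let ?S = "sobj (string_srep n fwd c m) (tail (cyc_quiver n fwd) a)"
  let ?k = "if fwd a then l - 1 else l + 1"
  define T where "T = {x \<in> ?S. smap (string_srep n fwd c m) a x = l}"
  have eq: "free_map ?S (smap (string_srep n fwd c m) a) e l = sum e T"
    by (simp add: free_map_def T_def del: cyc_quiver_simps)
  show ?thesis
  proof (cases "l \<le> m \<and> (fwd a \<longrightarrow> 2 \<le> l) \<and> ?k \<in> ?S")
    case True
    have "T \<subseteq> {?k}"
      using l unfolding T_def string_srep_def by (auto split: if_splits)
    moreover have "smap (string_srep n fwd c m) a ?k = l"
      using True l by (auto simp: string_srep_def)
    ultimately have "T = {?k}" using True unfolding T_def by blast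
    then show ?thesis unfolding eq using True by simp
  next
    case False
    have "T = {}"
    proof -
      have False if x: "x \<in> ?S" "smap (string_srep n fwd c m) a x = l" for x
      proof -
        have "x = ?k" "l \<le> m \<and> (fwd a \<longrightarrow> 2 \<le> l)"
          using x l by (auto simp: string_srep_def split: if_splits)
        with False x(1) show False by simp
      qed
      then show ?thesis unfolding T_def by blast
    qed
    moreover have "e ?k = 0" if "?k \<notin> ?S" using e that by (simp add: free_obj_def del: cyc_quiver_simps)
    ultimately show ?thesis unfolding eq using False by auto
  qed
qed

lemma string_in_additive_image:
  fixes R :: "(nat, nat, 'f::field, 'v::ab_group_add) vrep"
  assumes R: "is_vrep (cyc_quiver n fwd) R" and iso: "vrep_iso (cyc_quiver n fwd) R (string_rep n fwd c m)"
  shows "in_additive_image (cyc_quiver n fwd)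
    (free_rep (cyc_quiver n fwd) :: (nat, nat, nat) srep \<Rightarrow> (nat, nat, 'f, nat \<Rightarrow> 'f) vrep)
    (set_reps (cyc_quiver n fwd)) R"
proof -
  let ?Q = "cyc_quiver n fwd" and ?Z = "string_srep n fwd c m"
  let ?T = "free_rep ?Q :: (nat, nat, nat) srep \<Rightarrow> (nat, nat, 'f, nat \<Rightarrow> 'f) vrep"
  let ?S = "string_rep n fwd c m :: (nat, nat, 'f, nat option \<Rightarrow> 'f) vrep"
  have Zs: "is_srep ?Q ?Z" by (rule is_srep_string_srep)
  have T_simps: "vscale (?T ?Z) = (\<lambda>r c x. r * c x)" "vobj (?T ?Z) q = free_obj (sobj ?Z q)"
    "vmap (?T ?Z) a = free_map (sobj ?Z (tail ?Q a)) (smap ?Z a)" for q a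
    by (simp_all add: free_rep_def)
  \<comment> \<open>The coefficient at 0 makes the total vanish. Pushing forward along a map of sets
    preserves the total, so the coefficient at 0 comes out right at the head of each arrow.\<close>
  define \<iota> :: "nat \<Rightarrow> (nat option \<Rightarrow> 'f) \<Rightarrow> nat \<Rightarrow> 'f" where
    "\<iota> q b x = (if x = 0 then - (\<Sum>l\<in>{1..m}. b (Some l)) else b (Some x))" for q b x
  define \<rho> :: "nat \<Rightarrow> (nat \<Rightarrow> 'f) \<Rightarrow> nat option \<Rightarrow> 'f" where
    "\<rho> q e o' = (case o' of None \<Rightarrow> 0 | Some l \<Rightarrow> if 1 \<le> l then e l else 0)" for q e o'
  have \<iota>_mem: "\<iota> q b \<in> free_obj (sobj ?Z q)" if "b \<in> vobj ?S q" for q b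
    using that by (auto simp: free_obj_def \<iota>_def string_rep_vobj string_srep_def)
  have \<iota>: "vrep_hom ?Q ?S (?T ?Z) \<iota>"
    unfolding vrep_hom_def T_simps
  proof (intro conjI ballI)
    show "linear_betw (vscale ?S) (\<lambda>r c x. r * c x) (vobj ?S q) (free_obj (sobj ?Z q)) (\<iota> q)" for q
      using \<iota>_mem by (intro linear_betwI) (auto simp: \<iota>_def fun_eq_iff sum.distrib sum_distrib_left)
    fix a b assume a: "a \<in> arcs ?Q" and b: "b \<in> vobj ?S (tail ?Q a)"
    let ?A = "sobj ?Z (tail ?Q a)" and ?B = "sobj ?Z (head ?Q a)"
    define w where "w = free_map ?A (smap ?Z a) (\<iota> (tail ?Q a) b)"
    have wl: "w l = vmap ?S a b (Some l)" if l: "1 \<le> l" for l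
      unfolding w_def free_map_string_srep[OF \<iota>_mem[OF b] l] string_rep_vmap[OF b]
      using l string_rep_vobjD(2)[OF b, of 0] by (auto simp: \<iota>_def)
    have total0: "(\<Sum>x\<in>?A. \<iota> (tail ?Q a) b x) = 0"
    proof -
      have "(\<Sum>x\<in>?A. \<iota> (tail ?Q a) b x) = (\<Sum>x\<in>insert 0 {1..m}. \<iota> (tail ?Q a) b x)"
        using string_rep_vobjD(2)[OF b]
        by (intro sum.mono_neutral_left) (auto simp: string_srep_def \<iota>_def)
      also have "\<dots> = 0" by (simp add: \<iota>_def)
      finally show ?thesis .
    qed
    have B: "finite ?B" "finite ?A" "smap ?Z a ` ?A \<subseteq> ?B"
      using Zs a unfolding is_srep_def by (auto simp del: cyc_quiver_simps(3,4) simp: string_srep_def)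
    have "(\<Sum>y\<in>?B. w y) = (\<Sum>x\<in>?A. \<iota> (tail ?Q a) b x)"
      unfolding w_def by (rule free_map_sum[OF B(2,1,3), of "\<lambda>_ x. x"]) simp_all
    then have "(\<Sum>y\<in>?B. w y) = 0" using total0 by simp
    moreover have "(\<Sum>y\<in>?B. w y) = (\<Sum>y\<in>insert 0 {1..m}. w y)"
    proof (rule sum.mono_neutral_left)
      have "vmap ?S a b \<in> vobj ?S (head ?Q a)"
        using linear_betw_mem[OF is_vrepD(4)[OF is_vrep_string_rep a] b] .
      then show "\<forall>y\<in>insert 0 {1..m} - ?B. w y = 0"
        using wl string_rep_vobjD(2) by (fastforce simp: string_srep_def)
    qed (auto simp: string_srep_def)
    ultimately have w0: "w 0 = - (\<Sum>l\<in>{1..m}. vmap ?S a b (Some l))"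
      using wl by (simp add: eq_neg_iff_add_eq_0)
    show "\<iota> (head ?Q a) (vmap ?S a b) = free_map ?A (smap ?Z a) (\<iota> (tail ?Q a) b)"
      unfolding w_def[symmetric] using w0 wl by (auto simp: \<iota>_def fun_eq_iff)
  qed
  have \<rho>: "vrep_hom ?Q (?T ?Z) ?S \<rho>"
    unfolding vrep_hom_def T_simps
  proof (intro conjI ballI)
    have \<rho>_mem: "\<rho> q e \<in> vobj ?S q" if "e \<in> free_obj (sobj ?Z q)" for q e
      using that by (auto simp: free_obj_def \<rho>_def string_rep_vobj string_srep_def)
    show "linear_betw (\<lambda>r c x. r * c x) (vscale ?S) (free_obj (sobj ?Z q)) (vobj ?S q) (\<rho> q)" for q
      using \<rho>_mem by (intro linear_betwI) (auto simp: \<rho>_def fun_eq_iff split: option.split)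
    fix a and e :: "nat \<Rightarrow> 'f"
    assume a: "a \<in> arcs ?Q" and e: "e \<in> free_obj (sobj ?Z (tail ?Q a))"
    show "\<rho> (head ?Q a) (free_map (sobj ?Z (tail ?Q a)) (smap ?Z a) e) = vmap ?S a (\<rho> (tail ?Q a) e)"
      unfolding string_rep_vmap[OF \<rho>_mem[OF e]]
    proof
      fix o'
      show "\<rho> (head ?Q a) (free_map (sobj ?Z (tail ?Q a)) (smap ?Z a) e) o' = (case o' of None \<Rightarrow> 0
        | Some l \<Rightarrow> if 1 \<le> l \<and> l \<le> m then \<rho> (tail ?Q a) e (Some (if fwd a then l - 1 else l + 1)) else 0)"
      proof (cases o')
        case (Some l)
        then show ?thesis
          using free_map_string_srep[OF e, of l] by (cases "1 \<le> l") (auto simp: \<rho>_def simp del: cyc_quiver_simps)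
      qed (simp add: \<rho>_def)
    qed
  qed
  show ?thesis
  proof (rule in_additive_image_iso[where T = ?T, OF wf_cyc_quiver R iso _ is_vrep_free_rep[OF Zs wf_cyc_quiver] \<iota> \<rho>])
    show "?Z \<in> set_reps ?Q" using Zs by (simp add: set_reps_def)
    fix q b assume "b \<in> vobj ?S q"
    from string_rep_vobjD[OF this] show "\<rho> q (\<iota> q b) = b"
      by (auto simp: \<rho>_def \<iota>_def fun_eq_iff split: option.split)
  qed
qed

section \<open>Free representations on cycles, and bands as their retracts\<close>

definition cycle_srep :: "nat \<Rightarrow> nat \<Rightarrow> (nat, nat, nat) srep" where
  "cycle_srep n g = \<lparr> sobj = (\<lambda>_. {..<g}), smap = (\<lambda>i x. if i = n then Suc x mod g else x) \<rparr>"

lemma is_srep_cycle_srep: "0 < g \<Longrightarrow> is_srep (cyc_quiver n fwd) (cycle_srep n g)"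
  by (auto simp: is_srep_def cycle_srep_def)

lemma free_map_cycle:
  assumes "e \<in> free_obj {..<Suc i}"
  shows "free_map {..<Suc i} (\<lambda>x. Suc x mod Suc i) e = (\<lambda>x. case x of 0 \<Rightarrow> e i | Suc j \<Rightarrow> if j < i then e j else 0)"
proof
  fix x
  show "free_map {..<Suc i} (\<lambda>x. Suc x mod Suc i) e x = (case x of 0 \<Rightarrow> e i | Suc j \<Rightarrow> if j < i then e j else 0)"
  proof (cases x)
    case 0
    have "{y \<in> {..<Suc i}. Suc y mod Suc i = x} = {i}" unfolding 0 by (auto simp: mod_Suc split: if_splits)
    then show ?thesis using 0 by (simp add: free_map_def)
  next
    case (Suc j)
    have "{y \<in> {..<Suc i}. Suc y mod Suc i = x} = (if j < i then {j} else {})"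
      unfolding Suc by (auto simp: mod_Suc split: if_splits)
    then show ?thesis using Suc by (simp add: free_map_def)
  qed
qed

lemma free_map_id:
  assumes "e \<in> free_obj A"
  shows "free_map A (\<lambda>x. x) e = e"
proof
  fix y
  have "{x \<in> A. x = y} = (if y \<in> A then {y} else {})" by auto
  then show "free_map A (\<lambda>x. x) e y = e y" using assms by (simp add: free_map_def free_obj_def)
qed

lemma degree_cyclo: "0 < g \<Longrightarrow> degree (cyclo g :: 'f::field poly) = g"
proof -
  assume g: "0 < g"
  have "degree (monom (1::'f) g + (- 1)) = degree (monom (1::'f) g)"
    by (rule degree_add_eq_left) (use g in \<open>simp add: degree_monom_eq\<close>)
  then show ?thesis by (simp add: cyclo_def degree_monom_eq)
qed

text \<open>With \<open>a * H + b * h' = 1\<close>, the element \<open>b * h'\<close> is idempotent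
  modulo \<open>cyclo g\<close>: it is 1 modulo \<open>H\<close> and 0 modulo \<open>h'\<close>.
  Multiplying by it embeds \<open>F[X]/(H)\<close> into \<open>F[X]/(X^g - 1)\<close>, and reduction
  modulo \<open>H\<close> is a retraction.\<close>

lemma band_in_additive_image:
  fixes R :: "(nat, nat, 'f::field, 'v::ab_group_add) vrep" and H h' :: "'f poly"
  assumes R: "is_vrep (cyc_quiver n fwd) R"
    and iso: "vrep_iso (cyc_quiver n fwd) R (band_rep n smult (poly_quot H) (mult_X H))"
    and g: "0 < g" and eq: "cyclo g = H * h'" and co: "comaximal H h'"
  shows "in_additive_image (cyc_quiver n fwd)
    (free_rep (cyc_quiver n fwd) :: (nat, nat, nat) srep \<Rightarrow> (nat, nat, 'f, nat \<Rightarrow> 'f) vrep)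
    (set_reps (cyc_quiver n fwd)) R"
proof -
  let ?Q = "cyc_quiver n fwd" and ?Z = "cycle_srep n g" and ?C = "cyclo g :: 'f poly"
  let ?T = "free_rep ?Q :: (nat, nat, nat) srep \<Rightarrow> (nat, nat, 'f, nat \<Rightarrow> 'f) vrep"
  have Zs: "is_srep ?Q ?Z" by (rule is_srep_cycle_srep[OF g])
  obtain i where i: "g = Suc i" using g by (cases g) auto
  obtain a b where ab: "a * H + b * h' = 1" using co by (auto simp: comaximal_def)
  define shift :: "(nat \<Rightarrow> 'f) \<Rightarrow> nat \<Rightarrow> 'f" where
    "shift e = (\<lambda>x. case x of 0 \<Rightarrow> e i | Suc j \<Rightarrow> if j < i then e j else 0)" for e
  have T_simps: "vscale (?T ?Z) = (\<lambda>r c x. r * c x)" "vobj (?T ?Z) q = free_obj {..<g}" for q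
    by (simp_all add: free_rep_def cycle_srep_def)
  have T_map: "vmap (?T ?Z) k e = (if k = n then shift e else e)" if "e \<in> free_obj {..<g}" for k e
    using that free_map_cycle[of e i] free_map_id[of e "{..<g}"]
    by (simp add: free_rep_def cycle_srep_def i shift_def)
  \<comment> \<open>Functions on \<open>{..<g}\<close> are read as polynomials of degree below
    \<open>g\<close>, the reduced representatives modulo \<open>cyclo g\<close>; rotation becomes
    multiplication by \<open>X\<close>.\<close>
  define pol :: "(nat \<Rightarrow> 'f) \<Rightarrow> 'f poly" where "pol e = (\<Sum>j<g. monom (e j) j)" for e
  have coeff_pol: "coeff (pol e) j = (if j < g then e j else 0)" for e j
    by (simp add: pol_def coeff_sum)
  have pol_add: "pol (\<lambda>x. e x + e' x) = pol e + pol e'" and pol_scale: "pol (\<lambda>x. c * e x) = smult c (pol e)" for e e' c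
    by (simp_all add: poly_eq_iff coeff_pol)
  have pol_shift: "pol (shift e) = [:0, 1:] * pol e - smult (e i) ?C" for e
  proof (rule poly_eqI)
    fix x
    show "coeff (pol (shift e)) x = coeff ([:0, 1:] * pol e - smult (e i) ?C) x"
      by (cases x) (auto simp: coeff_pol shift_def i cyclo_def less_Suc_eq)
  qed
  have mod_deg: "coeff (p mod ?C) j = 0" if "g \<le> j" for p j
    using degree_mod_less[of ?C p] cyclo_nonzero[OF g, where ?'a = 'f] degree_cyclo[OF g, where ?'f = 'f] that
    by (auto intro: coeff_eq_0)
  have pol_mod: "pol (coeff (p mod ?C)) = p mod ?C" for p
    by (rule poly_eqI) (use mod_deg in \<open>auto simp: coeff_pol\<close>)
  have pol_less: "pol e mod ?C = pol e" for e
  proof (rule mod_poly_less)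
    have "degree (pol e) \<le> i" by (rule degree_le) (simp add: coeff_pol i)
    then show "degree (pol e) < degree ?C" using degree_cyclo[OF g, where ?'f = 'f] i by simp
  qed
  have pol_inj: "e = e'" if "e \<in> free_obj {..<g}" "e' \<in> free_obj {..<g}" "pol e = pol e'" for e e'
  proof
    fix x
    have "coeff (pol e) x = coeff (pol e') x" using that(3) by simp
    then show "e x = e' x"
      using that(1,2) by (cases "x < g") (simp_all add: coeff_pol free_obj_def)
  qed
  have shift_mem: "shift e \<in> free_obj {..<g}" for e
    by (auto simp: free_obj_def shift_def i split: nat.split)
  define \<iota> :: "nat \<Rightarrow> 'f poly \<Rightarrow> nat \<Rightarrow> 'f" where "\<iota> q u = coeff ((u * (b * h')) mod ?C)" for q u
  define \<rho> :: "nat \<Rightarrow> (nat \<Rightarrow> 'f) \<Rightarrow> 'f poly" where "\<rho> q e = pol e mod H" for q e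
  have \<iota>_mem: "\<iota> q u \<in> free_obj {..<g}" for q u
    using mod_deg by (auto simp: \<iota>_def free_obj_def)
  have \<iota>_shift: "\<iota> q (mult_X H u) = shift (\<iota> q' u)" for q q' u
  proof (rule pol_inj[OF \<iota>_mem shift_mem])
    \<comment> \<open>\<open>mult_X H u\<close> differs from \<open>X * u\<close> by a multiple of
      \<open>H\<close>, which the factor \<open>h'\<close> turns into a multiple of
      \<open>cyclo g\<close>.\<close>
    have "?C dvd mult_X H u * (b * h') - [:0, 1:] * (u * (b * h'))"
    proof -
      have "H dvd mult_X H u - [:0, 1:] * u" unfolding mult_X_def by (simp add: mod_eq_dvd_iff[symmetric])
      then obtain t where "mult_X H u - [:0, 1:] * u = H * t" ..
      then have "(mult_X H u - [:0, 1:] * u) * (b * h') = ?C * (t * b)" unfolding eq by simp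
      then show ?thesis by (simp add: left_diff_distrib mult.assoc)
    qed
    then have *: "(mult_X H u * (b * h')) mod ?C = ([:0, 1:] * (u * (b * h'))) mod ?C"
      by (simp only: mod_eq_dvd_iff)
    have "pol (\<iota> q (mult_X H u)) = (mult_X H u * (b * h')) mod ?C"
      by (simp only: \<iota>_def pol_mod)
    also have "\<dots> = ([:0, 1:] * (u * (b * h'))) mod ?C" by (rule *)
    also have "\<dots> = ([:0, 1:] * pol (\<iota> q' u)) mod ?C"
      unfolding \<iota>_def pol_mod by (rule mod_mult_right_eq[symmetric])
    also have "\<dots> = pol (shift (\<iota> q' u)) mod ?C"
      unfolding pol_shift mod_eq_dvd_iff by (simp add: dvd_smult)
    finally show "pol (\<iota> q (mult_X H u)) = pol (shift (\<iota> q' u))"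
      unfolding pol_less .
  qed
  have \<rho>_shift: "\<rho> q (shift e) = mult_X H (\<rho> q' e)" for q q' e
  proof -
    have "H dvd ?C" unfolding eq by simp
    then have "pol (shift e) mod H = ([:0, 1:] * pol e) mod H"
      unfolding pol_shift mod_eq_dvd_iff by (simp add: dvd_smult)
    then show ?thesis unfolding \<rho>_def mult_X_def by (simp only: mod_mult_right_eq)
  qed
  have \<iota>: "vrep_hom ?Q (band_rep n smult (poly_quot H) (mult_X H)) (?T ?Z) \<iota>"
    unfolding vrep_hom_def T_simps
  proof (intro conjI ballI)
    show "linear_betw (vscale (band_rep n smult (poly_quot H) (mult_X H))) (\<lambda>r c x. r * c x)
        (vobj (band_rep n smult (poly_quot H) (mult_X H)) q) (free_obj {..<g}) (\<iota> q)" for q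
      using \<iota>_mem by (intro linear_betwI)
        (simp_all add: \<iota>_def fun_eq_iff distrib_right poly_mod_add_left mod_smult_left)
    fix k u
    show "\<iota> (head ?Q k) (vmap (band_rep n smult (poly_quot H) (mult_X H)) k u) = vmap (?T ?Z) k (\<iota> (tail ?Q k) u)"
      unfolding T_map[OF \<iota>_mem] using \<iota>_shift by (simp add: \<iota>_def)
  qed
  have \<rho>: "vrep_hom ?Q (?T ?Z) (band_rep n smult (poly_quot H) (mult_X H)) \<rho>"
    unfolding vrep_hom_def T_simps
  proof (intro conjI ballI)
    show "linear_betw (\<lambda>r c x. r * c x) (vscale (band_rep n smult (poly_quot H) (mult_X H))) (free_obj {..<g})
        (vobj (band_rep n smult (poly_quot H) (mult_X H)) q) (\<rho> q)" for q
      by (intro linear_betwI)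
        (simp_all add: \<rho>_def pol_add pol_scale poly_mod_add_left mod_smult_left plus_fun_def poly_quot_def)
    fix k and e :: "nat \<Rightarrow> 'f"
    assume "e \<in> free_obj {..<g}"
    then show "\<rho> (head ?Q k) (vmap (?T ?Z) k e) = vmap (band_rep n smult (poly_quot H) (mult_X H)) k (\<rho> (tail ?Q k) e)"
      using \<rho>_shift by (simp add: T_map \<rho>_def)
  qed
  show ?thesis
  proof (rule in_additive_image_iso[where T = ?T, OF wf_cyc_quiver R iso _ is_vrep_free_rep[OF Zs wf_cyc_quiver] \<iota> \<rho>])
    show "?Z \<in> set_reps ?Q" using Zs by (simp add: set_reps_def)
    fix q u assume "u \<in> vobj (band_rep n smult (poly_quot H) (mult_X H)) q"
    then have u: "u mod H = u" by (auto simp: poly_quot_def)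
    have "b * h' = 1 - a * H" using ab by (simp add: algebra_simps)
    then have "u * (b * h') = u * (1 - a * H)" by (simp only:)
    then have *: "u * (b * h') = u - H * (u * a)" by (simp add: algebra_simps)
    have "(u * (b * h')) mod ?C mod H = (u * (b * h')) mod H"
      by (rule mod_mod_cancel) (simp add: eq)
    also have "\<dots> = u mod H" unfolding * by (simp add: mod_eq_dvd_iff)
    finally show "\<rho> q (\<iota> q u) = u" by (simp add: \<rho>_def \<iota>_def pol_mod u)
  qed
qed

theorem theorem8p6:
  fixes n :: nat and fwd :: "nat \<Rightarrow> bool"
    and R :: "(nat, nat, 'f::field, 'v::ab_group_add) vrep"
  defines "Q \<equiv> cyc_quiver n fwd"
  assumes "is_vrep Q R" and "indecomposable Q R"
  shows "in_additive_image Q (free_rep Q :: (nat, nat, nat) srep \<Rightarrow> (nat, nat, 'f, nat \<Rightarrow> 'f) vrep)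
           (set_reps Q) R \<longleftrightarrow>
         is_string_rep n fwd R \<or>
         (\<exists>f m. (\<exists>z :: 'f alg_closure. root_of_unity z \<and> is_min_poly f z) \<and>
                (if CHAR('f) = 0 then m = 1 else \<exists>k. m = CHAR('f) ^ k) \<and>
                is_band_rep n fwd R smult (poly_quot (f ^ m)) (mult_X (f ^ m)))"
proof
  note ind = assms(3)[unfolded Q_def] and R = assms(2)[unfolded Q_def]
  show "is_string_rep n fwd R \<or>
         (\<exists>f m. (\<exists>z :: 'f alg_closure. root_of_unity z \<and> is_min_poly f z) \<and>
                (if CHAR('f) = 0 then m = 1 else \<exists>k. m = CHAR('f) ^ k) \<and>
                is_band_rep n fwd R smult (poly_quot (f ^ m)) (mult_X (f ^ m)))"
    if "in_additive_image Q (free_rep Q :: (nat, nat, nat) srep \<Rightarrow> (nat, nat, 'f, nat \<Rightarrow> 'f) vrep) (set_reps Q) R"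
    using additive_image_string_or_band[OF ind that[unfolded Q_def]] by (simp add: set_reps_def)
  assume "is_string_rep n fwd R \<or>
         (\<exists>f m. (\<exists>z :: 'f alg_closure. root_of_unity z \<and> is_min_poly f z) \<and>
                (if CHAR('f) = 0 then m = 1 else \<exists>k. m = CHAR('f) ^ k) \<and>
                is_band_rep n fwd R smult (poly_quot (f ^ m)) (mult_X (f ^ m)))"
  then show "in_additive_image Q (free_rep Q :: (nat, nat, nat) srep \<Rightarrow> (nat, nat, 'f, nat \<Rightarrow> 'f) vrep) (set_reps Q) R"
  proof (elim disjE exE conjE)
    assume "is_string_rep n fwd R"
    then show ?thesis unfolding Q_def is_string_rep_def using string_in_additive_image[OF R] by blast
  next
    fix f m and z :: "'f alg_closure"
    assume z: "root_of_unity z" "is_min_poly f z" and m: "if CHAR('f) = 0 then m = 1 else \<exists>k. m = CHAR('f) ^ k"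
      and band: "is_band_rep n fwd R smult (poly_quot (f ^ m)) (mult_X (f ^ m))"
    \<comment> \<open>Being a comaximal factor of some \<open>cyclo g\<close> is all that the band
      needs to be a retract.\<close>
    obtain g h' where "0 < g" "cyclo g = f ^ m * h'" "comaximal (f ^ m) h'"
      by (rule min_poly_primary_factor[OF z m])
    then show ?thesis unfolding Q_def
      using band_in_additive_image[OF R] band unfolding is_band_rep_def by blast
  qed
qed

end
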